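(* Let $A,u\in\Lambda(2)$ with $A\cdot u=2$, let $A_2=\{y\in\Lambda(2): y\cdot A=2,\ y\cdot u=1\}$, $W=\mathrm{span}\{A,u\}$, and let $\widehat A_2=N_W(A_2)\subset\mathbb S^{21}$ (a $2816$-point antipodal code). Let $B_{1408}$ be the set of $1408$ lines through the origin in $\mathbb R^{22}$ spanned by the antipodal pairs of points of $\widehat A_2$. Then $B_{1408}$ is universally optimal in the real projective space $\mathbb{RP}^{21}$.
   Context: $\Lambda_{24}$ is the Leech lattice normalized as the unique even unimodular lattice in $\mathbb R^{24}$ with no vectors of squared length $2$; $\Lambda(k)=\{x\in\Lambda_{24}:|x|^2=2k\}$. For a linear subspace $W\subset\mathbb R^{24}$ with orthogonal projection $P_W$, $N_W(x)=(x-P_Wx)/|x-P_Wx|$, a point of the unit sphere of $W^\perp$ ($\cong\mathbb S^{21}$ via a linear isometry), and $N_W(X)=\{N_W(x):x\in X\}$. A configuration of $N$ lines in $\mathbb R^{n}$, represented by unit vectors $x_1,\dots,x_N$, is universally optimal in $\mathbb{RP}^{n-1}$ if for every absolutely monotone function $h$ on $[-1,1)$ (i.e. $h^{(j)}\ge0$ there for all $j\ge0$) the energy $\sum_{i\ne j}h(2(x_i\cdot x_j)^2-1)$ is minimal among all configurations of $N$ lines in $\mathbb R^n$ (equivalently, it minimizes the energy for every completely monotonic function of squared chordal distance in $\mathbb{RP}^{n-1}$). *)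

theory Defs
  imports "HOL-Analysis.Analysis"
begin

definition lattice_spanned_by :: "real^'n^'n \<Rightarrow> (real^'n) set" where
  "lattice_spanned_by M = {\<Sum>i\<in>UNIV. of_int (c i) *\<^sub>R (M $ i) | c. (c :: 'n \<Rightarrow> int) \<in> UNIV}"

text \<open>Unimodular means covolume 1: the lattice is the integer span of the rows of a matrix with
  determinant \<open>\<plusminus>1\<close>. Integrality follows from evenness by polarization.\<close>

definition even_unimodular_lattice :: "(real^'n) set \<Rightarrow> bool" where
  "even_unimodular_lattice L \<longleftrightarrow>
     (\<exists>M. \<bar>det M\<bar> = 1 \<and> L = lattice_spanned_by M) \<and>
     (\<forall>x\<in>L. \<exists>k::int. x \<bullet> x = 2 * of_int k)"

text \<open>The Leech lattice is unique only up to linear isometry, so it is described by a predicate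
  that singles out all of its isometric copies.\<close>

definition is_Leech_lattice :: "(real^24) set \<Rightarrow> bool" where
  "is_Leech_lattice L \<longleftrightarrow> even_unimodular_lattice L \<and> (\<forall>x\<in>L. x \<bullet> x \<noteq> 2)"

definition shell :: "'a::real_inner set \<Rightarrow> nat \<Rightarrow> 'a set" where
  "shell L k = {x\<in>L. (norm x)\<^sup>2 = 2 * real k}"

definition orth_proj :: "'a::euclidean_space set \<Rightarrow> 'a \<Rightarrow> 'a" where
  "orth_proj W x = (THE p. p \<in> W \<and> x - p \<in> W\<^sup>\<bottom>)"

definition normal_part :: "'a::euclidean_space set \<Rightarrow> 'a \<Rightarrow> 'a" where
  "normal_part W x = (x - orth_proj W x) /\<^sub>R norm (x - orth_proj W x)"

text \<open>The sequence \<open>D\<close> consists of the successive derivatives of \<open>h\<close>, one-sided at \<open>-1\<close>.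
  Values of \<open>h\<close> outside \<open>[-1,1)\<close> are irrelevant.\<close>

definition absolutely_monotone :: "(real \<Rightarrow> real) \<Rightarrow> bool" where
  "absolutely_monotone h \<longleftrightarrow>
     (\<exists>D :: nat \<Rightarrow> real \<Rightarrow> real.
        (\<forall>t\<in>{-1..<1}. D 0 t = h t) \<and>
        (\<forall>j. \<forall>t\<in>{-1..<1}. (D j has_real_derivative D (Suc j) t) (at t within {-1..<1})) \<and>
        (\<forall>j. \<forall>t\<in>{-1..<1}. D j t \<ge> 0))"

text \<open>The lines of a configuration are pairwise distinct, so \<open>2 * (x i \<bullet> x j)\<^sup>2 - 1\<close> lies in
  \<open>[-1,1)\<close>, the domain of the potential, whenever \<open>i \<noteq> j\<close>.\<close>

definition line_configuration :: "nat \<Rightarrow> (nat \<Rightarrow> 'a::euclidean_space) \<Rightarrow> bool" where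
  "line_configuration N x \<longleftrightarrow>
     (\<forall>i<N. norm (x i) = 1) \<and> inj_on (\<lambda>i. span {x i}) {..<N}"

definition projective_energy :: "(real \<Rightarrow> real) \<Rightarrow> nat \<Rightarrow> (nat \<Rightarrow> 'a::euclidean_space) \<Rightarrow> real" where
  "projective_energy h N x = (\<Sum>i<N. \<Sum>j\<in>{..<N} - {i}. h (2 * (x i \<bullet> x j)\<^sup>2 - 1))"

text \<open>A configuration is a set of one-dimensional subspaces. The energy does not depend on the
  enumeration of the lines or on the signs of the representing unit vectors, so the choice of
  \<open>x\<close> is immaterial. Competitors are all configurations of \<open>N\<close> lines in the ambient space.\<close>

definition universally_optimal_lines :: "'a::euclidean_space set set \<Rightarrow> bool" where
  "universally_optimal_lines \<B> \<longleftrightarrow>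
     (\<exists>N x. line_configuration N x \<and> \<B> = (\<lambda>i. span {x i}) ` {..<N} \<and>
        (\<forall>h. absolutely_monotone h \<longrightarrow>
           (\<forall>y :: nat \<Rightarrow> 'a. line_configuration N y \<longrightarrow>
              projective_energy h N x \<le> projective_energy h N y)))"

end

theory Submission
  imports Defs "HOL-Complex_Analysis.Complex_Analysis" "HOL-Probability.Probability"
begin

text \<open>For a vector \<open>v\<close>, Poisson summation for \<open>\<Sum> exp (- \<pi> t \<bar>x + s v\<bar>\<^sup>2)\<close>, expanded in powers of \<open>s\<close>, gives
  the transformation laws of the theta series weighted by the even powers of \<open>x \<bullet> v\<close>. The combinations of
  their derivatives that belong to zonal harmonics of degree \<open>2k\<close> are modular forms of weight \<open>12 + 2k\<close>. As
  the Leech lattice has no vectors of norm 2, they start with \<open>q\<^sup>2\<close>, and for \<open>k \<le> 4\<close> the weight is too small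
  for a nonzero form of this kind. Hence the minimal vectors form a spherical design of strength 9, and
  polynomials in the inner products with \<open>A\<close> and \<open>u\<close> that vanish at all minimal vectors outside
  \<open>\<plusminus>A\<^sub>2 \<union> {\<plusminus>A}\<close> determine \<open>\<bar>A\<^sub>2\<bar> = 2816\<close> and the distribution of the inner products within \<open>A\<^sub>2\<close>: the
  squared cosines of the lines are 0 (840 times) and 1/9 (567 times). For such a configuration the
  Hermite interpolant of the potential at 0 and, doubly, at 1/9 gives a sharp linear programming bound.\<close>

section \<open>Unimodular lattices\<close>

text \<open>Poisson summation is reached without convergence of Fourier series: powers of a product
  of squared cosines form a nonnegative periodic kernel with a finite Fourier expansion, so its
  pairing with a Gaussian can be computed exactly and also concentrates at 0. The restriction to k
  \<le> 4 reflects that a nonzero form of level one divisible by q^2 has weight at least 24; an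
  elementary estimate suffices for weights up to 20. Degree 8 is what the counting requires: the
  polynomial that isolates \<open>A2\<close> has degree 6, and the square of one further inner
  product measures how \<open>A2\<close> looks from one of its points. The modular forms give
  moments along a single vector only; mixed moments are recovered by taking that vector to be A + t
  u and comparing coefficients of t. The final bound is attained because each line of the code sees
  1 + 567/9 = 64 = 1408/22 as the sum of all squared cosines and 1 + 567/81 = 8 as the sum of their
  squares, the values at which the zonal harmonics of degrees 2 and 4 sum to 0 over the
  code.\<close>

lemma det_Ints:
  fixes A :: "real^'n^'n"
  assumes "\<And>i j. A $ i $ j \<in> \<int>"
  shows "det A \<in> \<int>"
  unfolding det_def by (intro Ints_sum Ints_mult Ints_prod Ints_of_int assms)

lemma even_form_inner_Ints:
  fixes x y :: "'a::real_inner"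
  assumes even: "\<And>z. z \<in> L \<Longrightarrow> \<exists>k::int. z \<bullet> z = 2 * of_int k"
    and "x \<in> L" "y \<in> L" "x + y \<in> L"
  shows "x \<bullet> y \<in> \<int>"
proof -
  obtain a b c :: int where "x \<bullet> x = 2 * of_int a" "y \<bullet> y = 2 * of_int b"
      "(x + y) \<bullet> (x + y) = 2 * of_int c"
    using even assms(2-4) by metis
  then have "x \<bullet> y = of_int (c - a - b)"
    by (simp add: inner_add_left inner_add_right inner_commute)
  then show ?thesis by (metis Ints_of_int)
qed

text \<open>Self-duality in coordinates: \<open>M\<close> and \<open>d\<close> are dual bases with
  integral Gram matrices, so the integer span of \<open>M\<close>, that of \<open>d\<close> and the
  dual lattice coincide. Membership in \<open>L\<close> is tested against \<open>d\<close>, while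
  \<open>emb\<close> parametrises the same lattice by coordinates in the basis
  \<open>d\<close>.\<close>

locale unimodular_basis =
  fixes M d :: "'n::finite \<Rightarrow> real^'n"
  assumes biorth: "M i \<bullet> d j = (if i = j then 1 else 0)"
    and M_Ints: "M i \<bullet> M j \<in> \<int>"
    and d_Ints: "d i \<bullet> d j \<in> \<int>"
begin

definition L :: "(real^'n) set" where "L = {v. \<forall>i. v \<bullet> d i \<in> \<int>}"

definition emb :: "('n \<Rightarrow> int) \<Rightarrow> real^'n" where "emb c = (\<Sum>i\<in>UNIV. of_int (c i) *\<^sub>R d i)"

lemma matrix_biorth: "(\<chi> i. M i) ** transpose (\<chi> i. d i) = mat 1"
proof -
  have "(\<Sum>k\<in>UNIV. M i $ k * d j $ k) = (if i = j then 1 else 0)" for i j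
    using biorth[of i j] by (simp add: inner_vec_def)
  then show ?thesis
    by (simp add: vec_eq_iff matrix_matrix_mult_def transpose_def mat_def)
qed

lemma expand_M: "v = (\<Sum>i\<in>UNIV. (v \<bullet> d i) *\<^sub>R M i)"
proof -
  have "transpose (\<chi> i. d i) ** (\<chi> i. M i) = mat 1"
    using matrix_biorth matrix_left_right_inverse by blast
  then have "transpose (\<chi> i. M i) ** (\<chi> i. d i) = mat 1"
    by (metis matrix_transpose_mul transpose_mat transpose_transpose)
  then have "v = transpose (\<chi> i. M i) *v ((\<chi> i. d i) *v v)"
    by (simp add: matrix_vector_mul_assoc)
  also have "(\<chi> i. d i) *v v = (\<chi> i. v \<bullet> d i)"
    by (simp add: vec_eq_iff matrix_vector_mult_def inner_vec_def mult.commute)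
  also have "transpose (\<chi> i. M i) *v (\<chi> i. v \<bullet> d i) = (\<Sum>i\<in>UNIV. (v \<bullet> d i) *\<^sub>R M i)"
    by (simp add: vec_eq_iff matrix_vector_mult_def transpose_def mult.commute)
  finally show ?thesis .
qed

lemma inner_expand: "v \<bullet> w = (\<Sum>i\<in>UNIV. (v \<bullet> d i) * (w \<bullet> M i))"
proof -
  have "v \<bullet> w = (\<Sum>i\<in>UNIV. (v \<bullet> d i) *\<^sub>R M i) \<bullet> w"
    using expand_M[of v] by simp
  then show ?thesis by (simp add: inner_sum_left inner_commute[of w])
qed

lemma expand_d: "v = (\<Sum>i\<in>UNIV. (v \<bullet> M i) *\<^sub>R d i)"
proof -
  have "x \<bullet> v = x \<bullet> (\<Sum>i\<in>UNIV. (v \<bullet> M i) *\<^sub>R d i)" for x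
    unfolding inner_expand[of x v] inner_sum_right inner_scaleR_right by (simp only: mult.commute)
  then show ?thesis using vector_eq_ldot by blast
qed

lemma inner_Ints: "x \<in> L \<Longrightarrow> y \<in> L \<Longrightarrow> x \<bullet> y \<in> \<int>"
proof -
  assume *: "x \<in> L" "y \<in> L"
  have "y \<bullet> M i = (\<Sum>j\<in>UNIV. (y \<bullet> d j) * (M i \<bullet> M j))" for i
    by (rule inner_expand)
  then have "y \<bullet> M i \<in> \<int>" for i
    using * M_Ints by (simp add: L_def Ints_sum Ints_mult)
  then show ?thesis
    using * unfolding inner_expand[of x y] by (auto simp: L_def intro!: Ints_sum Ints_mult)
qed

lemma M_in_L: "M i \<in> L" by (simp add: L_def biorth)
lemma zero_in_L: "0 \<in> L" by (simp add: L_def)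
lemma add_in_L: "x \<in> L \<Longrightarrow> y \<in> L \<Longrightarrow> x + y \<in> L" by (simp add: L_def inner_add_left Ints_add)
lemma diff_in_L: "x \<in> L \<Longrightarrow> y \<in> L \<Longrightarrow> x - y \<in> L" by (simp add: L_def inner_diff_left Ints_diff)
lemma uminus_in_L: "x \<in> L \<Longrightarrow> - x \<in> L" by (simp add: L_def)

lemma emb_inner_M: "emb c \<bullet> M i = of_int (c i)"
  by (simp add: emb_def inner_sum_left inner_commute[of "d _"] biorth if_distrib cong: if_cong)

lemma inj_emb: "inj emb"
  by (rule injI) (metis emb_inner_M ext of_int_eq_iff)

text \<open>Self-duality enters here: one inclusion rests on \<open>d_Ints\<close>, the other on the
  integrality of inner products within \<open>L\<close>. As a result, the frequencies
  \<open>emb c\<close> of the periodic kernel run through \<open>L\<close> itself.\<close>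

lemma range_emb: "range emb = L"
proof
  show "range emb \<subseteq> L"
    by (auto simp: emb_def L_def inner_sum_left intro!: Ints_sum Ints_mult d_Ints)
  show "L \<subseteq> range emb"
  proof
    fix v assume "v \<in> L"
    then have "\<forall>i. \<exists>k. v \<bullet> M i = of_int k"
      using inner_Ints M_in_L Ints_cases by metis
    then obtain c where "\<And>i. v \<bullet> M i = of_int (c i)" by metis
    then have "v = emb c" using expand_d[of v] by (simp add: emb_def)
    then show "v \<in> range emb" by blast
  qed
qed

lemma bij_emb: "bij_betw emb UNIV L"
  by (simp add: bij_betw_def inj_emb range_emb)

lemma countable_L: "countable L"
proof -
  have "countable (UNIV :: ('n \<Rightarrow> int) set)"
    using countable_PiE[of "UNIV::'n set" "\<lambda>_. UNIV::int set"] by (simp add: PiE_UNIV_domain)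
  then show ?thesis using range_emb by (metis countable_image)
qed

end

text \<open>The Gram matrix \<open>G\<close> of the rows is integral by polarization and has
  determinant 1, so Cramer's rule makes its inverse \<open>K\<close> integral too. The columns of
  the inverse of \<open>A\<close> form the dual basis, and \<open>K\<close> is their Gram
  matrix.\<close>

lemma even_unimodular_basis:
  assumes "even_unimodular_lattice \<Lambda>"
  obtains M d where "unimodular_basis M d" "unimodular_basis.L d = \<Lambda>"
proof -
  obtain A where A: "\<bar>det A\<bar> = 1" "\<Lambda> = lattice_spanned_by A"
    and even: "\<And>x. x \<in> \<Lambda> \<Longrightarrow> \<exists>k::int. x \<bullet> x = 2 * of_int k"
    using assms by (auto simp: even_unimodular_lattice_def)
  have mem: "(\<Sum>i\<in>UNIV. of_int (c i) *\<^sub>R (A $ i)) \<in> \<Lambda>" for c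
    by (auto simp: A lattice_spanned_by_def)
  have row: "A $ i \<in> \<Lambda>" for i
    using mem[of "\<lambda>j. if j = i then 1 else 0"] by (simp add: if_distrib[of of_int] if_distrib[of "\<lambda>x. x *\<^sub>R _"] cong: if_cong)
  have row2: "A $ i + A $ j \<in> \<Lambda>" for i j
    using mem[of "\<lambda>k. (if k = i then 1 else 0) + (if k = j then 1 else 0)"]
    by (simp add: scaleR_left_distrib sum.distrib if_distrib[of of_int] if_distrib[of "\<lambda>x. x *\<^sub>R _"] cong: if_cong)
  have AI: "A $ i \<bullet> A $ j \<in> \<int>" for i j
    by (rule even_form_inner_Ints[OF even row row row2])
  have "invertible A" using A by (auto simp: invertible_det_nz)
  then obtain B where AB: "A ** B = mat 1" and BA: "B ** A = mat 1" by (auto simp: invertible_def)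
  define G where "G = A ** transpose A"
  define K where "K = transpose B ** B"
  have "G ** K = A ** (transpose A ** transpose B) ** B"
    by (simp add: G_def K_def matrix_mul_assoc)
  also have "\<dots> = mat 1" by (simp add: matrix_transpose_mul[symmetric] AB BA)
  finally have GK: "G ** K = mat 1" .
  have Gij: "G $ i $ j = A $ i \<bullet> A $ j" for i j
    by (simp add: G_def matrix_matrix_mult_def transpose_def inner_vec_def)
  have GI: "G $ i $ j \<in> \<int>" for i j
    by (simp add: Gij AI)
  have detG: "det G = 1"
    using A(1) by (metis G_def abs_square_eq_1 det_mul det_transpose power2_eq_square power_one abs_1 power2_abs)
  have KI: "K $ i $ j \<in> \<int>" for i j
  proof -
    have "G *v column j K = axis j 1"
    proof -
      have "(G ** K) $ k $ j = (G *v column j K) $ k" for k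
        by (simp add: matrix_matrix_mult_def matrix_vector_mult_def column_def)
      then show ?thesis by (simp add: GK vec_eq_iff mat_def axis_def)
    qed
    then have "column j K = (\<chi> k. det (\<chi> i l. if l = k then axis j 1 $ i else G $ i $ l) / det G)"
      using cramer[of G "column j K" "axis j 1"] detG by simp
    then have "K $ i $ j = det (\<chi> k l. if l = i then axis j 1 $ k else G $ k $ l)"
      by (simp add: detG vec_eq_iff column_def)
    also have "\<dots> \<in> \<int>"
      by (rule det_Ints) (auto simp: GI axis_def)
    finally show ?thesis .
  qed
  define d where "d = (\<lambda>j. column j B)"
  have bi: "A $ i \<bullet> d j = (if i = j then 1 else 0)" for i j
  proof -
    have "A $ i \<bullet> d j = (A ** B) $ i $ j"
      by (simp add: d_def column_def inner_vec_def matrix_matrix_mult_def)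
    then show ?thesis by (simp add: AB mat_def)
  qed
  have dI: "d i \<bullet> d j \<in> \<int>" for i j
    using KI[of i j] by (simp add: d_def K_def column_def inner_vec_def matrix_matrix_mult_def transpose_def)
  interpret unimodular_basis "\<lambda>i. A $ i" d
    by unfold_locales (use bi AI dI in auto)
  have "L = \<Lambda>"
  proof
    show "L \<subseteq> \<Lambda>"
    proof
      fix v assume "v \<in> L"
      then have "\<forall>i. \<exists>k. v \<bullet> d i = of_int k" by (auto simp: L_def elim: Ints_cases)
      then obtain c where "\<And>i. v \<bullet> d i = of_int (c i)" by metis
      then show "v \<in> \<Lambda>" using expand_M[of v] mem[of c] by simp
    qed
    show "\<Lambda> \<subseteq> L"
      by (auto simp: A(2) lattice_spanned_by_def L_def inner_sum_left bi intro!: Ints_sum Ints_mult)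
  qed
  then show ?thesis using that unimodular_basis_axioms by blast
qed

section \<open>Poisson summation\<close>

lemma tendsto_infsum_dominated:
  fixes f :: "nat \<Rightarrow> 'a \<Rightarrow> 'b::{banach,second_countable_topology}" and b :: "'a \<Rightarrow> real"
  assumes b: "b summable_on A" and le: "\<And>N x. x \<in> A \<Longrightarrow> norm (f N x) \<le> b x"
    and lim: "\<And>x. x \<in> A \<Longrightarrow> (\<lambda>N. f N x) \<longlonglongrightarrow> g x"
  shows "(\<lambda>N. infsum (f N) A) \<longlonglongrightarrow> infsum g A"
proof -
  have b': "Infinite_Set_Sum.abs_summable_on b A"
    using b summable_on_iff_abs_summable_on_real by (metis abs_summable_equivalent)
  have leg: "norm (g x) \<le> b x" if "x \<in> A" for x
    by (rule tendsto_upperbound[OF tendsto_norm[OF lim[OF that]]]) (use le that in auto)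
  have fs: "Infinite_Set_Sum.abs_summable_on (f N) A" for N
    by (rule abs_summable_on_comparison_test[OF b']) (simp add: order_trans[OF le abs_ge_self])
  have gs: "Infinite_Set_Sum.abs_summable_on g A"
    by (rule abs_summable_on_comparison_test[OF b']) (simp add: order_trans[OF leg abs_ge_self])
  have "(\<lambda>N. infsetsum (f N) A) \<longlonglongrightarrow> infsetsum g A"
    unfolding infsetsum_def
    by (rule integral_dominated_convergence[where w = b])
      (use b' le lim in \<open>auto simp: abs_summable_on_def intro!: AE_I2\<close>)
  then show ?thesis using fs gs by (simp add: infsetsum_infsum)
qed

lemma gauss_summable_int:
  assumes "\<epsilon> > 0"
  shows "(\<lambda>j::int. exp (- \<epsilon> * (real_of_int j)\<^sup>2)) summable_on UNIV"
proof -
  have nat: "(\<lambda>n. exp (- \<epsilon> * (real n)\<^sup>2)) summable_on UNIV"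
  proof (rule norm_summable_imp_summable_on, rule summable_comparison_test')
    show "summable (\<lambda>n. exp (- \<epsilon>) ^ n)"
      using assms by (intro summable_geometric) auto
    fix n :: nat
    have "real n \<le> (real n)\<^sup>2" using of_nat_mono[of n "n^2"] by (cases n) (auto simp: power2_eq_square)
    then have "exp (- \<epsilon> * (real n)\<^sup>2) \<le> exp (- \<epsilon> * real n)" using assms by simp
    also have "\<dots> = exp (- \<epsilon>) ^ n" by (simp add: exp_of_nat_mult[symmetric] mult.commute)
    finally show "norm (norm (exp (- \<epsilon> * (real n)\<^sup>2))) \<le> exp (- \<epsilon>) ^ n" by simp
  qed
  let ?g = "\<lambda>j::int. exp (- \<epsilon> * (real_of_int j)\<^sup>2)"
  have 1: "?g summable_on range int"
    using nat by (subst summable_on_reindex) (auto simp: o_def)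
  have 2: "?g summable_on range (\<lambda>n. - int n)"
    using nat by (subst summable_on_reindex) (auto simp: o_def inj_on_def)
  have "range int \<union> range (\<lambda>n. - int n) = UNIV"
    by (auto simp: image_iff) (metis int_cases2 minus_equation_iff)
  then show ?thesis using summable_on_union[OF 1 2] by simp
qed

lemma lborel_integral_prod:
  fixes f :: "'a::euclidean_space \<Rightarrow> real \<Rightarrow> complex"
  assumes int: "\<And>b. b \<in> Basis \<Longrightarrow> integrable lborel (f b)"
  shows "integrable lborel (\<lambda>x::'a. \<Prod>b\<in>Basis. f b (x \<bullet> b))"
    and "(\<integral>x. (\<Prod>b\<in>Basis. f b (x \<bullet> b)) \<partial>(lborel :: 'a measure)) = (\<Prod>b\<in>Basis. \<integral>u. f b u \<partial>lborel)"
proof -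
  interpret product_sigma_finite "\<lambda>_::'a. lborel :: real measure" ..
  let ?s = "\<lambda>g. \<Sum>b\<in>Basis. g b *\<^sub>R b :: 'a"
  have s: "?s \<in> measurable (\<Pi>\<^sub>M b\<in>(Basis::'a set). lborel) borel" by measurable
  have f: "(\<lambda>x::'a. \<Prod>b\<in>Basis. f b (x \<bullet> b)) \<in> borel_measurable borel"
  proof (rule borel_measurable_prod)
    fix b :: 'a assume "b \<in> Basis"
    then have [measurable]: "f b \<in> borel_measurable borel" using int by force
    show "(\<lambda>x::'a. f b (x \<bullet> b)) \<in> borel_measurable borel" by measurable
  qed
  have eq: "(\<Prod>b\<in>Basis. f b (?s g \<bullet> b)) = (\<Prod>b\<in>Basis. f b (g b))" for g
    by (intro prod.cong refl) (simp add: inner_sum_left inner_Basis if_distrib cong: if_cong)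
  show "integrable lborel (\<lambda>x::'a. \<Prod>b\<in>Basis. f b (x \<bullet> b))"
    using s f int product_integrable_prod[of Basis f] by (simp add: lborel_eq[where 'a='a] integrable_distr_eq eq)
  show "(\<integral>x. (\<Prod>b\<in>Basis. f b (x \<bullet> b)) \<partial>(lborel :: 'a measure)) = (\<Prod>b\<in>Basis. \<integral>u. f b u \<partial>lborel)"
    using s f int by (simp add: lborel_eq[where 'a='a] integral_distr eq product_integral_prod)
qed

abbreviation gauss :: "real \<Rightarrow> 'a::real_normed_vector \<Rightarrow> real" where
  "gauss t x \<equiv> exp (- pi * t * (norm x)\<^sup>2)"

text \<open>Scaling by \<open>s = sqrt (2 * pi * t)\<close> turns the Gaussian into a multiple of
  the standard normal density, whose characteristic function is known.\<close>

lemma gauss_fourier_real: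
  fixes t \<eta> :: real
  assumes "t > 0"
  shows "integrable lborel (\<lambda>u. of_real (exp (- pi * t * u\<^sup>2)) * cis (2 * pi * (u * \<eta>)))"
    and "(\<integral>u. of_real (exp (- pi * t * u\<^sup>2)) * cis (2 * pi * (u * \<eta>)) \<partial>lborel)
      = of_real (1 / sqrt t * exp (- pi * \<eta>\<^sup>2 / t))"
proof -
  define s where "s = sqrt (2 * pi * t)"
  have s: "s > 0" "s\<^sup>2 = 2 * pi * t" using assms by (simp_all add: s_def)
  let ?g = "\<lambda>u. of_real (std_normal_density u) * cis (2 * pi * \<eta> / s * u)"
  have gi: "integrable lborel ?g"
  proof (rule Bochner_Integration.integrable_bound)
    show "integrable lborel std_normal_density" by simp
    have "(\<lambda>u. cis (2 * pi * \<eta> / s * u)) \<in> borel_measurable borel"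
      unfolding cis_conv_exp by (intro borel_measurable_continuous_onI continuous_intros)
    then show "?g \<in> borel_measurable lborel" by (simp del: cis.code)
  qed (simp add: norm_mult)
  have gI: "integral\<^sup>L lborel ?g = of_real (exp (- (2 * pi * \<eta> / s)\<^sup>2 / 2))"
  proof -
    have "char std_normal_distribution (2 * pi * \<eta> / s) = integral\<^sup>L lborel ?g"
      unfolding char_def
      by (subst integral_density) (auto simp: scaleR_conv_of_real cis_conv_exp mult_ac)
    then show ?thesis by (simp add: char_std_normal_distribution)
  qed
  have eq: "of_real (exp (- pi * t * u\<^sup>2)) * cis (2 * pi * (u * \<eta>)) = of_real (sqrt (2 * pi)) * ?g (0 + s * u)" for u
    using s by (simp add: std_normal_density_def power_mult_distrib mult_ac)
  show "integrable lborel (\<lambda>u. of_real (exp (- pi * t * u\<^sup>2)) * cis (2 * pi * (u * \<eta>)))"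
    unfolding eq using s by (intro integrable_mult_right lborel_integrable_real_affine[OF gi]) auto
  have "of_real (exp (- (2 * pi * \<eta> / s)\<^sup>2 / 2)) = \<bar>s\<bar> *\<^sub>R (\<integral>u. ?g (0 + s * u) \<partial>lborel)"
    using lborel_integral_real_affine[of s ?g 0] s gI by simp
  then have "(\<integral>u. ?g (0 + s * u) \<partial>lborel) = of_real (exp (- (2 * pi * \<eta> / s)\<^sup>2 / 2) / s)"
    using s by (simp add: scaleR_conv_of_real field_simps)
  then have "(\<integral>u. of_real (exp (- pi * t * u\<^sup>2)) * cis (2 * pi * (u * \<eta>)) \<partial>lborel)
      = of_real (sqrt (2 * pi) * (exp (- (2 * pi * \<eta> / s)\<^sup>2 / 2) / s))"
    unfolding eq by (simp only: integral_mult_right_zero of_real_mult)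
  also have "- (2 * pi * \<eta> / s)\<^sup>2 / 2 = - pi * \<eta>\<^sup>2 / t"
    using assms by (simp add: power_divide s(2)) (simp add: power2_eq_square field_simps)
  also have "sqrt (2 * pi) * (exp (- pi * \<eta>\<^sup>2 / t) / s) = 1 / sqrt t * exp (- pi * \<eta>\<^sup>2 / t)"
    using assms by (simp add: s_def real_sqrt_mult)
  finally show "(\<integral>u. of_real (exp (- pi * t * u\<^sup>2)) * cis (2 * pi * (u * \<eta>)) \<partial>lborel)
      = of_real (1 / sqrt t * exp (- pi * \<eta>\<^sup>2 / t))" .
qed

lemma gauss_fourier:
  fixes y :: "'a::euclidean_space"
  assumes "t > 0"
  shows "integrable lborel (\<lambda>x::'a. of_real (gauss t x) * cis (2 * pi * (x \<bullet> y)))"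
    and "(\<integral>x. of_real (gauss t x) * cis (2 * pi * (x \<bullet> y)) \<partial>lborel)
      = of_real ((1 / sqrt t) ^ DIM('a) * exp (- pi * (norm y)\<^sup>2 / t))"
proof -
  let ?f = "\<lambda>b u. of_real (exp (- pi * t * u\<^sup>2)) * cis (2 * pi * (u * (y \<bullet> b)))"
  have eq: "of_real (gauss t x) * cis (2 * pi * (x \<bullet> y)) = (\<Prod>b\<in>Basis. ?f b (x \<bullet> b))" for x
  proof -
    have "(norm x)\<^sup>2 = (\<Sum>b\<in>Basis. (x \<bullet> b)\<^sup>2)"
      by (subst power2_norm_eq_inner, subst euclidean_inner) (simp add: power2_eq_square)
    moreover have "2 * pi * (x \<bullet> y) = (\<Sum>b\<in>Basis. 2 * pi * ((x \<bullet> b) * (y \<bullet> b)))"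
      by (simp add: euclidean_inner[of x y] sum_distrib_left)
    ultimately show ?thesis
      by (simp add: prod.distrib sum_distrib_left exp_sum cis_conv_exp sum_distrib_right
          flip: sum_negf)
  qed
  show "integrable lborel (\<lambda>x::'a. of_real (gauss t x) * cis (2 * pi * (x \<bullet> y)))"
    unfolding eq by (intro lborel_integral_prod gauss_fourier_real assms)
  have "(norm y)\<^sup>2 = (\<Sum>b\<in>Basis. (y \<bullet> b)\<^sup>2)"
    by (subst power2_norm_eq_inner, subst euclidean_inner) (simp add: power2_eq_square)
  then have "(1 / sqrt t) ^ DIM('a) * exp (- pi * (norm y)\<^sup>2 / t)
      = (\<Prod>b\<in>Basis. 1 / sqrt t * exp (- pi * (y \<bullet> b)\<^sup>2 / t))"
    unfolding prod.distrib prod_constant by (simp add: sum_distrib_left sum_divide_distrib exp_sum flip: sum_negf)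
  then show "(\<integral>x. of_real (gauss t x) * cis (2 * pi * (x \<bullet> y)) \<partial>lborel)
      = of_real ((1 / sqrt t) ^ DIM('a) * exp (- pi * (norm y)\<^sup>2 / t))"
    unfolding eq by (subst lborel_integral_prod(2)) (simp_all only: gauss_fourier_real assms of_real_prod)
qed

text \<open>The binomial coefficients of \<open>(2 cos \<pi>c)\<^bsup>2N\<^esup>\<close>, normalised so that each of them tends to 1.\<close>

definition cos_weight :: "nat \<Rightarrow> int \<Rightarrow> real" where
  "cos_weight N j = (if \<bar>j\<bar> \<le> int N then real ((2 * N) choose nat (int N + j)) / real ((2 * N) choose N) else 0)"

lemma cos_weight_bounds: "0 \<le> cos_weight N j" "cos_weight N j \<le> 1"
proof -
  show "0 \<le> cos_weight N j" by (simp add: cos_weight_def)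
  have "(2 * N) choose k \<le> (2 * N) choose N" for k
    using binomial_maximum'[of N k] by simp
  then show "cos_weight N j \<le> 1" by (simp add: cos_weight_def divide_le_eq)
qed

lemma cos_weight_uminus: "cos_weight N (- j) = cos_weight N j"
proof -
  have "(2 * N) choose nat (int N - j) = (2 * N) choose nat (int N + j)" if "\<bar>j\<bar> \<le> int N"
  proof -
    have "nat (int N - j) = 2 * N - nat (int N + j)" "nat (int N + j) \<le> 2 * N"
      using that by auto
    then show ?thesis by (simp add: binomial_symmetric[of "nat (int N + j)" "2 * N"])
  qed
  then show ?thesis by (simp add: cos_weight_def)
qed

text \<open>Neighbouring weights have the ratio (N - m) / (N + m + 1), which tends to 1; the
  induction starts at the centre, where the weight is exactly 1.\<close>

lemma cos_weight_tendsto: "(\<lambda>N. cos_weight N j) \<longlonglongrightarrow> 1"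
proof -
  have *: "(\<lambda>N. cos_weight N (int m)) \<longlonglongrightarrow> 1" for m
  proof (induction m)
    case 0
    then show ?case by (simp add: cos_weight_def)
  next
    case (Suc m)
    have "(\<lambda>N. (real N - real m) / (real N + real m + 1)) \<longlonglongrightarrow> 1" by real_asymp
    from tendsto_mult[OF this Suc]
    have "(\<lambda>N. (real N - real m) / (real N + real m + 1) * cos_weight N (int m)) \<longlonglongrightarrow> 1" by simp
    moreover have "eventually (\<lambda>N. (real N - real m) / (real N + real m + 1) * cos_weight N (int m)
        = cos_weight N (int (Suc m))) sequentially"
      using eventually_ge_at_top[of "Suc m"]
    proof eventually_elim
      case (elim N)
      have n1: "nat (int N + int m) = N + m" "nat (int N + (1 + int m)) = Suc (N + m)" by auto
      define X where "X = real ((2 * N) choose Suc (N + m))"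
      define Y where "Y = real ((2 * N) choose (N + m))"
      have "Suc (N + m) * ((2 * N) choose Suc (N + m)) = (2 * N - (N + m)) * ((2 * N) choose (N + m))"
        by (metis binomial_absorb_comp binomial_absorption mult.commute)
      then have "real (Suc (N + m)) * X = real (2 * N - (N + m)) * Y"
        unfolding X_def Y_def by (metis of_nat_mult)
      moreover have "real (2 * N - (N + m)) = real N - real m" using elim by simp
      ultimately have "X = (real N - real m) / (real N + real m + 1) * Y"
        by (simp add: eq_divide_eq mult.commute add.commute)
      moreover have "cos_weight N (int (Suc m)) = X / real ((2 * N) choose N)"
        "cos_weight N (int m) = Y / real ((2 * N) choose N)"
        using elim by (simp_all add: cos_weight_def n1 X_def Y_def)
      ultimately show ?case by simp
    qed
    ultimately show ?case by (rule Lim_transform_eventually)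
  qed
  show ?thesis
  proof (cases "j \<ge> 0")
    case True
    then show ?thesis using *[of "nat j"] by simp
  next
    case False
    then show ?thesis using *[of "nat (- j)"] cos_weight_uminus[of _ j] by simp
  qed
qed

text \<open>The binomial theorem for \<open>cis (pi * c) + cis (- (pi * c))\<close>. After division
  by the central binomial coefficient every Fourier coefficient tends to 1, as for a delta function
  at the integers.\<close>

lemma cos_power_expand:
  "of_real (4 ^ N / real ((2 * N) choose N) * (cos (pi * c) ^ 2) ^ N)
    = (\<Sum>j\<in>{- int N..int N}. of_real (cos_weight N j) * cis (2 * pi * (of_int j * c)))"
proof -
  have "of_real ((2 * cos (pi * c)) ^ (2 * N)) = (cis (pi * c) + cis (- (pi * c))) ^ (2 * N)"
  proof -
    have "cis (pi * c) + cis (- (pi * c)) = of_real (2 * cos (pi * c))" by (simp add: complex_eq_iff)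
    then show ?thesis by simp
  qed
  also have "\<dots> = (\<Sum>k\<le>2*N. of_nat ((2*N) choose k) * cis (pi * c) ^ k * cis (- (pi * c)) ^ (2 * N - k))"
    by (rule binomial_ring)
  also have "\<dots> = (\<Sum>k\<le>2*N. of_nat ((2*N) choose k) * cis (2 * pi * ((real k - real N) * c)))"
  proof (intro sum.cong refl)
    fix k assume "k \<in> {..2 * N}"
    then have "real k * (pi * c) + real (2 * N - k) * - (pi * c) = 2 * pi * ((real k - real N) * c)"
      by (simp add: of_nat_diff algebra_simps)
    then have "cis (pi * c) ^ k * cis (- (pi * c)) ^ (2 * N - k) = cis (2 * pi * ((real k - real N) * c))"
      unfolding Complex.DeMoivre cis_mult by (rule arg_cong)
    then show "of_nat ((2*N) choose k) * cis (pi * c) ^ k * cis (- (pi * c)) ^ (2 * N - k)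
        = of_nat ((2*N) choose k) * cis (2 * pi * ((real k - real N) * c))"
      by (simp only: mult.assoc)
  qed
  also have "\<dots> = (\<Sum>j\<in>{- int N..int N}. of_nat ((2*N) choose nat (int N + j)) * cis (2 * pi * (of_int j * c)))"
    by (rule sum.reindex_bij_witness[of _ "\<lambda>j. nat (int N + j)" "\<lambda>k. int k - int N"]) auto
  finally have e: "of_real ((2 * cos (pi * c)) ^ (2 * N)) = \<dots>" .
  have "(\<Sum>j\<in>{- int N..int N}. of_real (cos_weight N j) * cis (2 * pi * (of_int j * c)))
     = (\<Sum>j\<in>{- int N..int N}. of_nat ((2*N) choose nat (int N + j)) * cis (2 * pi * (of_int j * c))) / of_nat ((2 * N) choose N)"
    unfolding sum_divide_distrib by (intro sum.cong refl) (auto simp: cos_weight_def)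
  also have "\<dots> = of_real ((2 * cos (pi * c)) ^ (2 * N) / real ((2 * N) choose N))"
    unfolding e[symmetric] by simp
  also have "(2 * cos (pi * c)) ^ (2 * N) = 4 ^ N * (cos (pi * c) ^ 2) ^ N"
    by (simp add: power_mult power_mult_distrib)
  finally show ?thesis by simp
qed

section \<open>Theta series and the fundamental cell\<close>

context unimodular_basis begin

text \<open>Each coordinate of \<open>emb c\<close> is its inner product with some
  \<open>M i\<close>, so Cauchy-Schwarz bounds the sum of squared coordinates by a multiple of the
  squared norm. The majorant then factors into one-dimensional sums. The summand 1 in
  \<open>B\<close> only secures \<open>B > 0\<close>.\<close>

lemma gauss_summable:
  assumes "\<epsilon> > 0"
  shows "(\<lambda>x. exp (- \<epsilon> * (norm x)\<^sup>2)) summable_on L"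
proof -
  define B where "B = (\<Sum>i\<in>UNIV. (norm (M i))\<^sup>2) + 1"
  have B: "B > 0" unfolding B_def by (simp add: add_nonneg_pos sum_nonneg)
  define e where "e = \<epsilon> / B"
  have e: "e > 0" using assms B by (simp add: e_def)
  have le: "(\<Sum>i\<in>UNIV. (real_of_int (c i))\<^sup>2) \<le> B * (norm (emb c))\<^sup>2" for c
  proof -
    have "(real_of_int (c i))\<^sup>2 \<le> (norm (M i))\<^sup>2 * (norm (emb c))\<^sup>2" for i
    proof -
      have "\<bar>real_of_int (c i)\<bar> \<le> norm (M i) * norm (emb c)"
        using Cauchy_Schwarz_ineq2[of "emb c" "M i"] by (simp add: emb_inner_M mult.commute)
      then show ?thesis by (metis abs_ge_zero power2_abs power_mono power_mult_distrib)
    qed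
    then have "(\<Sum>i\<in>UNIV. (real_of_int (c i))\<^sup>2) \<le> (\<Sum>i\<in>UNIV. (norm (M i))\<^sup>2 * (norm (emb c))\<^sup>2)"
      by (rule sum_mono)
    also have "\<dots> \<le> B * (norm (emb c))\<^sup>2"
      by (simp add: B_def distrib_right flip: sum_distrib_right)
    finally show ?thesis .
  qed
  have "Infinite_Set_Sum.abs_summable_on (\<lambda>j::int. exp (- e * (real_of_int j)\<^sup>2)) UNIV"
    using gauss_summable_int[OF e] summable_on_iff_abs_summable_on_real by (metis abs_summable_equivalent)
  then have "Infinite_Set_Sum.abs_summable_on (\<lambda>c. \<Prod>i\<in>(UNIV::'n set). exp (- e * (real_of_int (c i))\<^sup>2)) (PiE UNIV (\<lambda>_. UNIV))"
    by (intro abs_summable_on_prod_PiE) auto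
  then have "(\<lambda>c. norm (\<Prod>i\<in>(UNIV::'n set). exp (- e * (real_of_int (c i))\<^sup>2))) summable_on UNIV"
    unfolding abs_summable_equivalent[symmetric] by (simp add: PiE_UNIV_domain)
  then have s: "(\<lambda>c::'n \<Rightarrow> int. exp (- e * (\<Sum>i\<in>UNIV. (real_of_int (c i))\<^sup>2))) summable_on UNIV"
    by (simp add: exp_sum[symmetric] sum_distrib_left sum_negf)
  have "(\<lambda>c. exp (- \<epsilon> * (norm (emb c))\<^sup>2)) summable_on UNIV"
  proof (rule summable_on_comparison_test[OF s])
    fix c :: "'n \<Rightarrow> int"
    have "e * (\<Sum>i\<in>UNIV. (real_of_int (c i))\<^sup>2) \<le> e * (B * (norm (emb c))\<^sup>2)"
      using le e by (intro mult_left_mono) auto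
    also have "\<dots> = \<epsilon> * (norm (emb c))\<^sup>2" using B by (simp add: e_def)
    finally show "exp (- \<epsilon> * (norm (emb c))\<^sup>2) \<le> exp (- e * (\<Sum>i\<in>UNIV. (real_of_int (c i))\<^sup>2))" by simp
  qed auto
  then show ?thesis
    using summable_on_reindex_bij_betw[OF bij_emb, of "\<lambda>x. exp (- \<epsilon> * (norm x)\<^sup>2)"] by simp
qed

definition theta :: "real \<Rightarrow> real^'n \<Rightarrow> real" where
  "theta t v = (\<Sum>\<^sub>\<infinity>x\<in>L. gauss t (x + v))"

lemma gauss_shift_le:
  fixes x v :: "'b::real_inner"
  assumes "t > 0"
  shows "gauss t (x + v) \<le> exp (pi * t * (norm v)\<^sup>2) * exp (- (pi * t / 2) * (norm x)\<^sup>2)"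
proof -
  have "(norm x)\<^sup>2 \<le> 2 * (norm (x + v))\<^sup>2 + 2 * (norm v)\<^sup>2"
  proof -
    \<comment> \<open>This square is exactly the difference of the two sides of the claimed
      inequality.\<close>
    have "0 \<le> (norm (x + 2 *\<^sub>R v))\<^sup>2" by simp
    then show ?thesis
      by (simp add: power2_norm_eq_inner inner_add_left inner_add_right inner_commute)
  qed
  then have "pi * t * (norm x)\<^sup>2 \<le> pi * t * (2 * (norm (x + v))\<^sup>2 + 2 * (norm v)\<^sup>2)"
    using assms by (intro mult_left_mono) auto
  then have "- pi * t * (norm (x + v))\<^sup>2 \<le> pi * t * (norm v)\<^sup>2 + - (pi * t / 2) * (norm x)\<^sup>2"
    by (simp add: algebra_simps)
  then show ?thesis by (simp add: mult_exp_exp)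
qed

lemma gauss_shift_summable:
  assumes "t > 0"
  shows "(\<lambda>x. gauss t (x + v)) summable_on L"
proof (rule summable_on_comparison_test)
  show "(\<lambda>x. exp (pi * t * (norm v)\<^sup>2) * exp (- (pi * t / 2) * (norm x)\<^sup>2)) summable_on L"
    using assms by (intro summable_on_cmult_right gauss_summable) auto
qed (use gauss_shift_le[OF assms] in auto)

lemma theta_pos:
  assumes "t > 0"
  shows "theta t v > 0"
proof -
  have "sum (\<lambda>x. gauss t (x + v)) {0} \<le> theta t v"
    unfolding theta_def
    by (rule finite_sum_le_infsum) (use gauss_shift_summable[OF assms] zero_in_L in auto)
  then show ?thesis by (smt (verit) exp_gt_zero finite.intros insert_absorb sum.empty sum.insert empty_iff)
qed

lemma continuous_theta:
  assumes "t > 0"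
  shows "continuous_on UNIV (theta t)"
proof -
  have "isCont (theta t) v0" for v0
  proof -
    let ?Y = "cball v0 1"
    define C where "C = exp (pi * t * (norm v0 + 1)\<^sup>2)"
    have "uniform_limit ?Y (\<lambda>X v. \<Sum>x\<in>X. gauss t (x + v)) (theta t) (finite_subsets_at_top L)"
      unfolding theta_def
    proof (rule Weierstrass_m_test_general)
      show "(\<lambda>x. C * exp (- (pi * t / 2) * (norm x)\<^sup>2)) summable_on L"
        using assms by (intro summable_on_cmult_right gauss_summable) auto
      fix x v :: "real^'n" assume "v \<in> ?Y"
      then have "norm v \<le> norm v0 + 1"
        using norm_triangle_sub[of v v0] by (simp add: dist_norm norm_minus_commute)
      then have "exp (pi * t * (norm v)\<^sup>2) \<le> C"
        using assms by (simp add: C_def power_mono)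
      then have "exp (pi * t * (norm v)\<^sup>2) * exp (- (pi * t / 2) * (norm x)\<^sup>2) \<le> C * exp (- (pi * t / 2) * (norm x)\<^sup>2)"
        by (intro mult_right_mono) auto
      with gauss_shift_le[OF assms, of x v]
      show "norm (gauss t (x + v)) \<le> C * exp (- (pi * t / 2) * (norm x)\<^sup>2)"
        unfolding real_norm_def abs_exp_cancel by (rule order_trans)
    qed
    then have "continuous_on ?Y (theta t)"
      by (rule uniform_limit_theorem[rotated])
        (auto intro!: always_eventually continuous_intros)
    then show ?thesis
      by (rule continuous_on_interior) simp
  qed
  then show ?thesis by (simp add: continuous_on_eq_continuous_at)
qed

text \<open>Half-open in every coordinate, so that the lattice translates of the cell tile the space
  without overlap; \<open>ccell\<close> is its closed counterpart, used wherever compactness is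
  needed.\<close>

definition cell :: "(real^'n) set" where
  "cell = {v. \<forall>i. - (1/2) \<le> v \<bullet> d i \<and> v \<bullet> d i < 1/2}"

definition ccell :: "(real^'n) set" where
  "ccell = {v. \<forall>i. \<bar>v \<bullet> d i\<bar> \<le> 1/2}"

text \<open>A peak function: lattice-periodic, with values in [0,1], and on \<open>ccell\<close>
  equal to 1 only at 0. Its powers concentrate at the lattice points and are trigonometric
  polynomials.\<close>

definition K0 :: "real^'n \<Rightarrow> real" where
  "K0 v = (\<Prod>i\<in>UNIV. (cos (pi * (v \<bullet> d i)))\<^sup>2)"

lemma L_inner_d: "x \<in> L \<Longrightarrow> \<exists>k::int. x \<bullet> d i = of_int k"
  by (metis (mono_tags, lifting) Ints_cases L_def mem_Collect_eq)

lemma cell_unique: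
  "\<exists>x\<in>L. \<forall>y\<in>L. v - y \<in> cell \<longleftrightarrow> y = x"
proof -
  define x where "x = (\<Sum>i\<in>UNIV. of_int \<lfloor>v \<bullet> d i + 1/2\<rfloor> *\<^sub>R M i)"
  have xd: "x \<bullet> d i = of_int \<lfloor>v \<bullet> d i + 1/2\<rfloor>" for i
    by (simp add: x_def inner_sum_left biorth if_distrib cong: if_cong)
  have "x \<in> L" by (simp add: L_def xd)
  moreover have "v - y \<in> cell \<longleftrightarrow> y = x" if "y \<in> L" for y
  proof
    assume "v - y \<in> cell"
    have "y \<bullet> d i = x \<bullet> d i" for i
    proof -
      obtain k where k: "y \<bullet> d i = of_int k" using L_inner_d[OF \<open>y \<in> L\<close>] by blast
      then have "\<lfloor>v \<bullet> d i + 1/2\<rfloor> = k"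
      proof -
        have "- (1/2) \<le> (v - y) \<bullet> d i \<and> (v - y) \<bullet> d i < 1/2"
          using \<open>v - y \<in> cell\<close> unfolding cell_def by blast
        then show ?thesis by (intro floor_unique) (auto simp: k inner_diff_left)
      qed
      then show ?thesis using k by (simp add: xd)
    qed
    then show "y = x" using expand_M[of y] expand_M[of x] by simp
  next
    assume "y = x"
    have "- (1/2) \<le> v \<bullet> d i - of_int \<lfloor>v \<bullet> d i + 1/2\<rfloor> \<and> v \<bullet> d i - of_int \<lfloor>v \<bullet> d i + 1/2\<rfloor> < 1/2" for i
      using floor_correct[of "v \<bullet> d i + 1/2"] by linarith
    then show "v - y \<in> cell"
      unfolding \<open>y = x\<close> by (simp add: cell_def inner_diff_left xd)
  qed
  ultimately show ?thesis by blast
qed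

lemma cell_sets: "cell \<in> sets borel"
proof -
  have "cell = (\<Inter>i. {v. - (1/2) \<le> v \<bullet> d i} \<inter> {v. v \<bullet> d i < 1/2})"
    by (auto simp: cell_def)
  also have "\<dots> \<in> sets borel"
    by (intro sets.finite_INT sets.Int borel_closed borel_open closed_Collect_le open_Collect_less continuous_intros) auto
  finally show ?thesis .
qed

lemma compact_ccell: "compact ccell"
proof -
  have "ccell = (\<Inter>i. {v. \<bar>v \<bullet> d i\<bar> \<le> 1/2})" by (auto simp: ccell_def)
  moreover have "closed (\<Inter>i. {v. \<bar>v \<bullet> d i\<bar> \<le> 1/2})"
    by (intro closed_INT ballI closed_Collect_le continuous_intros)
  moreover have "bounded ccell"
  proof (rule boundedI)
    fix v assume "v \<in> ccell"
    have "norm v = norm (\<Sum>i\<in>UNIV. (v \<bullet> d i) *\<^sub>R M i)" using expand_M[of v] by simp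
    also have "\<dots> \<le> (\<Sum>i\<in>UNIV. \<bar>v \<bullet> d i\<bar> * norm (M i))" by (rule sum_norm_le) simp
    also have "\<dots> \<le> (\<Sum>i\<in>UNIV. 1/2 * norm (M i))"
      using \<open>v \<in> ccell\<close> by (intro sum_mono mult_right_mono) (auto simp: ccell_def)
    finally show "norm v \<le> (\<Sum>i\<in>UNIV. 1/2 * norm (M i))" .
  qed
  ultimately show ?thesis by (simp add: compact_eq_bounded_closed)
qed

lemma cell_subset: "cell \<subseteq> ccell"
proof
  fix v assume "v \<in> cell"
  then have "- (1/2) \<le> v \<bullet> d i \<and> v \<bullet> d i < 1/2" for i by (simp add: cell_def)
  then have "\<bar>v \<bullet> d i\<bar> \<le> 1/2" for i by (smt (verit))
  then show "v \<in> ccell" by (simp add: ccell_def)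
qed

lemma emeasure_cell: "emeasure lborel cell < \<infinity>"
proof -
  have "emeasure lborel cell \<le> emeasure lborel ccell"
    using cell_subset compact_ccell by (intro emeasure_mono) (auto intro: borel_compact)
  also have "\<dots> < \<infinity>" using compact_ccell emeasure_compact_finite by blast
  finally show ?thesis .
qed

lemma K0_bounds: "0 \<le> K0 v" "K0 v \<le> 1"
  unfolding K0_def by (auto intro!: prod_nonneg prod_le_1 simp: power_le_one_iff abs_cos_le_one abs_square_le_1)

lemma continuous_K0: "continuous_on A K0"
  unfolding K0_def by (intro continuous_intros)

lemma K0_periodic: "x \<in> L \<Longrightarrow> K0 (v + x) = K0 v"
  unfolding K0_def
proof (intro prod.cong refl)
  fix i assume "x \<in> L"
  then obtain k where k: "x \<bullet> d i = of_int k" using L_inner_d by blast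
  have "(cos (pi * ((v + x) \<bullet> d i)))\<^sup>2 = (cos (pi * (v \<bullet> d i) + of_int k * pi))\<^sup>2"
    by (simp add: inner_add_left k algebra_simps)
  also have "\<dots> = (cos (pi * (v \<bullet> d i)))\<^sup>2 * (cos (of_int k * pi))\<^sup>2"
    by (simp add: cos_add power_mult_distrib mult.commute[of _ pi])
  also have "(cos (of_int k * pi))\<^sup>2 = 1"
    by (metis cos_int_times_real cos_squared_eq sin_zero_iff_int2 diff_zero power_zero_numeral)
  finally show "(cos (pi * ((v + x) \<bullet> d i)))\<^sup>2 = (cos (pi * (v \<bullet> d i)))\<^sup>2" by simp
qed

lemma K0_less_1:
  assumes "v \<in> ccell" "v \<noteq> 0"
  shows "K0 v < 1"
proof -
  obtain i where i: "v \<bullet> d i \<noteq> 0"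
    using expand_M[of v] assms(2) by (metis (no_types, lifting) scaleR_zero_left sum.neutral)
  have "\<bar>v \<bullet> d i\<bar> \<le> 1/2" using assms by (simp add: ccell_def)
  have "(sin (pi * (v \<bullet> d i)))\<^sup>2 > 0"
  proof -
    have "sin (pi * \<bar>v \<bullet> d i\<bar>) > 0"
    proof (rule sin_gt_zero)
      show "pi * \<bar>v \<bullet> d i\<bar> < pi"
        using mult_strict_left_mono[of "\<bar>v \<bullet> d i\<bar>" 1 pi] \<open>\<bar>v \<bullet> d i\<bar> \<le> 1/2\<close> by simp
    qed (use i in simp)
    then show ?thesis by (auto simp: abs_if split: if_splits)
  qed
  then have c: "(cos (pi * (v \<bullet> d i)))\<^sup>2 < 1" by (simp add: cos_squared_eq)
  have "K0 v = (cos (pi * (v \<bullet> d i)))\<^sup>2 * (\<Prod>j\<in>UNIV - {i}. (cos (pi * (v \<bullet> d j)))\<^sup>2)"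
    unfolding K0_def by (subst prod.remove[of _ i]) auto
  also have "\<dots> \<le> (cos (pi * (v \<bullet> d i)))\<^sup>2 * 1"
    by (intro mult_left_mono prod_le_1) (auto simp: abs_square_le_1 abs_cos_le_one)
  finally show ?thesis using c by simp
qed

end

section \<open>Unfolding and concentration of the kernel\<close>

context unimodular_basis begin

text \<open>The translates of \<open>cell\<close> partition the space, so the integral splits into
  one piece per lattice vector. Each piece is translated back to \<open>cell\<close>, where
  periodicity leaves \<open>K\<close> unchanged and the shifted Gaussians add up to
  \<open>theta\<close>. With nonnegative integrals both exchanges of sum and integral are
  free.\<close>

lemma nn_integral_unfold:
  fixes v0 :: "real^'n"
  assumes "t > 0" and [measurable]: "K \<in> borel_measurable borel"
    and K: "\<And>v. K v \<ge> 0" "\<And>x v. x \<in> L \<Longrightarrow> K (v + x) = K v"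
  shows "(\<integral>\<^sup>+v. ennreal (gauss t (v + v0) * K v) \<partial>lborel)
    = (\<integral>\<^sup>+v. ennreal (indicator cell v * (theta t (v + v0) * K v)) \<partial>lborel)"
proof -
  note [measurable] = cell_sets
  let ?g = "\<lambda>v. ennreal (gauss t (v + v0) * K v)"
  have one: "(\<integral>\<^sup>+x. indicator cell (v - x) \<partial>count_space L) = 1" for v
  proof -
    obtain x0 where x0: "x0 \<in> L" "\<And>y. y \<in> L \<Longrightarrow> v - y \<in> cell \<longleftrightarrow> y = x0"
      using cell_unique[of v] by blast
    have "(\<integral>\<^sup>+x. indicator cell (v - x) \<partial>count_space L) = (\<integral>\<^sup>+x. indicator {x0} x \<partial>count_space L)"
      by (intro nn_integral_cong) (use x0 in \<open>auto simp: indicator_def\<close>)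
    also have "\<dots> = 1" using x0 by (subst nn_integral_indicator) auto
    finally show ?thesis .
  qed
  have "(\<integral>\<^sup>+v. ?g v \<partial>lborel) = (\<integral>\<^sup>+v. (\<integral>\<^sup>+x. indicator cell (v - x) * ?g v \<partial>count_space L) \<partial>lborel)"
    by (simp add: nn_integral_multc one)
  also have "\<dots> = (\<integral>\<^sup>+x. (\<integral>\<^sup>+v. indicator cell (v - x) * ?g v \<partial>lborel) \<partial>count_space L)"
    by (rule nn_integral_count_space_nn_integral[OF countable_L]) measurable
  also have "\<dots> = (\<integral>\<^sup>+x. (\<integral>\<^sup>+v. indicator cell v * ennreal (gauss t (x + (v + v0)) * K v) \<partial>lborel) \<partial>count_space L)"
  proof (rule nn_integral_cong)
    fix x assume "x \<in> space (count_space L)"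
    then have x: "x \<in> L" by simp
    have "(\<integral>\<^sup>+v. indicator cell (v - x) * ?g v \<partial>lborel) = (\<integral>\<^sup>+v. indicator cell (v - x) * ?g v \<partial>distr lborel borel ((+) x))"
      by (simp add: lborel_distr_plus)
    also have "\<dots> = (\<integral>\<^sup>+v. indicator cell (x + v - x) * ?g (x + v) \<partial>lborel)"
      by (subst nn_integral_distr) measurable
    also have "\<dots> = (\<integral>\<^sup>+v. indicator cell v * ennreal (gauss t (x + (v + v0)) * K v) \<partial>lborel)"
      using K(2)[OF x] by (simp add: add.assoc add.commute[of x])
    finally show "(\<integral>\<^sup>+v. indicator cell (v - x) * ?g v \<partial>lborel) = \<dots>" .
  qed
  also have "\<dots> = (\<integral>\<^sup>+v. (\<integral>\<^sup>+x. indicator cell v * ennreal (gauss t (x + (v + v0)) * K v) \<partial>count_space L) \<partial>lborel)"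
    by (rule nn_integral_count_space_nn_integral[OF countable_L, symmetric]) measurable
  also have "\<dots> = (\<integral>\<^sup>+v. ennreal (indicator cell v * (theta t (v + v0) * K v)) \<partial>lborel)"
  proof (rule nn_integral_cong)
    fix v
    let ?e = "\<lambda>x. gauss t (x + (v + v0))"
    have abs: "Infinite_Set_Sum.abs_summable_on ?e L"
      using gauss_shift_summable[OF \<open>t > 0\<close>, of "v + v0"] summable_on_iff_abs_summable_on_real
      by (metis abs_summable_equivalent)
    have "(\<integral>\<^sup>+x. indicator cell v * ennreal (?e x * K v) \<partial>count_space L)
        = (\<integral>\<^sup>+x. ennreal (?e x) * (ennreal (K v) * indicator cell v) \<partial>count_space L)"
      by (intro nn_integral_cong) (simp add: ennreal_mult K mult_ac)
    also have "\<dots> = (\<integral>\<^sup>+x. ennreal (?e x) \<partial>count_space L) * (ennreal (K v) * indicator cell v)"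
      by (rule nn_integral_multc) simp
    also have "(\<integral>\<^sup>+x. ennreal (?e x) \<partial>count_space L) = ennreal (theta t (v + v0))"
      using nn_integral_conv_infsetsum[OF abs] abs by (simp add: infsetsum_infsum theta_def)
    also have "ennreal (theta t (v + v0)) * (ennreal (K v) * indicator cell v) = ennreal (indicator cell v * (theta t (v + v0) * K v))"
      using theta_pos[OF \<open>t > 0\<close>, of "v + v0"] K by (simp add: ennreal_mult indicator_def)
    finally show "(\<integral>\<^sup>+x. indicator cell v * ennreal (?e x * K v) \<partial>count_space L)
        = ennreal (indicator cell v * (theta t (v + v0) * K v))" .
  qed
  finally show ?thesis .
qed

lemma integrable_cell:
  fixes f :: "real^'n \<Rightarrow> real"
  assumes "continuous_on UNIV f"
  shows "integrable lborel (\<lambda>v. indicator cell v * f v)"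
proof -
  have "continuous_on ccell f" using assms continuous_on_subset by blast
  then obtain B where B: "\<And>v. v \<in> ccell \<Longrightarrow> norm (f v) \<le> B"
    using compact_ccell compact_continuous_image compact_imp_bounded bounded_iff by (metis image_eqI)
  have [measurable]: "f \<in> borel_measurable borel" using assms by (rule borel_measurable_continuous_onI)
  note [measurable] = cell_sets
  show ?thesis
  proof (rule Bochner_Integration.integrable_bound)
    show "integrable lborel (\<lambda>v. indicator cell v * B)"
      using emeasure_cell cell_sets by (intro integrable_mult_left integrable_real_indicator) auto
    show "AE v in lborel. norm (indicator cell v * f v) \<le> norm (indicator cell v * B)"
      using B cell_subset by (intro AE_I2) (auto simp: indicator_def intro: order_trans[OF _ abs_ge_self])
  qed measurable
qed

lemma ball_subset_cell: obtains r where "r > 0" "ball 0 r \<subseteq> cell"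
proof -
  let ?U = "{v. \<forall>i. - (1/2) < v \<bullet> d i \<and> v \<bullet> d i < 1/2}"
  have "?U = (\<Inter>i. {v. - (1/2) < v \<bullet> d i} \<inter> {v. v \<bullet> d i < 1/2})" by auto
  moreover have "open \<dots>"
    by (intro open_INT open_Int ballI open_Collect_less continuous_intros) auto
  ultimately have "open ?U" by simp
  moreover have "0 \<in> ?U" by simp
  ultimately obtain r where "r > 0" "ball 0 r \<subseteq> ?U" by (rule openE)
  moreover have "?U \<subseteq> cell" by (auto simp: cell_def less_imp_le)
  ultimately show ?thesis using that by blast
qed

abbreviation kernel_mass :: "nat \<Rightarrow> real" where
  "kernel_mass N \<equiv> (\<integral>v. indicator cell v * K0 v ^ N \<partial>lborel)"

abbreviation kernel_integral :: "(real^'n \<Rightarrow> real) \<Rightarrow> nat \<Rightarrow> real" where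
  "kernel_integral f N \<equiv> (\<integral>v. indicator cell v * (f v * K0 v ^ N) \<partial>lborel)"

text \<open>Laplace's method: away from 0 compactness bounds \<open>K0\<close> by some
  \<open>\<rho> < 1\<close>, while continuity at 0 makes the total mass decay no faster than
  \<sigma>^N for any prescribed \<sigma> < 1.\<close>

lemma kernel_mass_pos: "kernel_mass N > 0"
  and kernel_tail_tendsto: "r > 0 \<Longrightarrow> (\<lambda>N. kernel_integral (indicator (- ball 0 r)) N / kernel_mass N) \<longlonglongrightarrow> 0"
proof -
  note [measurable] = cell_sets
  have K0m [measurable]: "K0 \<in> borel_measurable borel"
    by (intro borel_measurable_continuous_onI continuous_K0)
  have int: "integrable lborel (\<lambda>v. indicator cell v * K0 v ^ N)" for N
    by (intro integrable_cell continuous_intros continuous_K0)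
  have lower: "\<exists>m>0. \<forall>N. kernel_mass N \<ge> \<rho> ^ N * m" if \<rho>: "0 \<le> \<rho>" "\<rho> < 1" for \<rho>
  proof -
    have "K0 0 = 1" by (simp add: K0_def)
    have "open {v. \<rho> < K0 v}" by (intro open_Collect_less continuous_intros continuous_K0)
    then obtain r1 where r1: "r1 > 0" "ball 0 r1 \<subseteq> {v. \<rho> < K0 v}"
      using \<rho> \<open>K0 0 = 1\<close> by (metis mem_Collect_eq openE)
    obtain r2 where r2: "r2 > 0" "ball 0 r2 \<subseteq> cell" by (rule ball_subset_cell)
    define s where "s = min r1 r2"
    have s: "s > 0" "ball 0 s \<subseteq> cell" "\<And>v. v \<in> ball 0 s \<Longrightarrow> \<rho> < K0 v" using r1 r2 by (auto simp: s_def)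
    define m where "m = measure lborel (ball (0::real^'n) s)"
    have "m > 0" unfolding m_def using s(1) by (simp add: content_ball_pos)
    moreover have "kernel_mass N \<ge> \<rho> ^ N * m" for N
    proof -
      have "\<rho> ^ N * m = (\<integral>v. indicator (ball (0::real^'n) s) v * \<rho> ^ N \<partial>lborel)"
        by (simp add: m_def)
      also have "\<dots> \<le> kernel_mass N"
      proof (rule integral_mono)
        show "integrable lborel (\<lambda>v. indicator (ball (0::real^'n) s) v * \<rho> ^ N)"
          using emeasure_bounded_finite[of "ball (0::real^'n) s"] by (intro integrable_mult_left integrable_real_indicator) auto
        fix v :: "real^'n"
        show "indicator (ball 0 s) v * \<rho> ^ N \<le> indicator cell v * K0 v ^ N"
          using s(2) s(3)[of v] \<rho> K0_bounds(1)[of v] by (auto simp: indicator_def intro: power_mono less_imp_le)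
      qed (rule int)
      finally show ?thesis .
    qed
    ultimately show ?thesis by blast
  qed
  have pos: "kernel_mass N > 0" for N
  proof -
    obtain m where "m > 0" "kernel_mass N \<ge> (1/2) ^ N * m"
      using lower[of "1/2"] by auto
    then show ?thesis by (smt (verit) mult_pos_pos zero_less_power half_gt_zero_iff)
  qed
  show "kernel_mass N > 0" by (rule pos)
  show "(\<lambda>N. kernel_integral (indicator (- ball 0 r)) N / kernel_mass N) \<longlonglongrightarrow> 0" if "r > 0"
  proof -
    let ?S = "ccell - ball 0 r"
    have cS: "compact ?S" by (intro compact_diff compact_ccell) auto
    obtain \<rho> where \<rho>: "0 \<le> \<rho>" "\<rho> < 1" "\<And>v. v \<in> ?S \<Longrightarrow> K0 v \<le> \<rho>"
    proof (cases "?S = {}")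
      case True
      then have "K0 v \<le> 0" if "v \<in> ?S" for v using that by (metis empty_iff)
      then show ?thesis using that[of 0] by simp
    next
      case False
      obtain w where w: "w \<in> ?S" "\<And>v. v \<in> ?S \<Longrightarrow> K0 v \<le> K0 w"
        using continuous_attains_sup[OF cS False continuous_K0] by blast
      have "w \<noteq> 0" using w(1) \<open>r > 0\<close> by auto
      then have "K0 w < 1" using w(1) by (intro K0_less_1) auto
      then show ?thesis using that[of "K0 w"] w K0_bounds(1) by blast
    qed
    \<comment> \<open>Any value strictly between \<open>\<rho>\<close> and 1 serves: the quotient is
      then bounded by a multiple of \<open>(\<rho> / \<sigma>) ^ N\<close>.\<close>
    define \<sigma> where "\<sigma> = (1 + \<rho>) / 2"
    have \<sigma>: "\<rho> < \<sigma>" "0 < \<sigma>" "\<sigma> < 1" using \<rho> by (auto simp: \<sigma>_def)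
    obtain m where m: "m > 0" "\<And>N. kernel_mass N \<ge> \<sigma> ^ N * m"
      using lower[of \<sigma>] \<sigma> by auto
    let ?T = "\<lambda>N. kernel_integral (indicator (- ball 0 r)) N"
    define C where "C = measure lborel cell"
    have T0: "?T N \<ge> 0" for N
      by (intro integral_nonneg_AE AE_I2) (auto simp: indicator_def K0_bounds)
    have T1: "?T N \<le> \<rho> ^ N * C" for N
    proof -
      have "?T N \<le> (\<integral>v. indicator cell v * \<rho> ^ N \<partial>lborel)"
      proof (rule integral_mono')
        show "integrable lborel (\<lambda>v. indicator cell v * \<rho> ^ N)"
          using emeasure_cell cell_sets by (intro integrable_mult_left integrable_real_indicator) auto
        fix v
        show "indicator cell v * (indicator (- ball 0 r) v * K0 v ^ N) \<le> indicator cell v * \<rho> ^ N"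
          using \<rho> cell_subset K0_bounds(1)[of v] by (auto simp: indicator_def intro: power_mono)
        show "0 \<le> indicator cell v * \<rho> ^ N" using \<rho> by (simp add: indicator_def)
      qed
      then show ?thesis using cell_sets by (simp add: C_def mult.commute)
    qed
    show "(\<lambda>N. ?T N / kernel_mass N) \<longlonglongrightarrow> 0"
    proof (rule tendsto_sandwich[of "\<lambda>_. 0"])
      show "\<forall>\<^sub>F N in sequentially. ?T N / kernel_mass N \<le> (\<rho> / \<sigma>) ^ N * (C / m)"
      proof (intro always_eventually allI)
        fix N
        have "?T N / kernel_mass N \<le> (\<rho> ^ N * C) / (\<sigma> ^ N * m)"
          using T1[of N] T0[of N] m(1) m(2)[of N] \<sigma> by (intro frac_le) auto
        then show "?T N / kernel_mass N \<le> (\<rho> / \<sigma>) ^ N * (C / m)"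
          by (simp add: power_divide)
      qed
      have "(\<lambda>N. (\<rho> / \<sigma>) ^ N) \<longlonglongrightarrow> 0" using \<rho> \<sigma> by (intro LIMSEQ_power_zero) simp
      then show "(\<lambda>N. (\<rho> / \<sigma>) ^ N * (C / m)) \<longlonglongrightarrow> 0" by (rule tendsto_mult_left_zero)
    qed (use T0 pos in \<open>auto intro!: always_eventually divide_nonneg_pos\<close>)
  qed
qed

lemma kernel_tendsto:
  fixes f :: "real^'n \<Rightarrow> real"
  assumes f: "continuous_on UNIV f"
  shows "(\<lambda>N. kernel_integral f N / kernel_mass N) \<longlonglongrightarrow> f 0"
proof -
  note [measurable] = cell_sets
  have K0m [measurable]: "K0 \<in> borel_measurable borel"
    by (intro borel_measurable_continuous_onI continuous_K0)
  let ?T = "\<lambda>r N. kernel_integral (indicator (- ball 0 r)) N"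
  have int: "integrable lborel (\<lambda>v. indicator cell v * K0 v ^ N)" for N
    by (intro integrable_cell continuous_intros continuous_K0)
  have intf: "integrable lborel (\<lambda>v. indicator cell v * (f v * K0 v ^ N))" for N
    by (intro integrable_cell continuous_intros continuous_K0 f)
  have intT: "integrable lborel (\<lambda>v. indicator cell v * (indicator (- ball 0 r) v * K0 v ^ N))" for N r
  proof (rule Bochner_Integration.integrable_bound[OF int[of N]])
    show "AE v in lborel. norm (indicator cell v * (indicator (- ball 0 r) v * K0 v ^ N)) \<le> norm (indicator cell v * K0 v ^ N)"
      by (intro AE_I2) (auto simp: indicator_def)
  qed measurable
  have "continuous_on ccell f" using f continuous_on_subset by blast
  then obtain B0 where B0: "\<And>v. v \<in> ccell \<Longrightarrow> norm (f v) \<le> B0"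
    using compact_ccell compact_continuous_image compact_imp_bounded bounded_iff by (metis image_eqI)
  define B where "B = B0 + \<bar>f 0\<bar> + 1"
  have "0 \<in> ccell" by (simp add: ccell_def)
  have B: "B > 0" "\<And>v. v \<in> cell \<Longrightarrow> \<bar>f v - f 0\<bar> \<le> B"
    using B0[OF \<open>0 \<in> ccell\<close>] B0 cell_subset unfolding B_def by (auto, smt (verit) real_norm_def subsetD)
  show ?thesis
  proof (rule LIMSEQ_I)
    fix e :: real assume "e > 0"
    have "isCont f 0" using f by (simp add: continuous_on_eq_continuous_at)
    then obtain r where r: "r > 0" "\<And>v. dist v 0 < r \<Longrightarrow> dist (f v) (f 0) < e / 2"
      unfolding continuous_at_eps_delta using \<open>e > 0\<close> by (metis half_gt_zero)
    obtain N0 where N0: "\<And>N. N \<ge> N0 \<Longrightarrow> norm (?T r N / kernel_mass N - 0) < e / (2 * B)"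
      using LIMSEQ_D[OF kernel_tail_tendsto[OF r(1)], of "e / (2 * B)"] \<open>e > 0\<close> B(1) by auto
    show "\<exists>no. \<forall>n\<ge>no. norm (kernel_integral f n / kernel_mass n - f 0) < e"
    proof (intro exI allI impI)
      fix N assume "N \<ge> N0"
      have "kernel_integral f N - f 0 * kernel_mass N = (\<integral>v. indicator cell v * (f v * K0 v ^ N) - f 0 * (indicator cell v * K0 v ^ N) \<partial>lborel)"
        by (subst Bochner_Integration.integral_diff) (use int intf in auto)
      then have "\<bar>kernel_integral f N - f 0 * kernel_mass N\<bar> = norm (\<integral>v. indicator cell v * (f v * K0 v ^ N) - f 0 * (indicator cell v * K0 v ^ N) \<partial>lborel)"
        by simp
      also have "\<dots> \<le> (\<integral>v. e / 2 * (indicator cell v * K0 v ^ N) + B * (indicator cell v * (indicator (- ball 0 r) v * K0 v ^ N)) \<partial>lborel)"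
      proof (rule Bochner_Integration.integral_norm_bound_integral)
        fix v
        show "norm (indicator cell v * (f v * K0 v ^ N) - f 0 * (indicator cell v * K0 v ^ N))
          \<le> e / 2 * (indicator cell v * K0 v ^ N) + B * (indicator cell v * (indicator (- ball 0 r) v * K0 v ^ N))"
        proof (cases "v \<in> cell")
          case True
          have K: "K0 v ^ N \<ge> 0" using K0_bounds by simp
          have "norm (f v * K0 v ^ N - f 0 * K0 v ^ N) = \<bar>f v - f 0\<bar> * K0 v ^ N"
            using K by (simp add: abs_mult flip: left_diff_distrib)
          also have "\<dots> \<le> (e / 2 + B * indicator (- ball 0 r) v) * K0 v ^ N"
          proof (rule mult_right_mono[OF _ K])
            show "\<bar>f v - f 0\<bar> \<le> e / 2 + B * indicator (- ball 0 r) v"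
              using r(2)[of v] B(2)[OF True] \<open>e > 0\<close> by (auto simp: indicator_def dist_norm)
          qed
          finally show ?thesis using True by (simp add: algebra_simps)
        qed simp
      qed (use int intf intT in auto)
      also have "\<dots> = e / 2 * kernel_mass N + B * ?T r N"
        by (subst Bochner_Integration.integral_add) (use int intT in auto)
      finally have "\<bar>kernel_integral f N - f 0 * kernel_mass N\<bar> \<le> e / 2 * kernel_mass N + B * ?T r N" .
      moreover have "norm (kernel_integral f N / kernel_mass N - f 0) = \<bar>kernel_integral f N - f 0 * kernel_mass N\<bar> / kernel_mass N"
        using kernel_mass_pos[of N] by (simp add: field_simps abs_divide)
      ultimately have "norm (kernel_integral f N / kernel_mass N - f 0) \<le> (e / 2 * kernel_mass N + B * ?T r N) / kernel_mass N"
        using kernel_mass_pos[of N] by (simp add: divide_right_mono less_imp_le)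
      also have "\<dots> = e / 2 + B * (?T r N / kernel_mass N)" using kernel_mass_pos[of N] by (simp add: field_simps)
      also have "\<dots> < e / 2 + B * (e / (2 * B))"
      proof -
        have "\<bar>?T r N / kernel_mass N\<bar> < e / (2 * B)"
          using N0[OF \<open>N \<ge> N0\<close>] by (simp only: real_norm_def diff_zero)
        then have "?T r N / kernel_mass N < e / (2 * B)" by (rule order_le_less_trans[OF abs_ge_self])
        then show ?thesis using B(1) by (intro add_strict_left_mono mult_strict_left_mono)
      qed
      also have "\<dots> = e" using B(1) by simp
      finally show "norm (kernel_integral f N / kernel_mass N - f 0) < e" .
    qed
  qed
qed

text \<open>The frequency side of the Poisson summation formula for the translate by
  \<open>v\<close>; by self-duality the sum over the dual lattice is again a sum over
  \<open>L\<close>.\<close>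

definition dual_theta :: "real \<Rightarrow> real^'n \<Rightarrow> complex" where
  "dual_theta t v = (\<Sum>\<^sub>\<infinity>y\<in>L. of_real ((1 / sqrt t) ^ CARD('n) * exp (- pi * (norm y)\<^sup>2 / t)) * cis (- 2 * pi * (v \<bullet> y)))"

lemma K0_power_expand:
  fixes N defines "\<beta> \<equiv> (4 ^ N / real ((2 * N) choose N)) ^ CARD('n)"
  shows "of_real (\<beta> * K0 v ^ N) = (\<Sum>c\<in>PiE UNIV (\<lambda>_. {- int N..int N}).
      of_real (\<Prod>i\<in>UNIV. cos_weight N (c i)) * cis (2 * pi * (v \<bullet> emb c)))"
proof -
  have "of_real (\<beta> * K0 v ^ N) = (\<Prod>i\<in>(UNIV::'n set). complex_of_real (4 ^ N / real ((2 * N) choose N) * (cos (pi * (v \<bullet> d i)) ^ 2) ^ N))"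
    by (simp add: \<beta>_def K0_def prod.distrib prod_dividef power_divide prod_power_distrib)
  also have "\<dots> = (\<Prod>i\<in>(UNIV::'n set). \<Sum>j\<in>{- int N..int N}. of_real (cos_weight N j) * cis (2 * pi * (of_int j * (v \<bullet> d i))))"
    by (simp only: cos_power_expand)
  also have "\<dots> = (\<Sum>c\<in>PiE UNIV (\<lambda>_. {- int N..int N}). \<Prod>i\<in>UNIV. of_real (cos_weight N (c i)) * cis (2 * pi * (of_int (c i) * (v \<bullet> d i))))"
    by (rule prod_sum_PiE) auto
  also have "\<dots> = (\<Sum>c\<in>PiE UNIV (\<lambda>_. {- int N..int N}). of_real (\<Prod>i\<in>UNIV. cos_weight N (c i)) * cis (2 * pi * (v \<bullet> emb c)))"
  proof (intro sum.cong refl)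
    fix c :: "'n \<Rightarrow> int"
    have "(\<Prod>i\<in>UNIV. cis (2 * pi * (of_int (c i) * (v \<bullet> d i)))) = cis (2 * pi * (v \<bullet> emb c))"
      by (simp add: cis_conv_exp emb_def inner_sum_right sum_distrib_left exp_sum)
    then show "(\<Prod>i\<in>UNIV. of_real (cos_weight N (c i)) * cis (2 * pi * (of_int (c i) * (v \<bullet> d i))))
        = of_real (\<Prod>i\<in>UNIV. cos_weight N (c i)) * cis (2 * pi * (v \<bullet> emb c))"
      by (simp add: prod.distrib)
  qed
  finally show ?thesis .
qed

text \<open>The normalised kernel is a finite trigonometric sum, so the integral is a finite
  weighted sum of Fourier transforms of the Gaussian at the points \<open>emb c\<close>. The weights
  lie in [0,1] and tend to 1, and the Gaussian decay of the transforms justifies the limit.\<close>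

lemma gauss_kernel_tendsto:
  fixes v0 :: "real^'n"
  defines "\<beta> \<equiv> \<lambda>N. (4 ^ N / real ((2 * N) choose N)) ^ CARD('n)"
  assumes t: "t > 0"
  shows "integrable lborel (\<lambda>v. gauss t (v + v0) * (\<beta> N * K0 v ^ N))"
    and "(\<lambda>N. complex_of_real (\<integral>v. gauss t (v + v0) * (\<beta> N * K0 v ^ N) \<partial>lborel)) \<longlonglongrightarrow> dual_theta t v0"
proof -
  let ?A = "\<lambda>y. complex_of_real ((1 / sqrt t) ^ CARD('n) * exp (- pi * (norm y)\<^sup>2 / t)) * cis (- 2 * pi * (v0 \<bullet> y))"
  let ?g = "\<lambda>v. complex_of_real (gauss t (v + v0))"
  have FT: "integrable lborel (\<lambda>v. ?g v * cis (2 * pi * (v \<bullet> y)))"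
    "(\<integral>v. ?g v * cis (2 * pi * (v \<bullet> y)) \<partial>lborel) = ?A y" for y :: "real^'n"
  proof -
    let ?h = "\<lambda>w. complex_of_real (gauss t w) * cis (2 * pi * (w \<bullet> y))"
    have eq: "?g v * cis (2 * pi * (v \<bullet> y)) = cis (- 2 * pi * (v0 \<bullet> y)) * ?h (v0 + v)" for v
      by (simp add: add.commute[of v0] inner_add_left distrib_left mult.left_commute[of "cis _"] cis_mult)
    have hm: "?h \<in> borel_measurable borel"
      using gauss_fourier(1)[OF t, of y] by (auto dest: borel_measurable_integrable)
    have D: "lborel = distr lborel borel ((+) v0)" by (rule lborel_distr_plus[symmetric])
    have i1: "integrable lborel (\<lambda>v. ?h (v0 + v))"
    proof -
      have "integrable (distr lborel borel ((+) v0)) ?h"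
        unfolding D[symmetric] by (rule gauss_fourier(1)[OF t])
      then show ?thesis by (rule integrable_distr[rotated]) measurable
    qed
    have i2: "(\<integral>v. ?h (v0 + v) \<partial>lborel) = integral\<^sup>L lborel ?h"
      using hm by (subst (2) D) (simp add: integral_distr)
    show "integrable lborel (\<lambda>v. ?g v * cis (2 * pi * (v \<bullet> y)))"
      unfolding eq by (intro integrable_mult_right i1)
    show "(\<integral>v. ?g v * cis (2 * pi * (v \<bullet> y)) \<partial>lborel) = ?A y"
      unfolding eq by (simp only: integral_mult_right_zero i2 gauss_fourier(2)[OF t]) (simp add: mult.commute)
  qed
  let ?S = "\<lambda>N. PiE (UNIV::'n set) (\<lambda>_. {- int N..int N})"
  let ?w = "\<lambda>N c. \<Prod>i\<in>(UNIV::'n set). cos_weight N (c i)"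
  have fin: "finite (?S N)" for N by (intro finite_PiE) auto
  have eq: "complex_of_real (gauss t (v + v0) * (\<beta> N * K0 v ^ N))
      = (\<Sum>c\<in>?S N. of_real (?w N c) * (?g v * cis (2 * pi * (v \<bullet> emb c))))" for N v
    unfolding of_real_mult[of "exp _"] \<beta>_def K0_power_expand by (simp add: sum_distrib_left mult_ac)
  have "integrable lborel (\<lambda>v. complex_of_real (gauss t (v + v0) * (\<beta> N * K0 v ^ N)))" for N
    unfolding eq by (intro Bochner_Integration.integrable_sum integrable_mult_right FT(1))
  then show "integrable lborel (\<lambda>v. gauss t (v + v0) * (\<beta> N * K0 v ^ N))" for N
    by (simp only: complex_of_real_integrable_eq)
  have I: "complex_of_real (\<integral>v. gauss t (v + v0) * (\<beta> N * K0 v ^ N) \<partial>lborel)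
      = (\<Sum>\<^sub>\<infinity>c\<in>UNIV. of_real (?w N c) * ?A (emb c))" for N
  proof -
    have "complex_of_real (\<integral>v. gauss t (v + v0) * (\<beta> N * K0 v ^ N) \<partial>lborel)
      = (\<integral>v. (\<Sum>c\<in>?S N. of_real (?w N c) * (?g v * cis (2 * pi * (v \<bullet> emb c)))) \<partial>lborel)"
      unfolding eq[symmetric] by (rule integral_complex_of_real[symmetric])
    also have "\<dots> = (\<Sum>c\<in>?S N. of_real (?w N c) * ?A (emb c))"
      by (subst Bochner_Integration.integral_sum)
        (auto intro!: integrable_mult_right FT(1) sum.cong simp only: integral_mult_right_zero FT(2))
    also have "\<dots> = (\<Sum>\<^sub>\<infinity>c\<in>?S N. of_real (?w N c) * ?A (emb c))"
      using fin by simp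
    also have "\<dots> = (\<Sum>\<^sub>\<infinity>c\<in>UNIV. of_real (?w N c) * ?A (emb c))"
    proof (rule infsum_cong_neutral)
      fix c assume "c \<in> UNIV - ?S N"
      then obtain i where "c i \<notin> {- int N..int N}" by blast
      then have "cos_weight N (c i) = 0" by (auto simp: cos_weight_def)
      then have "?w N c = 0" by (intro prod_zero) auto
      then show "of_real (?w N c) * ?A (emb c) = 0" by simp
    qed auto
    finally show ?thesis .
  qed
  have "(\<lambda>N. \<Sum>\<^sub>\<infinity>c\<in>UNIV. of_real (?w N c) * ?A (emb c)) \<longlonglongrightarrow> (\<Sum>\<^sub>\<infinity>c\<in>UNIV. ?A (emb c))"
  proof (rule tendsto_infsum_dominated)
    have "(\<lambda>y. (1 / sqrt t) ^ CARD('n) * exp (- (pi / t) * (norm y)\<^sup>2)) summable_on L"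
      using t by (intro summable_on_cmult_right gauss_summable) auto
    then show "(\<lambda>c. (1 / sqrt t) ^ CARD('n) * exp (- (pi / t) * (norm (emb c))\<^sup>2)) summable_on UNIV"
      using summable_on_reindex_bij_betw[OF bij_emb, of "\<lambda>y. (1 / sqrt t) ^ CARD('n) * exp (- (pi / t) * (norm y)\<^sup>2)"] by simp
    fix c N
    have w: "0 \<le> ?w N c" "?w N c \<le> 1"
      by (auto intro!: prod_nonneg prod_le_1 simp: cos_weight_bounds)
    have "norm (?A (emb c)) = (1 / sqrt t) ^ CARD('n) * exp (- (pi / t) * (norm (emb c))\<^sup>2)"
      using t by (simp add: norm_mult norm_power norm_divide)
    then show "norm (of_real (?w N c) * ?A (emb c)) \<le> (1 / sqrt t) ^ CARD('n) * exp (- (pi / t) * (norm (emb c))\<^sup>2)"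
      using w t mult_left_le_one_le[of "norm (?A (emb c))" "?w N c"] by (simp only: norm_mult norm_of_real) simp
  next
    fix c
    have "(\<lambda>N. ?w N c) \<longlonglongrightarrow> (\<Prod>i\<in>(UNIV::'n set). 1)" by (intro Limits.tendsto_prod cos_weight_tendsto)
    then have "(\<lambda>N. complex_of_real (?w N c)) \<longlonglongrightarrow> of_real 1" by (intro tendsto_of_real) simp
    from tendsto_mult_right[OF this, of "?A (emb c)"]
    show "(\<lambda>N. of_real (?w N c) * ?A (emb c)) \<longlonglongrightarrow> ?A (emb c)" by simp
  qed
  also have "(\<Sum>\<^sub>\<infinity>c\<in>UNIV. ?A (emb c)) = dual_theta t v0"
    unfolding dual_theta_def by (rule infsum_reindex_bij_betw[OF bij_emb])
  finally show "(\<lambda>N. complex_of_real (\<integral>v. gauss t (v + v0) * (\<beta> N * K0 v ^ N) \<partial>lborel)) \<longlonglongrightarrow> dual_theta t v0"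
    unfolding I .
qed

text \<open>Poisson summation: unfolding turns the Gaussian integral against the kernel into an integral of
  \<open>theta\<close> over the cell, so that \<open>dual_theta\<close> is \<open>theta\<close> times the limiting mass of the kernel. This
  mass depends neither on \<open>t\<close> nor on \<open>v\<close>, and it is 1 because both sides agree at \<open>t = 1\<close>, \<open>v = 0\<close>.\<close>

theorem theta_transformation:
  assumes t: "t > 0"
  shows "of_real (theta t v) = dual_theta t v"
proof -
  define \<beta> where "\<beta> = (\<lambda>N. (4 ^ N / real ((2 * N) choose N)) ^ CARD('n))"
  have \<beta>: "\<beta> N > 0" for N by (simp add: \<beta>_def)
  have mass: "(\<lambda>N. complex_of_real (\<beta> N * kernel_mass N)) \<longlonglongrightarrow> dual_theta t v0 / of_real (theta t v0)" if t: "t > 0" for t v0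
  proof -
    let ?J = "\<lambda>N. kernel_integral (\<lambda>v. theta t (v + v0)) N"
    have cont: "continuous_on UNIV (\<lambda>v. theta t (v + v0))"
      by (intro continuous_on_compose2[OF continuous_theta[OF t]] continuous_intros) auto
    have J: "(\<integral>v. gauss t (v + v0) * (\<beta> N * K0 v ^ N) \<partial>lborel) = \<beta> N * ?J N" for N
    proof -
      have Km: "(\<lambda>v. \<beta> N * K0 v ^ N) \<in> borel_measurable borel"
        by (intro borel_measurable_continuous_onI continuous_intros continuous_K0)
      have "(\<integral>v. gauss t (v + v0) * (\<beta> N * K0 v ^ N) \<partial>lborel)
          = enn2real (\<integral>\<^sup>+v. ennreal (gauss t (v + v0) * (\<beta> N * K0 v ^ N)) \<partial>lborel)"
        using gauss_kernel_tendsto(1)[OF t, of v0 N] \<beta>[of N] K0_bounds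
        by (intro integral_eq_nn_integral) (auto simp: \<beta>_def)
      also have "\<dots> = enn2real (\<integral>\<^sup>+v. ennreal (indicator cell v * (theta t (v + v0) * (\<beta> N * K0 v ^ N))) \<partial>lborel)"
        using \<beta>[of N] by (subst nn_integral_unfold[OF t Km]) (auto simp: K0_bounds K0_periodic)
      also have "\<dots> = (\<integral>v. indicator cell v * (theta t (v + v0) * (\<beta> N * K0 v ^ N)) \<partial>lborel)"
      proof (rule integral_eq_nn_integral[symmetric])
        have "integrable lborel (\<lambda>v. indicator cell v * (theta t (v + v0) * (\<beta> N * K0 v ^ N)))"
          by (intro integrable_cell continuous_intros cont continuous_K0)
        then show "(\<lambda>v. indicator cell v * (theta t (v + v0) * (\<beta> N * K0 v ^ N))) \<in> borel_measurable lborel"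
          by auto
        show "AE v in lborel. 0 \<le> indicator cell v * (theta t (v + v0) * (\<beta> N * K0 v ^ N))"
          using theta_pos[OF t] \<beta>[of N] K0_bounds by (intro AE_I2) (simp add: less_imp_le)
      qed
      also have "\<dots> = (\<integral>v. \<beta> N * (indicator cell v * (theta t (v + v0) * K0 v ^ N)) \<partial>lborel)"
        by (simp add: mult_ac)
      finally show ?thesis by simp
    qed
    have "(\<lambda>N. ?J N / kernel_mass N) \<longlonglongrightarrow> theta t (0 + v0)"
      by (rule kernel_tendsto[OF cont])
    then have 1: "(\<lambda>N. complex_of_real (?J N / kernel_mass N)) \<longlonglongrightarrow> of_real (theta t v0)"
      by (intro tendsto_of_real) simp
    have 2: "(\<lambda>N. complex_of_real (\<beta> N * ?J N)) \<longlonglongrightarrow> dual_theta t v0"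
      using gauss_kernel_tendsto(2)[OF t, of v0] unfolding J[unfolded \<beta>_def] unfolding \<beta>_def .
    have "(\<lambda>N. complex_of_real (\<beta> N * ?J N) / complex_of_real (?J N / kernel_mass N)) \<longlonglongrightarrow> dual_theta t v0 / of_real (theta t v0)"
      using theta_pos[OF t, of v0] by (intro tendsto_divide 2 1) auto
    moreover have "eventually (\<lambda>N. complex_of_real (\<beta> N * ?J N) / complex_of_real (?J N / kernel_mass N) = complex_of_real (\<beta> N * kernel_mass N)) sequentially"
    proof -
      have "eventually (\<lambda>N. ?J N / kernel_mass N > 0) sequentially"
        using \<open>(\<lambda>N. ?J N / kernel_mass N) \<longlonglongrightarrow> theta t (0 + v0)\<close> theta_pos[OF t, of "0 + v0"] order_tendstoD(1) by blast
      then show ?thesis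
      proof eventually_elim
        case (elim N)
        then have "?J N \<noteq> 0" by auto
        then show ?case using kernel_mass_pos[of N] by (simp flip: of_real_mult of_real_divide)
      qed
    qed
    ultimately show ?thesis by (rule Lim_transform_eventually)
  qed
  have "dual_theta 1 0 = of_real (theta 1 0)"
  proof -
    have "((\<lambda>x. exp (- pi * 1 * (norm (x + 0))\<^sup>2)) has_sum theta 1 0) L"
      unfolding theta_def by (rule has_sum_infsum[OF gauss_shift_summable]) simp
    from has_sum_of_real[OF this, where 'a = complex]
    show ?thesis unfolding dual_theta_def by (intro infsumI) simp
  qed
  then have "dual_theta 1 0 / of_real (theta 1 0) = 1" using theta_pos[of 1 0] by simp
  then have "dual_theta t v / of_real (theta t v) = 1"
    using LIMSEQ_unique[OF mass[OF t, of v] mass[of 1 0]] by simp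
  then show ?thesis using theta_pos[OF t, of v] by (simp add: divide_eq_1_iff)
qed

end

section \<open>Vanishing of modular forms of small weight\<close>

lemma powser_coeffs_zero:
  fixes a :: "nat \<Rightarrow> 'a::{real_normed_field,banach}"
  assumes "0 < r" and sums: "\<And>x. norm x < r \<Longrightarrow> (\<lambda>n. a n * x ^ n) sums 0"
  shows "a n = 0"
proof (rule ccontr)
  assume "a n \<noteq> 0"
  have "a 0 = 0"
    using sums[of 0] \<open>0 < r\<close> sums_unique2 powser_sums_zero[of a] by fastforce
  then have "0 < n" using \<open>a n \<noteq> 0\<close> by (cases n) auto
  obtain s where s: "0 < s" "\<And>z. z \<in> cball (0::'a) s - {0} \<Longrightarrow> (\<lambda>_. 0::'a) z \<noteq> 0"
    by (rule powser_0_nonzero[of r 0 a "\<lambda>_. 0" n])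
      (use assms \<open>a n \<noteq> 0\<close> \<open>0 < n\<close> in auto)
  show False using s(2)[of "of_real s"] s(1) by simp
qed

lemma q_convergent_summable:
  fixes a :: "nat \<Rightarrow> complex"
  assumes "conv_radius a \<ge> 1" "norm z < 1"
  shows "summable (\<lambda>n. a n * z ^ n)"
  by (rule summable_in_conv_radius, rule less_le_trans[OF _ assms(1)]) (use assms(2) in simp)

text \<open>With \<open>u\<close> in the role of the squared modulus of \<tau>1, the decay of q
  between the heights 4/5 and (4/5)/u outweighs the automorphy factor of weight \<open>K\<close>.
  The inputs are \<open>- ln u \<le> 1 / u - 1\<close> and \<open>20 < 8 * pi * (4/5)\<close>. The
  height 4/5 lies in a narrow window: above 20/(8 pi), about 0.796, as needed here, and below sqrt 3
  / 2, about 0.866, so that points with real part at most 1/2 in absolute value have modulus below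
  1.\<close>

lemma theta_decay_estimate:
  fixes K :: nat and u :: real
  assumes "K \<le> 20" "0 < u" "u < 1"
  shows "exp (- 8 * pi * (4/5) * (1 / u - 1)) < u ^ K"
proof -
  define w where "w = 1 / u - 1"
  have "w > 0" using assms by (simp add: w_def)
  have "ln (1 / u) \<le> w" using ln_le_minus_one[of "1/u"] assms by (simp add: w_def)
  then have l: "- ln u \<le> w" using assms by (simp add: ln_div)
  have "ln u < 0" using assms by simp
  have "real K * (- ln u) \<le> 20 * (- ln u)"
    using \<open>ln u < 0\<close> assms(1) by (intro mult_right_mono) auto
  also have "\<dots> \<le> 20 * w" using l by simp
  also have "\<dots> < 8 * pi * (4/5) * w"
  proof -
    have "20 < 8 * pi * (4/5)" using pi_approx(1) by simp
    then show ?thesis using \<open>w > 0\<close> by (intro mult_strict_right_mono)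
  qed
  finally have "- 8 * pi * (4/5) * w < real K * ln u" by simp
  then have "exp (- 8 * pi * (4/5) * w) < exp (real K * ln u)" by simp
  also have "exp (real K * ln u) = u ^ K" using assms by (simp add: exp_of_nat_mult)
  finally show ?thesis by (simp add: w_def)
qed

text \<open>With \<open>G = q\<^sup>2 h\<close>, let \<open>\<tau>\<^sub>1\<close> maximise \<open>\<bar>h\<bar>\<close> on the line \<open>Im \<tau> = 4/5\<close>, so that \<open>\<bar>h\<bar>\<close> is nowhere larger
  above this line. Since \<open>\<bar>\<tau>\<^sub>1\<bar> < 1\<close>, the point \<open>-1/\<tau>\<^sub>1\<close> lies above the line, whereas the invariant function
  \<open>\<bar>G\<bar> (Im \<tau>)\<^bsup>K/2\<^esup>\<close> is strictly smaller there, because \<open>e\<^bsup>-4\<pi>y\<^esup> y\<^bsup>K/2\<^esup>\<close> decreases for \<open>y \<ge> 4/5\<close>.\<close>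

lemma modular_form_eq_0:
  fixes a :: "nat \<Rightarrow> complex" and G :: "complex \<Rightarrow> complex"
  assumes conv: "conv_radius a \<ge> 1"
    and "a 0 = 0" "a 1 = 0" "K \<le> 20"
    and G: "\<And>\<tau>. Im \<tau> > 0 \<Longrightarrow> (\<lambda>n. a n * exp (2 * pi * \<i> * \<tau>) ^ n) sums G \<tau>"
    and law: "\<And>\<tau>. Im \<tau> > 0 \<Longrightarrow> G (- 1 / \<tau>) = \<tau> ^ K * G \<tau>"
  shows "a n = 0"
proof -
  define q where "q = (\<lambda>\<tau>. exp (2 * pi * \<i> * \<tau>))"
  define h where "h = (\<lambda>z. \<Sum>n. a (n + 2) * z ^ n)"
  have norm_q: "norm (q \<tau>) = exp (- 2 * pi * Im \<tau>)" for \<tau>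
    by (simp add: q_def)
  note sum_a = q_convergent_summable[OF conv]
  have h_sums: "(\<lambda>n. a (n + 2) * z ^ n) sums h z" if z: "norm z < 1" for z
  proof (cases "z = 0")
    case True
    show ?thesis unfolding h_def True powser_zero by (rule powser_sums_zero)
  next
    case False
    have "summable (\<lambda>n. inverse (z ^ 2) * (a (n + 2) * z ^ (n + 2)))"
      by (intro summable_mult summable_ignore_initial_segment sum_a z)
    also have "(\<lambda>n. inverse (z ^ 2) * (a (n + 2) * z ^ (n + 2))) = (\<lambda>n. a (n + 2) * z ^ n)"
      using False by (auto simp only: power_add mult_ac) (simp add: mult.assoc[symmetric])
    finally show ?thesis unfolding h_def by (rule summable_sums)
  qed
  have G_h: "G \<tau> = q \<tau> ^ 2 * h (q \<tau>)" if \<tau>: "Im \<tau> > 0" for \<tau>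
  proof -
    have q1: "norm (q \<tau>) < 1" using \<tau> by (simp add: norm_q)
    have "(\<lambda>n. a (n + 2) * q \<tau> ^ (n + 2)) sums (q \<tau> ^ 2 * h (q \<tau>))"
      using sums_mult[OF h_sums[OF q1], of "q \<tau> ^ 2"] by (simp only: power_add mult_ac)
    then have "(\<lambda>n. a n * q \<tau> ^ n) sums (q \<tau> ^ 2 * h (q \<tau>))"
      by (subst (asm) sums_iff_shift) (simp add: numeral_2_eq_2 assms(2,3)[unfolded One_nat_def])
    then show ?thesis using G[OF \<tau>] sums_unique2 unfolding q_def by blast
  qed
  have hol: "h holomorphic_on ball 0 1"
    by (rule power_series_holomorphic[of _ _ "\<lambda>n. a (n + 2)"]) (use h_sums in simp)
  define r where "r = exp (- 2 * pi * (4/5))"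
  have r: "0 < r" "r < 1" by (simp_all add: r_def)
  have "continuous_on (sphere 0 r) (\<lambda>z. norm (h z))"
    using hol r by (intro continuous_on_norm holomorphic_on_imp_continuous_on) (auto elim!: holomorphic_on_subset)
  then obtain q1 where q1: "norm q1 = r" "\<And>z. norm z = r \<Longrightarrow> norm (h z) \<le> norm (h q1)"
    using continuous_attains_sup[of "sphere 0 r" "\<lambda>z. norm (h z)"] r by auto
  have max: "norm (h z) \<le> norm (h q1)" if "norm z \<le> r" for z
  proof (rule maximum_modulus_frontier[of h "cball 0 r"])
    show "h holomorphic_on interior (cball 0 r)" "continuous_on (closure (cball 0 r)) h"
      using hol r by (auto intro!: holomorphic_on_imp_continuous_on elim!: holomorphic_on_subset)
  qed (use q1 r that in auto)
  \<comment> \<open>The principal logarithm places \<open>\<tau>1\<close> in the strip of real part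
    at most 1/2 in absolute value, so its squared modulus is at most 1/4 + 16/25 = 89/100.\<close>
  define \<tau>1 where "\<tau>1 = Ln q1 / (2 * pi * \<i>)"
  have "q1 \<noteq> 0" using q1 r by auto
  have q\<tau>1: "q \<tau>1 = q1" using \<open>q1 \<noteq> 0\<close> by (simp add: q_def \<tau>1_def)
  have Im1: "Im \<tau>1 = 4/5"
    using norm_q[of \<tau>1] q1 by (simp add: q\<tau>1 r_def)
  have Re1: "\<bar>Re \<tau>1\<bar> \<le> 1/2"
  proof -
    have "Re \<tau>1 = Im (Ln q1) / (2 * pi)"
      by (simp add: \<tau>1_def Re_divide power2_eq_square)
    moreover have "\<bar>Im (Ln q1)\<bar> \<le> pi"
      using mpi_less_Im_Ln[OF \<open>q1 \<noteq> 0\<close>] Im_Ln_le_pi[OF \<open>q1 \<noteq> 0\<close>] by linarith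
    ultimately show ?thesis by (simp add: abs_div divide_le_eq)
  qed
  define u where "u = (norm \<tau>1)\<^sup>2"
  have u: "u = (Re \<tau>1)\<^sup>2 + 16/25" by (simp add: u_def cmod_power2 Im1 power_divide)
  have "(Re \<tau>1)\<^sup>2 \<le> (1/2)\<^sup>2" using Re1 by (metis abs_le_square_iff abs_of_nonneg divide_nonneg_nonneg zero_le_numeral zero_le_one)
  then have u01: "0 < u" "u < 1"
    unfolding u by (auto simp: power2_eq_square add_nonneg_pos)
  define \<tau>2 where "\<tau>2 = - 1 / \<tau>1"
  have Im2: "Im \<tau>2 = (4/5) / u"
    by (simp add: \<tau>2_def Im_divide u_def cmod_power2 Im1)
  have gt: "4/5 < (4/5) / u" using u01 by (simp add: field_simps)
  have "norm (h (q \<tau>2)) \<le> norm (h q1)"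
  proof (rule max)
    have "2 * pi * (4/5) \<le> 2 * pi * ((4/5) / u)"
      using gt by (intro mult_left_mono) auto
    then show "norm (q \<tau>2) \<le> r" by (simp add: norm_q Im2 r_def)
  qed
  have "q \<tau>2 ^ 2 * h (q \<tau>2) = \<tau>1 ^ K * (q1 ^ 2 * h q1)"
  proof -
    have "G \<tau>2 = \<tau>1 ^ K * G \<tau>1" using law[of \<tau>1] Im1 by (simp add: \<tau>2_def)
    moreover have "G \<tau>1 = q1 ^ 2 * h q1" using G_h[of \<tau>1] Im1 by (simp add: q\<tau>1)
    moreover have "G \<tau>2 = q \<tau>2 ^ 2 * h (q \<tau>2)" using G_h[of \<tau>2] Im2 u01 by simp
    ultimately show ?thesis by simp
  qed
  then have "norm (q \<tau>2) ^ 2 * norm (h (q \<tau>2)) = norm \<tau>1 ^ K * (r ^ 2 * norm (h q1))"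
    using q1 by (metis norm_mult norm_power)
  then have le: "norm \<tau>1 ^ K * r ^ 2 * norm (h q1) \<le> norm (q \<tau>2) ^ 2 * norm (h q1)"
    using \<open>norm (h (q \<tau>2)) \<le> norm (h q1)\<close>
    by (metis mult.assoc mult_left_mono zero_le_power norm_ge_zero)
  have "h q1 = 0"
  proof (rule ccontr)
    assume "h q1 \<noteq> 0"
    then have "norm \<tau>1 ^ K * r ^ 2 \<le> norm (q \<tau>2) ^ 2" using le by simp
    then have "norm \<tau>1 ^ K * (norm q1) ^ 2 \<le> norm (q \<tau>2) ^ 2" using q1 by simp
    \<comment> \<open>Squaring leaves only the squared modulus \<open>u\<close>, so that the
      explicit bound for u^K applies.\<close>
    then have "(norm \<tau>1 ^ K * r ^ 2)\<^sup>2 \<le> (norm (q \<tau>2) ^ 2)\<^sup>2"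
      using q1(1) r by (intro power_mono) auto
    then have "u ^ K * r ^ 4 \<le> norm (q \<tau>2) ^ 4"
      by (simp add: u_def power_mult_distrib mult.commute flip: power_mult)
    also have "norm (q \<tau>2) ^ 4 = exp (- 8 * pi * (4/5) * (1/u - 1)) * r ^ 4"
      using u01 by (simp add: norm_q Im2 r_def mult_exp_exp flip: exp_of_nat_mult) (simp add: field_simps)
    finally have "u ^ K \<le> exp (- 8 * pi * (4/5) * (1/u - 1))" using r by simp
    then show False using theta_decay_estimate[OF \<open>K \<le> 20\<close> u01] by linarith
  qed
  then have h0: "h z = 0" if "norm z < r" for z using max[of z] that by simp
  have "a (m + 2) = 0" for m
  proof (rule powser_coeffs_zero[of r "\<lambda>n. a (n + 2)"])
    show "(\<lambda>n. a (n + 2) * z ^ n) sums 0" if "norm z < r" for z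
      using h_sums[of z] h0[OF that] that r by simp
  qed (rule r)
  then show ?thesis
    using assms(2,3) by (metis One_nat_def add_2_eq_Suc' not0_implies_Suc)
qed

section \<open>Differentiated transformation laws\<close>

definition q_series :: "(nat \<Rightarrow> complex) \<Rightarrow> complex \<Rightarrow> complex" where
  "q_series a \<tau> = (\<Sum>n. a n * exp (2 * pi * \<i> * \<tau>) ^ n)"

text \<open>The operator d/d\<tau> acting on q-coefficients; the factor 2 pi \<i> is kept, so
  iterates are true derivatives in \<tau>.\<close>

definition q_deriv :: "(nat \<Rightarrow> complex) \<Rightarrow> nat \<Rightarrow> complex" where
  "q_deriv a n = 2 * pi * \<i> * of_nat n * a n"

lemma q_deriv_funpow: "(q_deriv ^^ j) a n = (2 * pi * \<i> * of_nat n) ^ j * a n"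
  by (induction j) (simp_all add: q_deriv_def mult.assoc)

lemma norm_q: "Im \<tau> > 0 \<Longrightarrow> norm (exp (2 * pi * \<i> * \<tau>)) < 1"
  by simp

lemma q_series_sums:
  assumes "conv_radius a \<ge> 1" "Im \<tau> > 0"
  shows "(\<lambda>n. a n * exp (2 * pi * \<i> * \<tau>) ^ n) sums q_series a \<tau>"
  unfolding q_series_def
  by (intro summable_sums q_convergent_summable assms norm_q)

lemma q_convergent_deriv:
  assumes "conv_radius a \<ge> 1"
  shows "conv_radius (q_deriv a) \<ge> 1"
proof -
  have "conv_radius (diffs a) \<ge> 1"
  proof (rule conv_radius_geI_ex')
    fix r :: real assume "0 < r" "ereal r < 1"
    then show "summable (\<lambda>n. diffs a n * of_real r ^ n)"
      by (intro termdiff_converges[of "of_real r" 1 a]) (use q_convergent_summable[OF assms] in auto)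
  qed
  moreover have "(\<lambda>n. q_deriv a (n + 1)) = (\<lambda>n. 2 * pi * \<i> * diffs a n)"
    by (simp add: q_deriv_def diffs_def fun_eq_iff mult_ac)
  ultimately have "conv_radius (\<lambda>n. q_deriv a (n + 1)) \<ge> 1"
    using conv_radius_cmult_left[of "2 * pi * \<i>" "diffs a"] by (simp only:) simp
  then show ?thesis by (simp only: conv_radius_shift)
qed

lemma q_convergent_funpow: "conv_radius a \<ge> 1 \<Longrightarrow> conv_radius ((q_deriv ^^ j) a) \<ge> 1"
  by (induction j) (auto intro: q_convergent_deriv)

lemma q_convergent_cmult: "conv_radius a \<ge> 1 \<Longrightarrow> conv_radius (\<lambda>n. c * a n :: complex) \<ge> 1"
  by (cases "c = 0") (simp_all add: conv_radius_cmult_left)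

lemma q_convergent_sum:
  "finite I \<Longrightarrow> (\<And>i. i \<in> I \<Longrightarrow> conv_radius (a i) \<ge> 1) \<Longrightarrow> conv_radius (\<lambda>n. \<Sum>i\<in>I. a i n :: complex) \<ge> 1"
proof (induction I rule: finite_induct)
  case (insert i I)
  then have "1 \<le> min (conv_radius (a i)) (conv_radius (\<lambda>n. \<Sum>i\<in>I. a i n))" by simp
  also note conv_radius_add_ge
  finally show ?case using insert by simp
qed simp

lemma q_series_linear:
  assumes "finite I" "\<And>i. i \<in> I \<Longrightarrow> conv_radius (a i) \<ge> 1" "Im \<tau> > 0"
  shows "q_series (\<lambda>n. \<Sum>i\<in>I. c i * a i n) \<tau> = (\<Sum>i\<in>I. c i * q_series (a i) \<tau>)"
proof -
  have "(\<lambda>n. \<Sum>i\<in>I. c i * (a i n * exp (2 * pi * \<i> * \<tau>) ^ n)) sums (\<Sum>i\<in>I. c i * q_series (a i) \<tau>)"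
    by (intro sums_sum sums_mult q_series_sums assms)
  then have "(\<lambda>n. (\<Sum>i\<in>I. c i * a i n) * exp (2 * pi * \<i> * \<tau>) ^ n) sums (\<Sum>i\<in>I. c i * q_series (a i) \<tau>)"
    by (simp add: sum_distrib_right mult.assoc)
  then show ?thesis unfolding q_series_def by (rule sums_unique[symmetric])
qed

lemma q_series_has_field_derivative:
  assumes a: "conv_radius a \<ge> 1" and \<tau>: "Im \<tau> > 0"
  shows "(q_series a has_field_derivative q_series (q_deriv a) \<tau>) (at \<tau>)"
proof -
  define q where "q = exp (2 * pi * \<i> * \<tau>)"
  have q: "norm q < 1" using norm_q[OF \<tau>] by (simp add: q_def)
  have D: "((\<lambda>z. \<Sum>n. a n * z ^ n) has_field_derivative (\<Sum>n. diffs a n * q ^ n)) (at (exp (2 * pi * \<i> * \<tau>)))"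
    unfolding q_def[symmetric] by (rule termdiffs_strong'[of 1]) (use a q q_convergent_summable in auto)
  have E: "((\<lambda>\<tau>. exp (2 * pi * \<i> * \<tau>)) has_field_derivative (2 * pi * \<i> * q)) (at \<tau>)"
    unfolding q_def by (auto intro!: derivative_eq_intros)
  have "(q_series a has_field_derivative ((\<Sum>n. diffs a n * q ^ n) * (2 * pi * \<i> * q))) (at \<tau>)"
    unfolding q_series_def[abs_def] by (rule DERIV_chain2[OF D E])
  also have "(\<Sum>n. diffs a n * q ^ n) * (2 * pi * \<i> * q) = q_series (q_deriv a) \<tau>"
  proof -
    have "summable (\<lambda>n. diffs a n * q ^ n)"
      by (rule termdiff_converges[of _ 1]) (use a q q_convergent_summable in auto)
    then have "(\<lambda>n. (2 * pi * \<i> * q) * (diffs a n * q ^ n)) sums ((2 * pi * \<i> * q) * (\<Sum>n. diffs a n * q ^ n))"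
      by (intro sums_mult summable_sums)
    also have "(\<lambda>n. (2 * pi * \<i> * q) * (diffs a n * q ^ n)) = (\<lambda>n. q_deriv a (Suc n) * q ^ Suc n)"
      by (simp add: diffs_def q_deriv_def fun_eq_iff mult_ac)
    finally have "(\<lambda>n. q_deriv a n * q ^ n) sums ((2 * pi * \<i> * q) * (\<Sum>n. diffs a n * q ^ n))"
      by (subst (asm) sums_Suc_iff) (simp add: q_deriv_def)
    then show ?thesis unfolding q_series_def q_def[symmetric] by (simp add: sums_iff mult.commute)
  qed
  finally show ?thesis .
qed

lemma Im_minus_inverse_pos: "Im \<tau> > 0 \<Longrightarrow> Im (- 1 / \<tau>) > 0"
  by (auto simp: Im_divide zero_less_divide_iff add_nonneg_pos)

text \<open>The chain rule: \<tau> \<mapsto> -1/\<tau> has derivative 1/\<tau>^2, so each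
  differentiation of a transformation law applies \<tau>^2 d/d\<tau> to its right-hand side.\<close>

lemma slash_deriv:
  assumes law: "\<And>\<tau>. Im \<tau> > 0 \<Longrightarrow> f (- 1 / \<tau>) = G \<tau>"
    and f': "\<And>\<tau>. Im \<tau> > 0 \<Longrightarrow> (f has_field_derivative f' \<tau>) (at \<tau>)"
    and G': "(G has_field_derivative G') (at \<tau>)" and \<tau>: "Im \<tau> > 0"
  shows "f' (- 1 / \<tau>) = \<tau>\<^sup>2 * G'"
proof -
  have "\<tau> \<noteq> 0" using \<tau> by auto
  have "((\<lambda>\<tau>. - 1 / \<tau>) has_field_derivative 1 / \<tau>\<^sup>2) (at \<tau>)"
    using \<open>\<tau> \<noteq> 0\<close> by (auto intro!: derivative_eq_intros simp: power2_eq_square)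
  from DERIV_chain2[OF f'[OF Im_minus_inverse_pos[OF \<tau>]] this]
  have "((\<lambda>\<tau>. f (- 1 / \<tau>)) has_field_derivative f' (- 1 / \<tau>) * (1 / \<tau>\<^sup>2)) (at \<tau>)" .
  then have "(G has_field_derivative f' (- 1 / \<tau>) * (1 / \<tau>\<^sup>2)) (at \<tau>)"
    by (rule has_field_derivative_transform_within_open[of _ _ _ "{\<tau>. Im \<tau> > 0}"])
      (use \<tau> law open_halfspace_Im_gt in auto)
  then have "f' (- 1 / \<tau>) * (1 / \<tau>\<^sup>2) = G'" using G' by (rule DERIV_unique)
  then show ?thesis using \<open>\<tau> \<noteq> 0\<close> by (auto simp: field_simps)
qed

text \<open>The coefficients of \<open>(\<tau>\<^sup>2 d/d\<tau>)\<^sup>j (\<tau>\<^sup>w g)\<close>, where \<open>g\<close> is given with all its derivatives.\<close>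

fun slash_coeff :: "nat \<Rightarrow> nat \<Rightarrow> nat \<Rightarrow> nat" where
  "slash_coeff w 0 b = (if b = 0 then 1 else 0)"
| "slash_coeff w (Suc j) 0 = 1"
| "slash_coeff w (Suc j) (Suc b) = slash_coeff w j (Suc b) + slash_coeff w j b * (w + 2 * j - b)"

definition slash_term :: "nat \<Rightarrow> nat \<Rightarrow> (nat \<Rightarrow> complex \<Rightarrow> complex) \<Rightarrow> complex \<Rightarrow> complex" where
  "slash_term j w g \<tau> = (\<Sum>b\<le>j. of_nat (slash_coeff w j b) * \<tau> ^ (w + 2 * j - b) * g (j - b) \<tau>)"

lemma slash_coeff_0: "slash_coeff w j 0 = 1" by (cases j) auto

lemma slash_coeff_eq_0: "b > j \<Longrightarrow> slash_coeff w j b = 0"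
  by (induction w j b rule: slash_coeff.induct) auto

lemma slash_term_deriv:
  assumes "w > 0" and g: "\<And>i. (g i has_field_derivative g (Suc i) \<tau>) (at \<tau>)" and "\<tau> \<noteq> 0"
  shows "(slash_term j w g has_field_derivative slash_term (Suc j) w g \<tau> / \<tau>\<^sup>2) (at \<tau>)"
proof -
  let ?c = "\<lambda>b. of_nat (slash_coeff w j b) :: complex"
  define S where "S = (\<Sum>b\<le>j. ?c b * (of_nat (w + 2 * j - b) * \<tau> ^ (w + 2 * j - b - 1) * g (j - b) \<tau>
      + \<tau> ^ (w + 2 * j - b) * g (Suc (j - b)) \<tau>))"
  have "(slash_term j w g has_field_derivative S) (at \<tau>)"
    unfolding slash_term_def[abs_def] S_def
    by (intro DERIV_sum) (auto intro!: derivative_eq_intros g simp: algebra_simps)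
  moreover have "\<tau>\<^sup>2 * S = slash_term (Suc j) w g \<tau>"
  proof -
    have "\<tau>\<^sup>2 * S = (\<Sum>b\<le>j. ?c b * of_nat (w + 2 * j - b) * \<tau> ^ (w + 2 * j + 1 - b) * g (j - b) \<tau>
        + ?c b * \<tau> ^ (w + 2 * j + 2 - b) * g (Suc j - b) \<tau>)"
      unfolding S_def sum_distrib_left
    proof (intro sum.cong refl)
      fix b assume "b \<in> {..j}"
      then have e: "\<tau>\<^sup>2 * \<tau> ^ (w + 2 * j - b - 1) = \<tau> ^ (w + 2 * j + 1 - b)"
        "\<tau>\<^sup>2 * \<tau> ^ (w + 2 * j - b) = \<tau> ^ (w + 2 * j + 2 - b)" "Suc (j - b) = Suc j - b"
      proof -
        \<comment> \<open>Natural subtraction: \<open>w > 0\<close> together with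
          \<open>b \<le> j\<close> keeps every difference exact, including the exponent lowered by
          differentiation.\<close>
        have "2 + (w + 2 * j - b - 1) = w + 2 * j + 1 - b" "2 + (w + 2 * j - b) = w + 2 * j + 2 - b"
          using \<open>w > 0\<close> \<open>b \<in> {..j}\<close> by auto
        then show "\<tau>\<^sup>2 * \<tau> ^ (w + 2 * j - b - 1) = \<tau> ^ (w + 2 * j + 1 - b)"
          "\<tau>\<^sup>2 * \<tau> ^ (w + 2 * j - b) = \<tau> ^ (w + 2 * j + 2 - b)"
          by (metis power_add)+
        show "Suc (j - b) = Suc j - b" using \<open>b \<in> {..j}\<close> by simp
      qed
      have "\<tau>\<^sup>2 * (C * (N * X * G + Y * H)) = C * N * (\<tau>\<^sup>2 * X) * G + C * (\<tau>\<^sup>2 * Y) * H" for C N X G Y H :: complex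
        by (simp add: algebra_simps)
      then show "\<tau>\<^sup>2 * (?c b * (of_nat (w + 2 * j - b) * \<tau> ^ (w + 2 * j - b - 1) * g (j - b) \<tau>
          + \<tau> ^ (w + 2 * j - b) * g (Suc (j - b)) \<tau>))
        = ?c b * of_nat (w + 2 * j - b) * \<tau> ^ (w + 2 * j + 1 - b) * g (j - b) \<tau>
          + ?c b * \<tau> ^ (w + 2 * j + 2 - b) * g (Suc j - b) \<tau>"
        unfolding e(1,2)[symmetric] e(3)[symmetric] by blast
    qed
    \<comment> \<open>The second sum is extended to \<open>b = Suc j\<close>, where the coefficient
      is 0. Splitting off \<open>b = 0\<close> then aligns it with the first sum, and the recursion
      of \<open>slash_coeff\<close> can be read off.\<close>
    also have "\<dots> = (\<Sum>b\<le>j. ?c b * of_nat (w + 2 * j - b) * \<tau> ^ (w + 2 * j + 1 - b) * g (j - b) \<tau>)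
        + (\<Sum>b\<le>Suc j. ?c b * \<tau> ^ (w + 2 * j + 2 - b) * g (Suc j - b) \<tau>)"
      by (simp add: sum.distrib slash_coeff_eq_0)
    also have "(\<Sum>b\<le>Suc j. ?c b * \<tau> ^ (w + 2 * j + 2 - b) * g (Suc j - b) \<tau>)
        = \<tau> ^ (w + 2 * j + 2) * g (Suc j) \<tau> + (\<Sum>b\<le>j. ?c (Suc b) * \<tau> ^ (w + 2 * j + 1 - b) * g (j - b) \<tau>)"
      by (subst sum.atMost_Suc_shift) (simp add: slash_coeff_0)
    also have "(\<Sum>b\<le>j. ?c b * of_nat (w + 2 * j - b) * \<tau> ^ (w + 2 * j + 1 - b) * g (j - b) \<tau>)
        + (\<tau> ^ (w + 2 * j + 2) * g (Suc j) \<tau> + (\<Sum>b\<le>j. ?c (Suc b) * \<tau> ^ (w + 2 * j + 1 - b) * g (j - b) \<tau>))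
        = slash_term (Suc j) w g \<tau>"
      unfolding slash_term_def
      by (subst sum.atMost_Suc_shift) (simp add: sum.distrib distrib_right)
    finally show ?thesis .
  qed
  ultimately show ?thesis using \<open>\<tau> \<noteq> 0\<close> by (metis nonzero_mult_div_cancel_left power_not_zero)
qed

lemma slash_term_simps:
  "slash_term 0 w g \<tau> = \<tau> ^ w * g 0 \<tau>"
  "slash_term 1 w g \<tau> = \<tau> ^ (w + 2) * g 1 \<tau> + of_nat w * \<tau> ^ (w + 1) * g 0 \<tau>"
  "slash_term 2 w g \<tau> = \<tau> ^ (w + 4) * g 2 \<tau> + of_nat (2 * (w + 1)) * \<tau> ^ (w + 3) * g 1 \<tau>
    + of_nat ((w + 1) * w) * \<tau> ^ (w + 2) * g 0 \<tau>"
  "slash_term 3 w g \<tau> = \<tau> ^ (w + 6) * g 3 \<tau> + of_nat (3 * (w + 2)) * \<tau> ^ (w + 5) * g 2 \<tau>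
    + of_nat (3 * (w + 2) * (w + 1)) * \<tau> ^ (w + 4) * g 1 \<tau>
    + of_nat ((w + 2) * (w + 1) * w) * \<tau> ^ (w + 3) * g 0 \<tau>"
  "slash_term 4 w g \<tau> = \<tau> ^ (w + 8) * g 4 \<tau> + of_nat (4 * (w + 3)) * \<tau> ^ (w + 7) * g 3 \<tau>
    + of_nat (6 * (w + 3) * (w + 2)) * \<tau> ^ (w + 6) * g 2 \<tau>
    + of_nat (4 * (w + 3) * (w + 2) * (w + 1)) * \<tau> ^ (w + 5) * g 1 \<tau>
    + of_nat ((w + 3) * (w + 2) * (w + 1) * w) * \<tau> ^ (w + 4) * g 0 \<tau>"
  unfolding slash_term_def
  by (simp_all add: eval_nat_numeral algebra_simps)

text \<open>The coefficients of a Jacobi-like form of weight 12. For the generating series F(\<tau>,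
  X) of the functions \<open>q_series (A k)\<close> times X^k, \<open>law\<close> says that
  F(-1/\<tau>, X/\<tau>^2) = \<tau>^12 exp(X/\<tau>) F(\<tau>, X).\<close>

locale quasimodular_family =
  fixes A :: "nat \<Rightarrow> nat \<Rightarrow> complex"
  assumes conv: "conv_radius (A k) \<ge> 1"
    and law: "Im \<tau> > 0 \<Longrightarrow> q_series (A k) (- 1 / \<tau>) = (\<Sum>j\<le>k. \<tau> ^ (12 + 2 * k - j) / fact j * q_series (A (k - j)) \<tau>)"
begin

definition D :: "nat \<Rightarrow> nat \<Rightarrow> complex \<Rightarrow> complex" where
  "D k j = q_series ((q_deriv ^^ j) (A k))"

lemma D_deriv: "Im \<tau> > 0 \<Longrightarrow> (D k j has_field_derivative D k (Suc j) \<tau>) (at \<tau>)"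
  using q_series_has_field_derivative[OF q_convergent_funpow[OF conv]] by (simp add: D_def)

lemma D_law:
  "Im \<tau> > 0 \<Longrightarrow> D k j (- 1 / \<tau>) = (\<Sum>a\<le>k. 1 / fact a * slash_term j (12 + 2 * k - a) (D (k - a)) \<tau>)"
proof (induction j arbitrary: \<tau>)
  case 0
  then show ?case using law[OF 0, of k] by (simp add: D_def slash_term_simps)
next
  case (Suc j)
  have "\<tau> \<noteq> 0" using Suc.prems by auto
  have "((\<lambda>\<tau>. \<Sum>a\<le>k. 1 / fact a * slash_term j (12 + 2 * k - a) (D (k - a)) \<tau>) has_field_derivative
      (\<Sum>a\<le>k. 1 / fact a * (slash_term (Suc j) (12 + 2 * k - a) (D (k - a)) \<tau> / \<tau>\<^sup>2))) (at \<tau>)"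
    by (intro DERIV_sum DERIV_cmult slash_term_deriv D_deriv Suc.prems \<open>\<tau> \<noteq> 0\<close>) auto
  from slash_deriv[OF Suc.IH D_deriv this Suc.prems] show ?case
    using \<open>\<tau> \<noteq> 0\<close> by (simp add: sum_distrib_left)
qed

text \<open>The classical correction of Taylor coefficients of a Jacobi form to modular forms; in
  weight w the factorial is (w + 2k - j - 2)!. Up to a scalar these are also the coefficients of the
  Gegenbauer polynomial of degree 2k and parameter 11 = 24/2 - 1, which is why zonal harmonics in
  dimension 24 appear.\<close>

definition zonal_coeff :: "nat \<Rightarrow> nat \<Rightarrow> complex" where
  "zonal_coeff k j = (- 1) ^ j * fact (10 + 2 * k - j) / fact j"

text \<open>Inserting \<open>D_law\<close> gives a combination of derivatives multiplied by powers
  of \<tau>; the coefficients are chosen so that everything except the power 12 + 2k cancels. For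
  four explicit values of \<open>k\<close> this is finite arithmetic.\<close>

lemma zonal_law:
  assumes "k \<in> {1, 2, 3, 4}" and \<tau>: "Im \<tau> > 0"
  shows "(\<Sum>j\<le>k. zonal_coeff k j * D (k - j) j (- 1 / \<tau>)) = \<tau> ^ (12 + 2 * k) * (\<Sum>j\<le>k. zonal_coeff k j * D (k - j) j \<tau>)"
proof -
  have s: "{..1::nat} = {0, 1}" "{..2::nat} = {0, 1, 2}" "{..3::nat} = {0, 1, 2, 3}" "{..4::nat} = {0, 1, 2, 3, 4}"
    by auto
  show ?thesis
    unfolding D_law[OF \<tau>] zonal_coeff_def
    using assms(1)
    by (elim insertE) (simp_all add: s slash_term_simps fact_numeral algebra_simps add_divide_distrib diff_divide_distrib
        del: One_nat_def add_2_eq_Suc add_2_eq_Suc')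
qed

lemma zonal_sum_eq_0:
  assumes k: "k \<in> {1, 2, 3, 4}" and A0: "\<And>m. m > 0 \<Longrightarrow> A m 0 = 0" and A1: "\<And>m. A m 1 = 0"
  shows "(\<Sum>j\<le>k. zonal_coeff k j * ((2 * pi * \<i> * of_nat n) ^ j * A (k - j) n)) = 0"
proof -
  let ?a = "\<lambda>n. \<Sum>j\<le>k. zonal_coeff k j * (q_deriv ^^ j) (A (k - j)) n"
  have cv: "conv_radius ?a \<ge> 1"
    by (intro q_convergent_sum q_convergent_cmult q_convergent_funpow conv) auto
  have eq: "q_series ?a \<tau> = (\<Sum>j\<le>k. zonal_coeff k j * D (k - j) j \<tau>)" if "Im \<tau> > 0" for \<tau>
    unfolding D_def by (rule q_series_linear) (use that conv q_convergent_funpow in auto)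
  have "?a n = 0"
  proof (rule modular_form_eq_0[where a = ?a and K = "12 + 2 * k" and G = "q_series ?a"])
    show "?a 0 = 0"
    proof (rule sum.neutral, rule ballI)
      \<comment> \<open>Only \<open>j = k\<close> involves \<open>A 0\<close>, whose constant term
        may be nonzero; there the k-fold derivative with \<open>k > 0\<close> removes it.\<close>
      fix j assume "j \<in> {..k}"
      then show "zonal_coeff k j * (q_deriv ^^ j) (A (k - j)) 0 = 0"
        using k A0[of "k - j"] by (cases "j = k") (auto simp: q_deriv_funpow)
    qed
    show "?a 1 = 0" by (simp add: q_deriv_funpow A1[unfolded One_nat_def])
    show "12 + 2 * k \<le> 20" using k by auto
    show "q_series ?a (- 1 / \<tau>) = \<tau> ^ (12 + 2 * k) * q_series ?a \<tau>" if "Im \<tau> > 0" for \<tau>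
      using zonal_law[OF k that] eq[OF that] eq[OF Im_minus_inverse_pos[OF that]] by simp
  qed (rule cv, rule q_series_sums[OF cv])
  then show ?thesis by (simp add: q_deriv_funpow)
qed

end

section \<open>Moments of theta series\<close>

text \<open>The series is known to vanish for real \<open>s\<close> only. Uniqueness is therefore
  applied over the reals to the real and imaginary parts, after filling in zeros at the odd
  exponents.\<close>

lemma even_powser_coeffs_zero:
  fixes a :: "nat \<Rightarrow> complex"
  assumes "\<And>s::real. (\<lambda>k. a k * of_real s ^ (2 * k)) sums 0"
  shows "a k = 0"
proof -
  have *: "b k = 0" if b: "\<And>s::real. (\<lambda>k. b k * s ^ (2 * k)) sums 0" for b :: "nat \<Rightarrow> real"
  proof -
    define c where "c = (\<lambda>n. if even n then b (n div 2) else 0)"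
    have "c (2 * k) = 0"
    proof (rule powser_coeffs_zero[of 1])
      fix s :: real
      have "(\<lambda>n. c (2 * n) * s ^ (2 * n)) sums 0 \<longleftrightarrow> (\<lambda>n. c n * s ^ n) sums 0"
        by (rule sums_mono_reindex[of "\<lambda>n. 2 * n" "\<lambda>n. c n * s ^ n"]) (auto simp: strict_mono_def c_def image_iff elim!: evenE)
      then show "(\<lambda>n. c n * s ^ n) sums 0" using b[of s] by (simp add: c_def)
    qed simp
    then show ?thesis by (simp add: c_def)
  qed
  have "Re (a k) = 0"
    using sums_Re[OF assms] by (intro *) (simp flip: of_real_power)
  moreover have "Im (a k) = 0"
    using sums_Im[OF assms] by (intro *) (simp flip: of_real_power)
  ultimately show ?thesis by (simp add: complex_eq_iff)
qed

lemma power_le_fact_exp: "0 \<le> y \<Longrightarrow> y ^ m \<le> fact m * exp (y::real)"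
proof -
  assume y: "0 \<le> y"
  have s: "(\<lambda>n. y ^ n /\<^sub>R fact n) sums exp y" by (rule exp_converges)
  have "(\<Sum>n\<in>{m}. y ^ n /\<^sub>R fact n) \<le> (\<Sum>n. y ^ n /\<^sub>R fact n)"
    using s y by (intro sum_le_suminf) (auto simp: sums_iff)
  then have "y ^ m / fact m \<le> exp y" using s by (simp add: sums_iff divide_inverse mult.commute)
  then show ?thesis by (simp add: divide_le_eq mult.commute)
qed

section \<open>Gaussian sums weighted by powers and exponentials of an inner product\<close>

context unimodular_basis begin

lemma finite_L_bounded: "finite {x \<in> L. norm x \<le> R}"
proof -
  define B where "B = \<lceil>\<Sum>i\<in>UNIV. \<bar>R\<bar> * norm (M i)\<rceil>"
  have "{x \<in> L. norm x \<le> R} \<subseteq> emb ` (PiE UNIV (\<lambda>_. {- B..B}))"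
  proof
    fix x assume "x \<in> {x \<in> L. norm x \<le> R}"
    then have "x \<in> range emb" and le: "norm x \<le> R" by (auto simp: range_emb)
    then obtain c where c: "x = emb c" by blast
    have "\<bar>c i\<bar> \<le> B" for i
    proof -
      have "\<bar>real_of_int (c i)\<bar> \<le> norm x * norm (M i)"
        using Cauchy_Schwarz_ineq2[of x "M i"] by (simp add: c emb_inner_M)
      also have "\<dots> \<le> \<bar>R\<bar> * norm (M i)" using le by (intro mult_right_mono) auto
      also have "\<dots> \<le> (\<Sum>i\<in>UNIV. \<bar>R\<bar> * norm (M i))" by (intro member_le_sum) auto
      finally have "real_of_int \<bar>c i\<bar> \<le> (\<Sum>i\<in>UNIV. \<bar>R\<bar> * norm (M i))" by simp
      then show ?thesis unfolding B_def by linarith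
    qed
    then have "- B \<le> c i \<and> c i \<le> B" for i by (smt (verit))
    then show "x \<in> emb ` (PiE UNIV (\<lambda>_. {- B..B}))" unfolding c by auto
  qed
  then show ?thesis by (rule finite_subset) (auto intro!: finite_PiE)
qed

lemma finite_shell: "finite (shell L k)"
proof -
  have "shell L k \<subseteq> {x \<in> L. norm x \<le> sqrt (2 * real k)}"
    by (auto simp: shell_def intro: real_le_rsqrt)
  then show ?thesis using finite_L_bounded finite_subset by blast
qed

text \<open>Completing the square absorbs exp(x \<bullet> w) into a translated Gaussian, and exp of
  an absolute value is at most the sum of the two signed exponentials. This majorant dominates all
  moments at once.\<close>

lemma gauss_exp_summable:
  assumes "t > 0"
  shows "(\<lambda>x. gauss t x * exp \<bar>x \<bullet> w\<bar>) summable_on L"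
proof -
  have 1: "(\<lambda>x. gauss t x * exp (x \<bullet> w)) summable_on L" for w
  proof -
    define u where "u = (- 1 / (2 * pi * t)) *\<^sub>R w"
    have "gauss t x * exp (x \<bullet> w) = exp (pi * t * (norm u)\<^sup>2) * gauss t (x + u)" for x
    proof -
      have "2 * pi * t * (x \<bullet> u) = - (x \<bullet> w)" using assms by (simp add: u_def)
      moreover have "(norm (x + u))\<^sup>2 = (norm x)\<^sup>2 + 2 * (x \<bullet> u) + (norm u)\<^sup>2"
        by (simp add: power2_norm_eq_inner inner_add_left inner_add_right inner_commute)
      ultimately have "- pi * t * (norm x)\<^sup>2 + x \<bullet> w = pi * t * (norm u)\<^sup>2 + - pi * t * (norm (x + u))\<^sup>2"
        by (simp add: algebra_simps)
      then show ?thesis by (simp only: mult_exp_exp)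
    qed
    then show ?thesis using gauss_shift_summable[OF assms, of u] by (simp add: summable_on_cmult_right)
  qed
  show ?thesis
  proof (rule summable_on_comparison_test)
    show "(\<lambda>x. gauss t x * exp (x \<bullet> w) + gauss t x * exp (x \<bullet> (- w))) summable_on L"
      by (intro summable_on_add 1)
    show "gauss t x * exp \<bar>x \<bullet> w\<bar>
        \<le> gauss t x * exp (x \<bullet> w) + gauss t x * exp (x \<bullet> (- w))" for x
      by (cases "x \<bullet> w \<ge> 0") (auto simp: abs_if)
  qed auto
qed

definition gauss_moment :: "real^'n \<Rightarrow> nat \<Rightarrow> real \<Rightarrow> real" where
  "gauss_moment v m t = (\<Sum>\<^sub>\<infinity>x\<in>L. gauss t x * (x \<bullet> v) ^ m)"

definition gauss_exp :: "real^'n \<Rightarrow> real \<Rightarrow> complex \<Rightarrow> complex" where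
  "gauss_exp v t z = (\<Sum>\<^sub>\<infinity>x\<in>L. of_real (gauss t x) * exp (z * of_real (x \<bullet> v)))"

lemma gauss_moment_abs_summable:
  assumes "t > 0"
  shows "(\<lambda>x. norm (gauss t x * (x \<bullet> v) ^ m)) summable_on L"
proof (rule summable_on_comparison_test)
  show "(\<lambda>x. fact m * (gauss t x * exp \<bar>x \<bullet> v\<bar>)) summable_on L"
    by (intro summable_on_cmult_right gauss_exp_summable assms)
  fix x
  have "\<bar>x \<bullet> v\<bar> ^ m \<le> fact m * exp \<bar>x \<bullet> v\<bar>" by (rule power_le_fact_exp) simp
  then have "gauss t x * \<bar>x \<bullet> v\<bar> ^ m \<le> gauss t x * (fact m * exp \<bar>x \<bullet> v\<bar>)"
    by (intro mult_left_mono) auto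
  then show "norm (gauss t x * (x \<bullet> v) ^ m) \<le> fact m * (gauss t x * exp \<bar>x \<bullet> v\<bar>)"
    by (simp add: abs_mult power_abs mult_ac)
qed auto

text \<open>Fubini for the lattice sum and the exponential series. Absolute summability over the
  product follows from \<open>gauss_exp_summable\<close> with
  \<open>w = norm z *\<^sub>R v\<close>.\<close>

lemma gauss_exp_sums:
  assumes t: "t > 0"
  shows "(\<lambda>m. z ^ m / fact m * of_real (gauss_moment v m t)) sums gauss_exp v t z"
proof -
  let ?e = "\<lambda>x. gauss t x"
  define F where "F = (\<lambda>(x, m). of_real (?e x) * ((z * of_real (x \<bullet> v)) ^ m /\<^sub>R fact m))"
  have ex: "((\<lambda>m. F (x, m)) has_sum (of_real (?e x) * exp (z * of_real (x \<bullet> v)))) UNIV"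
    "((\<lambda>m. norm (F (x, m))) has_sum (?e x * exp (norm (z * of_real (x \<bullet> v))))) UNIV" for x
  proof -
    have n: "norm (F (x, m)) = ?e x * (norm (z * of_real (x \<bullet> v)) ^ m /\<^sub>R fact m)" for m
      by (simp add: F_def norm_mult norm_power)
    have s: "(\<lambda>m. norm (F (x, m))) sums (?e x * exp (norm (z * of_real (x \<bullet> v))))"
      unfolding n by (intro sums_mult exp_converges)
    then show "((\<lambda>m. norm (F (x, m))) has_sum (?e x * exp (norm (z * of_real (x \<bullet> v))))) UNIV"
      by (intro sums_nonneg_imp_has_sum) auto
    have "(\<lambda>m. F (x, m)) sums (of_real (?e x) * exp (z * of_real (x \<bullet> v)))"
      unfolding F_def prod.case by (intro sums_mult exp_converges)
    then show "((\<lambda>m. F (x, m)) has_sum (of_real (?e x) * exp (z * of_real (x \<bullet> v)))) UNIV"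
      using s by (intro norm_summable_imp_has_sum) (auto simp: sums_iff)
  qed
  have "Infinite_Sum.abs_summable_on F (L \<times> UNIV)"
  proof (rule Infinite_Sum.abs_summable_on_Sigma_iff[THEN iffD2], intro conjI ballI)
    show "(\<lambda>y. norm (F (x, y))) summable_on UNIV" for x
      using ex(2) has_sum_imp_summable by blast
    have "(\<Sum>\<^sub>\<infinity>m. norm (F (x, m))) = ?e x * exp \<bar>x \<bullet> (norm z *\<^sub>R v)\<bar>" for x
      using infsumI[OF ex(2)[of x]] by (simp add: norm_mult abs_mult)
    then show "(\<lambda>x. norm (\<Sum>\<^sub>\<infinity>m. norm (F (x, m)))) summable_on L"
      using gauss_exp_summable[OF t, of "norm z *\<^sub>R v"] by simp
  qed
  then have "F summable_on (L \<times> UNIV)" by (rule abs_summable_summable)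
  then obtain S where S: "(F has_sum S) (L \<times> UNIV)" by (auto simp: summable_on_def)
  have "((\<lambda>x. of_real (?e x) * exp (z * of_real (x \<bullet> v))) has_sum S) L"
    by (rule has_sum_SigmaD[OF S ex(1)])
  then have "S = gauss_exp v t z" unfolding gauss_exp_def by (rule infsumI[symmetric])
  have S': "((\<lambda>(m, x). F (x, m)) has_sum S) (UNIV \<times> L)"
    using S by (subst (asm) has_sum_swap) simp
  have "((\<lambda>x. F (x, m)) has_sum (z ^ m / fact m * of_real (gauss_moment v m t))) L" for m
  proof -
    have "((\<lambda>x. ?e x * (x \<bullet> v) ^ m) has_sum gauss_moment v m t) L"
      unfolding gauss_moment_def
      by (rule has_sum_infsum[OF abs_summable_summable[OF gauss_moment_abs_summable[OF t]]])
    from has_sum_cmult_right[OF has_sum_of_real[OF this], of "z ^ m / fact m"]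
    show ?thesis by (simp add: F_def power_mult_distrib scaleR_conv_of_real divide_inverse mult_ac)
  qed
  then have "((\<lambda>m. z ^ m / fact m * of_real (gauss_moment v m t)) has_sum S) UNIV"
    by (intro has_sum_SigmaD[OF S']) auto
  then show ?thesis unfolding \<open>S = gauss_exp v t z\<close> by (rule has_sum_imp_sums)
qed

lemma gauss_moment_odd:
  assumes "odd m"
  shows "gauss_moment v m t = 0"
proof -
  have "gauss_moment v m t = (\<Sum>\<^sub>\<infinity>x\<in>L. gauss t (- x) * (- x \<bullet> v) ^ m)"
    unfolding gauss_moment_def
    by (rule infsum_reindex_bij_witness[of _ uminus uminus]) (auto simp: uminus_in_L)
  also have "\<dots> = - gauss_moment v m t"
    using assms by (simp add: gauss_moment_def infsum_uminus)
  finally show ?thesis by simp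
qed

lemma gauss_exp_sums_even:
  assumes "t > 0"
  shows "(\<lambda>k. z ^ (2 * k) / fact (2 * k) * of_real (gauss_moment v (2 * k) t)) sums gauss_exp v t z"
proof -
  have "(\<lambda>k. z ^ (2 * k) / fact (2 * k) * of_real (gauss_moment v (2 * k) t)) sums gauss_exp v t z
    \<longleftrightarrow> (\<lambda>m. z ^ m / fact m * of_real (gauss_moment v m t)) sums gauss_exp v t z"
  proof (rule sums_mono_reindex[of "\<lambda>k. 2 * k" "\<lambda>m. z ^ m / fact m * of_real (gauss_moment v m t)"])
    fix n :: nat assume "n \<notin> range (\<lambda>k. 2 * k)"
    then have "odd n" by (auto elim!: evenE)
    then show "z ^ n / fact n * of_real (gauss_moment v n t) = 0" by (simp add: gauss_moment_odd)
  qed (simp add: strict_mono_def)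
  then show ?thesis using gauss_exp_sums[OF assms] by blast
qed

text \<open>Poisson summation at the shift \<open>s *\<^sub>R v\<close>, read as an identity of
  exponential generating functions: expanding the squared norm gives a real argument on the theta
  side, the characters give an imaginary one on the dual side.\<close>

lemma gauss_exp_transformation:
  assumes t: "t > 0"
  shows "gauss_exp v (1 / t) (- 2 * pi * \<i> * of_real s)
    = of_real (sqrt t ^ CARD('n)) * of_real (exp (- pi * t * (v \<bullet> v) * s ^ 2)) * gauss_exp v t (complex_of_real (- 2 * pi * t * s))"
proof -
  have th: "of_real (theta t (s *\<^sub>R v)) = of_real (exp (- pi * t * (v \<bullet> v) * s ^ 2)) * gauss_exp v t (complex_of_real (- 2 * pi * t * s))"
  proof -
    have eq: "complex_of_real (gauss t (x + s *\<^sub>R v))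
      = of_real (exp (- pi * t * (v \<bullet> v) * s ^ 2)) * (of_real (gauss t x) * exp (complex_of_real (- 2 * pi * t * s) * of_real (x \<bullet> v)))" for x
    proof -
      have "- pi * t * (norm (x + s *\<^sub>R v))\<^sup>2
          = - pi * t * (v \<bullet> v) * s ^ 2 + (- pi * t * (norm x)\<^sup>2 + - 2 * pi * t * s * (x \<bullet> v))"
      proof -
        have "(norm (x + s *\<^sub>R v))\<^sup>2 = (norm x)\<^sup>2 + 2 * s * (x \<bullet> v) + s\<^sup>2 * (v \<bullet> v)"
          by (simp add: power2_norm_eq_inner inner_add_left inner_add_right inner_commute) (simp add: power2_eq_square)
        then show ?thesis by (simp add: algebra_simps)
      qed
      then have "complex_of_real (gauss t (x + s *\<^sub>R v))
          = of_real (exp (- pi * t * (v \<bullet> v) * s ^ 2) * (gauss t x * exp (- 2 * pi * t * s * (x \<bullet> v))))"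
        by (simp only: mult_exp_exp)
      moreover have "exp (complex_of_real (- 2 * pi * t * s) * of_real (x \<bullet> v)) = of_real (exp (- 2 * pi * t * s * (x \<bullet> v)))"
        by (simp only: of_real_mult[symmetric] exp_of_real)
      ultimately show ?thesis by (simp only: of_real_mult)
    qed
    have "((\<lambda>x. gauss t (x + s *\<^sub>R v)) has_sum theta t (s *\<^sub>R v)) L"
      unfolding theta_def by (rule has_sum_infsum[OF gauss_shift_summable[OF t]])
    from has_sum_of_real[OF this, where 'a = complex]
    have "of_real (theta t (s *\<^sub>R v)) = (\<Sum>\<^sub>\<infinity>x\<in>L. complex_of_real (gauss t (x + s *\<^sub>R v)))"
      by (rule infsumI[symmetric])
    also have "\<dots> = of_real (exp (- pi * t * (v \<bullet> v) * s ^ 2)) * gauss_exp v t (complex_of_real (- 2 * pi * t * s))"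
      unfolding eq gauss_exp_def by (rule infsum_cmult_right')
    finally show ?thesis .
  qed
  have "dual_theta t (s *\<^sub>R v) = of_real ((1 / sqrt t) ^ CARD('n)) * gauss_exp v (1 / t) (- 2 * pi * \<i> * of_real s)"
    unfolding dual_theta_def gauss_exp_def
    by (subst infsum_cmult_right'[symmetric], rule infsum_cong)
      (simp add: cis_conv_exp inner_commute mult_ac)
  then have e: "of_real (theta t (s *\<^sub>R v)) = of_real ((1 / sqrt t) ^ CARD('n)) * gauss_exp v (1 / t) (- 2 * pi * \<i> * of_real s)"
    by (simp add: theta_transformation[OF t])
  have "of_real (sqrt t ^ CARD('n)) * of_real ((1 / sqrt t) ^ CARD('n)) = (1::complex)"
    using t by (simp add: power_divide flip: of_real_mult)
  then have "of_real (sqrt t ^ CARD('n)) * of_real (theta t (s *\<^sub>R v)) = gauss_exp v (1 / t) (- 2 * pi * \<i> * of_real s)"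
    unfolding e by (metis mult.assoc mult_1)
  then show ?thesis unfolding th by (simp add: mult.assoc)
qed

text \<open>Both sides of \<open>gauss_exp_transformation\<close> are power series in s^2, the right
  one as the Cauchy product of a Gaussian in s with the series of even moments; the claim compares
  the coefficients of s^(2k).\<close>

lemma gauss_moment_transformation:
  assumes t: "t > 0"
  shows "(- 1) ^ k * (2 * pi) ^ (2 * k) / fact (2 * k) * gauss_moment v (2 * k) (1 / t)
    = sqrt t ^ CARD('n) * (\<Sum>j\<le>k. (- pi * t * (v \<bullet> v)) ^ j / fact j *
        ((2 * pi * t) ^ (2 * (k - j)) / fact (2 * (k - j)) * gauss_moment v (2 * (k - j)) t))"
proof -
  define a where "a = (\<lambda>j. (- pi * t * (v \<bullet> v)) ^ j / fact j)"
  define b where "b = (\<lambda>j. (2 * pi * t) ^ (2 * j) / fact (2 * j) * gauss_moment v (2 * j) t)"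
  define l where "l = (\<lambda>k. (- 1) ^ k * (2 * pi) ^ (2 * k) / fact (2 * k) * gauss_moment v (2 * k) (1 / t))"
  let ?a = "\<lambda>j. complex_of_real (a j)" and ?b = "\<lambda>j. complex_of_real (b j)" and ?l = "\<lambda>k. complex_of_real (l k)"
  have "?l k - of_real (sqrt t ^ CARD('n)) * complex_of_real (\<Sum>j\<le>k. a j * b (k - j)) = (0::complex)"
  proof (rule even_powser_coeffs_zero[of "\<lambda>k. ?l k - of_real (sqrt t ^ CARD('n)) * complex_of_real (\<Sum>j\<le>k. a j * b (k - j))"])
    fix s :: real
    let ?E = "exp (- pi * t * (v \<bullet> v) * s ^ 2) :: complex"
    let ?G = "gauss_exp v t (complex_of_real (- 2 * pi * t * s))"
    have A: "(\<lambda>j. ?a j * complex_of_real s ^ (2 * j)) sums (exp (- pi * t * (v \<bullet> v) * s ^ 2) :: complex)" for s :: real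
    proof -
      have "(\<lambda>j. (- pi * t * (v \<bullet> v) * s ^ 2) ^ j /\<^sub>R fact j) sums exp (- pi * t * (v \<bullet> v) * s ^ 2)"
        by (rule exp_converges)
      also have "(\<lambda>j. (- pi * t * (v \<bullet> v) * s ^ 2) ^ j /\<^sub>R fact j) = (\<lambda>j. a j * s ^ (2 * j))"
        unfolding power_mult a_def power_mult_distrib[of "- pi * t * (v \<bullet> v)"] by (simp add: divide_inverse mult_ac)
      finally have "(\<lambda>j. a j * s ^ (2 * j)) sums exp (- pi * t * (v \<bullet> v) * s ^ 2)" .
      from sums_of_real[OF this, where 'a = complex] show ?thesis by simp
    qed
    have B: "(\<lambda>j. ?b j * complex_of_real s ^ (2 * j)) sums gauss_exp v t (complex_of_real (- 2 * pi * t * s))" for s :: real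
    proof -
      have "(- 2 * pi * t * s) ^ (2 * k) = (2 * pi * t) ^ (2 * k) * s ^ (2 * k)" for k
        unfolding power_mult power_mult_distrib[symmetric] by (simp add: power2_eq_square)
      then have "complex_of_real (- 2 * pi * t * s) ^ (2 * k) / fact (2 * k) * of_real (gauss_moment v (2 * k) t)
          = ?b k * complex_of_real s ^ (2 * k)" for k
        unfolding of_real_power[symmetric] by (simp add: b_def mult_ac)
      then show ?thesis using gauss_exp_sums_even[OF t, of "complex_of_real (- 2 * pi * t * s)" v] by simp
    qed
    \<comment> \<open>Absolute convergence at \<open>s\<close> follows from convergence at the
      larger point \<open>\<bar>s\<bar> + 1\<close>.\<close>
    have abs: "summable (\<lambda>j. norm (c j * complex_of_real s ^ (2 * j)))"
      if "\<And>s::real. summable (\<lambda>j. c j * complex_of_real s ^ (2 * j))" for c :: "nat \<Rightarrow> complex"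
    proof -
      have "summable (\<lambda>j. norm (c j * (of_real (s ^ 2)) ^ j))"
      proof (rule powser_insidea)
        show "summable (\<lambda>j. c j * (of_real ((\<bar>s\<bar> + 1) ^ 2)) ^ j)"
          using that[of "\<bar>s\<bar> + 1"] by (simp add: power_mult)
        have "s ^ 2 < (\<bar>s\<bar> + 1) ^ 2" by (simp add: power2_eq_square algebra_simps)
        then show "norm (complex_of_real (s ^ 2)) < norm (complex_of_real ((\<bar>s\<bar> + 1) ^ 2))"
          by (simp only: norm_of_real) simp
      qed
      then show ?thesis by (simp add: power_mult)
    qed
    let ?s = "complex_of_real s"
    have "(\<lambda>k. \<Sum>j\<le>k. (?a j * ?s ^ (2 * j)) * (?b (k - j) * ?s ^ (2 * (k - j)))) sums
        ((\<Sum>j. ?a j * ?s ^ (2 * j)) * (\<Sum>j. ?b j * ?s ^ (2 * j)))"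
      by (intro Cauchy_product_sums abs) (use A B sums_summable in blast)+
    moreover have "(\<Sum>j\<le>k. (?a j * ?s ^ (2 * j)) * (?b (k - j) * ?s ^ (2 * (k - j))))
        = complex_of_real (\<Sum>j\<le>k. a j * b (k - j)) * (?s ^ (2 * k) :: complex)" for k
    proof -
      have *: "(?a j * ?s ^ (2 * j)) * (?b (k - j) * ?s ^ (2 * (k - j)))
          = complex_of_real (a j * b (k - j)) * (?s ^ (2 * k) :: complex)" if "j \<le> k" for j
      proof -
        have "2 * k = 2 * j + 2 * (k - j)" using that by simp
        then have "?s ^ (2 * k) = ?s ^ (2 * j) * (?s ^ (2 * (k - j)) :: complex)"
          by (metis power_add)
        then show ?thesis by (simp add: mult_ac)
      qed
      show ?thesis unfolding of_real_sum sum_distrib_right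
        by (rule sum.cong[OF refl], rule *) simp
    qed
    ultimately have R: "(\<lambda>k. complex_of_real (\<Sum>j\<le>k. a j * b (k - j)) * ?s ^ (2 * k)) sums (?E * ?G)"
      using A[of s] B[of s] by (simp add: sums_iff)
    have Lq: "(\<lambda>k. ?l k * ?s ^ (2 * k)) sums gauss_exp v (1 / t) (- 2 * pi * \<i> * of_real s)"
    proof -
      have "(- 2 * pi * \<i> * of_real s) ^ (2 * k) = of_real ((- 1) ^ k * (2 * pi) ^ (2 * k)) * ?s ^ (2 * k)" for k
      proof -
        have e: "(- 2 * pi * \<i> * of_real s) ^ 2 = complex_of_real ((- 1) * ((2 * pi) ^ 2 * s ^ 2))"
          by (simp add: power2_eq_square)
        show ?thesis
          unfolding power_mult e by (simp only: of_real_mult of_real_power power_mult_distrib mult.assoc)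
      qed
      then have "(- 2 * pi * \<i> * of_real s) ^ (2 * k) / fact (2 * k) * of_real (gauss_moment v (2 * k) (1 / t))
          = ?l k * ?s ^ (2 * k)" for k
        by (simp add: l_def mult_ac)
      then show ?thesis
        using gauss_exp_sums_even[of "1 / t" "- 2 * pi * \<i> * of_real s" v] t by simp
    qed
    show "(\<lambda>k. (?l k - of_real (sqrt t ^ CARD('n)) * complex_of_real (\<Sum>j\<le>k. a j * b (k - j))) * ?s ^ (2 * k)) sums 0"
      using sums_diff[OF Lq sums_mult[OF R, of "of_real (sqrt t ^ CARD('n))"]] gauss_exp_transformation[OF t, of v s]
      by (simp add: left_diff_distrib mult.assoc)
  qed
  then have "?l k = of_real (sqrt t ^ CARD('n) * (\<Sum>j\<le>k. a j * b (k - j)))"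
    by simp
  then have "l k = sqrt t ^ CARD('n) * (\<Sum>j\<le>k. a j * b (k - j))"
    by (simp only: of_real_eq_iff)
  then show ?thesis by (simp add: l_def a_def b_def)
qed

end

section \<open>Even lattices: moments as q-series on the half-plane\<close>

lemma q_series_holomorphic:
  assumes "conv_radius a \<ge> 1"
  shows "q_series a holomorphic_on {\<tau>. Im \<tau> > 0}"
  using q_series_has_field_derivative[OF assms] open_halfspace_Im_gt[of 0]
  by (auto simp: holomorphic_on_open)

locale even_unimodular_24 = unimodular_basis M d for M d :: "'n::finite \<Rightarrow> real^'n" +
  assumes card24: "CARD('n) = 24"
    and even: "x \<in> L \<Longrightarrow> \<exists>k::int. x \<bullet> x = 2 * of_int k"
begin

lemma L_in_shell:
  assumes "x \<in> L"
  obtains k where "x \<in> shell L k"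
proof -
  obtain k :: int where k: "x \<bullet> x = 2 * of_int k" using even[OF assms] by blast
  then have "k \<ge> 0" using inner_ge_zero[of x] by simp
  then have "x \<in> shell L (nat k)"
    using assms k by (simp add: shell_def power2_norm_eq_inner)
  then show ?thesis by (rule that)
qed

text \<open>Evenness is used here: the shells with norms 2k exhaust the lattice, so every absolutely
  convergent lattice sum becomes a series indexed by integral powers of q.\<close>

lemma shell_sums:
  fixes h :: "real^'n \<Rightarrow> 'b::banach"
  assumes "(\<lambda>x. norm (h x)) summable_on L"
  shows "(\<lambda>k. \<Sum>x\<in>shell L k. h x) sums (\<Sum>\<^sub>\<infinity>x\<in>L. h x)"
proof -
  have S: "(h has_sum (\<Sum>\<^sub>\<infinity>x\<in>L. h x)) L"
    by (rule has_sum_infsum[OF abs_summable_summable[OF assms]])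
  have "inj_on snd (Sigma UNIV (shell L))"
  proof (rule inj_onI)
    fix p q assume "p \<in> Sigma UNIV (shell L)" "q \<in> Sigma UNIV (shell L)" "snd p = snd q"
    then have "2 * real (fst p) = 2 * real (fst q)" unfolding shell_def by force
    then show "p = q" using \<open>snd p = snd q\<close> by (simp add: prod_eq_iff)
  qed
  moreover have "snd ` (Sigma UNIV (shell L)) = L"
  proof
    show "snd ` (Sigma UNIV (shell L)) \<subseteq> L" by (auto simp: shell_def)
    show "L \<subseteq> snd ` (Sigma UNIV (shell L))"
    proof
      fix x assume "x \<in> L"
      then obtain k where "x \<in> shell L k" by (rule L_in_shell)
      then have "(k, x) \<in> Sigma UNIV (shell L)" by simp
      then show "x \<in> snd ` (Sigma UNIV (shell L))" by force
    qed
  qed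
  ultimately have "bij_betw snd (Sigma UNIV (shell L)) L" by (simp add: bij_betw_def)
  from has_sum_reindex_bij_betw[OF this, of h] S
  have "((\<lambda>p. h (snd p)) has_sum (\<Sum>\<^sub>\<infinity>x\<in>L. h x)) (Sigma UNIV (shell L))" by simp
  then have "((\<lambda>k. \<Sum>x\<in>shell L k. h x) has_sum (\<Sum>\<^sub>\<infinity>x\<in>L. h x)) UNIV"
    by (rule has_sum_SigmaD) (simp add: has_sum_finite finite_shell)
  then show ?thesis by (rule has_sum_imp_sums)
qed

definition moment :: "real^'n \<Rightarrow> nat \<Rightarrow> nat \<Rightarrow> real" where
  "moment v m k = (\<Sum>x\<in>shell L k. (x \<bullet> v) ^ m)"

lemma gauss_shell: "x \<in> shell L k \<Longrightarrow> gauss t x = exp (- 2 * pi * t) ^ k"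
  by (simp add: shell_def mult_ac flip: exp_of_nat_mult)

lemma moment_sums:
  assumes "t > 0"
  shows "(\<lambda>k. moment v m k * exp (- 2 * pi * t) ^ k) sums gauss_moment v m t"
proof -
  have "(\<Sum>x\<in>shell L k. gauss t x * (x \<bullet> v) ^ m) = moment v m k * exp (- 2 * pi * t) ^ k" for k
    unfolding moment_def sum_distrib_right by (intro sum.cong refl) (subst gauss_shell, assumption, rule mult.commute)
  then show ?thesis
    using shell_sums[OF gauss_moment_abs_summable[OF assms, of v m]] by (simp add: gauss_moment_def)
qed

lemma q_convergent_moment: "conv_radius (\<lambda>k. complex_of_real (moment v m k)) \<ge> 1"
proof (rule conv_radius_geI_ex')
  fix r :: real assume r: "0 < r" "ereal r < 1"
  define t where "t = - ln r / (2 * pi)"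
  have t: "t > 0" "exp (- 2 * pi * t) = r" using r by (simp_all add: t_def divide_neg_pos ln_less_zero)
  from sums_of_real[OF moment_sums[OF t(1), of v m], where 'a = complex]
  show "summable (\<lambda>n. complex_of_real (moment v m n) * of_real r ^ n)"
    unfolding t(2) by (simp add: sums_iff)
qed

text \<open>The moment theta series normalised so that its transformation law has the coefficients
  1/j! and no trace of pi or \<open>v\<close>; the factor 1/(2k)! comes from the exponential
  generating function.\<close>

definition A_coeff :: "real^'n \<Rightarrow> nat \<Rightarrow> nat \<Rightarrow> complex" where
  "A_coeff v k n = (4 * pi * \<i> / (v \<bullet> v)) ^ k / fact (2 * k) * of_real (moment v (2 * k) n)"

lemma A_coeff_imaginary:
  fixes t :: real
  assumes "t > 0"
  shows "q_series (A_coeff v k) (\<i> * t) = (4 * pi * \<i> / (v \<bullet> v)) ^ k / fact (2 * k) * of_real (gauss_moment v (2 * k) t)"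
proof -
  have e: "exp (2 * pi * \<i> * (\<i> * t)) = of_real (exp (- 2 * pi * t))"
  proof -
    have "2 * pi * \<i> * (\<i> * t) = complex_of_real (- 2 * pi * t)" by (simp add: complex_eq_iff)
    then show ?thesis by (simp only: exp_of_real)
  qed
  have "(\<lambda>n. (4 * pi * \<i> / (v \<bullet> v)) ^ k / fact (2 * k) * of_real (moment v (2 * k) n * exp (- 2 * pi * t) ^ n))
    sums ((4 * pi * \<i> / (v \<bullet> v)) ^ k / fact (2 * k) * of_real (gauss_moment v (2 * k) t))"
    by (intro sums_mult sums_of_real moment_sums assms)
  then show ?thesis
    unfolding q_series_def e A_coeff_def by (simp add: sums_iff mult.assoc)
qed

lemma A_coeff_law_imaginary:
  fixes t :: real
  assumes t: "t > 0" and v: "v \<noteq> 0"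
  shows "q_series (A_coeff v k) (- 1 / (\<i> * t))
    = (\<Sum>j\<le>k. (\<i> * t) ^ (12 + 2 * k - j) / fact j * q_series (A_coeff v (k - j)) (\<i> * t))"
proof -
  define V where "V = v \<bullet> v"
  have V: "V > 0" using v by (simp add: V_def)
  \<comment> \<open>The factor \<open>?a\<close> converts between the two normalisations: it sends
    -(2 pi)^2 to \<open>?b\<close>, -pi t V to \<i> t, and (2 pi t)^2 to (\<i> t)^2 times
    \<open>?b\<close>.\<close>
  let ?a = "- \<i> / (pi * V)" and ?b = "4 * pi * \<i> / V"
  define g where "g = (\<lambda>m. gauss_moment v (2 * m) t / fact (2 * m))"
  have inv: "- 1 / (\<i> * t) = \<i> * (1 / t)" using t by (simp add: field_simps)
  have sq: "sqrt t ^ CARD('n) = t ^ 12"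
  proof -
    have "sqrt t ^ CARD('n) = (sqrt t ^ 2) ^ 12" unfolding card24 by (simp flip: power_mult)
    then show ?thesis using t by simp
  qed
  define X where "X = (- 1) ^ k * (2 * pi) ^ (2 * k) / fact (2 * k) * gauss_moment v (2 * k) (1 / t)"
  have X: "X = t ^ 12 * (\<Sum>j\<le>k. (- pi * t * V) ^ j / fact j * ((2 * pi * t) ^ (2 * (k - j)) * g (k - j)))"
    unfolding X_def gauss_moment_transformation[OF t] sq V_def g_def by simp
  have c: "?b ^ k / fact (2 * k) * of_real (gauss_moment v (2 * k) (1 / t)) = ?a ^ k * of_real X"
  proof -
    have "?a ^ k * of_real ((- 1) ^ k * (2 * pi) ^ (2 * k)) = (?a * of_real ((- 1) * (2 * pi) ^ 2)) ^ k"
      by (simp only: power_mult power_mult_distrib of_real_mult of_real_power)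
    also have "?a * of_real ((- 1) * (2 * pi) ^ 2) = ?b"
      using V by (simp add: field_simps power2_eq_square)
    finally have "?a ^ k * of_real ((- 1) ^ k * (2 * pi) ^ (2 * k)) = ?b ^ k" .
    then show ?thesis unfolding X_def by (simp add: mult.assoc[symmetric])
  qed
  have summand: "?a ^ k * of_real (t ^ 12 * ((- pi * t * V) ^ j / fact j * ((2 * pi * t) ^ (2 * (k - j)) * g (k - j))))
      = (\<i> * t) ^ (12 + 2 * k - j) / fact j * (?b ^ (k - j) * of_real (g (k - j)))" if "j \<le> k" for j
  proof -
    define m where "m = k - j"
    have k: "k = j + m" using that by (simp add: m_def)
    have 1: "?a ^ j * of_real ((- pi * t * V) ^ j) = (\<i> * t) ^ j"
    proof -
      have "?a * of_real (- pi * t * V) = \<i> * t" using V by simp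
      then show ?thesis by (metis of_real_power power_mult_distrib)
    qed
    have 2: "?a ^ m * of_real ((2 * pi * t) ^ (2 * m)) = (\<i> * t) ^ (2 * m) * ?b ^ m"
    proof -
      have "?a * of_real ((2 * pi * t) ^ 2) = (\<i> * t) ^ 2 * ?b"
        using V by (simp add: field_simps power2_eq_square)
      then show ?thesis unfolding power_mult of_real_power[of _ m] power_mult_distrib[symmetric] by simp
    qed
    have 3: "(\<i> * t) ^ (12 + 2 * k - j) = of_real (t ^ 12) * (\<i> * t) ^ j * (\<i> * t) ^ (2 * m)"
    proof -
      have "12 + 2 * k - j = 12 + j + 2 * m" by (simp add: k)
      moreover have "(\<i> * t) ^ 12 = of_real (t ^ 12)"
        by (simp add: power_mult_distrib)
      ultimately show ?thesis by (simp only: power_add)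
    qed
    have "?a ^ k * of_real (t ^ 12 * ((- pi * t * V) ^ j / fact j * ((2 * pi * t) ^ (2 * m) * g m)))
      = of_real (t ^ 12) * (?a ^ j * of_real ((- pi * t * V) ^ j)) *
        (?a ^ m * of_real ((2 * pi * t) ^ (2 * m))) / fact j * of_real (g m)"
      unfolding k power_add of_real_mult of_real_divide of_real_fact by simp
    also have "\<dots> = (\<i> * t) ^ (12 + 2 * k - j) / fact j * (?b ^ m * of_real (g m))"
      unfolding 1 2 3 by simp
    finally show ?thesis unfolding m_def .
  qed
  have "q_series (A_coeff v k) (- 1 / (\<i> * t)) = ?a ^ k * of_real X"
    unfolding inv using A_coeff_imaginary[of "1 / t" v k] t c by (simp add: V_def)
  also have "\<dots> = (\<Sum>j\<le>k. (\<i> * t) ^ (12 + 2 * k - j) / fact j * (?b ^ (k - j) * of_real (g (k - j))))"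
    unfolding X sum_distrib_left of_real_sum by (intro sum.cong refl summand) simp
  also have "\<dots> = (\<Sum>j\<le>k. (\<i> * t) ^ (12 + 2 * k - j) / fact j * q_series (A_coeff v (k - j)) (\<i> * t))"
    unfolding A_coeff_imaginary[OF t] V_def[symmetric] g_def by simp
  finally show ?thesis .
qed

lemma q_convergent_A_coeff: "conv_radius (A_coeff v k) \<ge> 1"
  unfolding A_coeff_def[abs_def] by (intro q_convergent_cmult q_convergent_moment)

text \<open>Poisson summation yields the law only on the positive imaginary axis. Both sides are
  holomorphic on the upper half-plane and the axis accumulates at \<i>, so the identity theorem
  extends it.\<close>

lemma A_coeff_law:
  assumes v: "v \<noteq> 0" and \<tau>: "Im \<tau> > 0"
  shows "q_series (A_coeff v k) (- 1 / \<tau>) = (\<Sum>j\<le>k. \<tau> ^ (12 + 2 * k - j) / fact j * q_series (A_coeff v (k - j)) \<tau>)"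
proof -
  let ?H = "{\<tau>. Im \<tau> > 0}"
  let ?F = "\<lambda>\<tau>. q_series (A_coeff v k) (- 1 / \<tau>) - (\<Sum>j\<le>k. \<tau> ^ (12 + 2 * k - j) / fact j * q_series (A_coeff v (k - j)) \<tau>)"
  have "?F \<tau> = 0"
  proof (rule analytic_continuation[of ?F ?H "(\<lambda>t. \<i> * of_real t) ` {0<..}" \<i>])
    have "(q_series (A_coeff v k) \<circ> (\<lambda>\<tau>. - 1 / \<tau>)) holomorphic_on ?H"
    proof (rule holomorphic_on_compose_gen[OF _ q_series_holomorphic[OF q_convergent_A_coeff]])
      show "(\<lambda>\<tau>. - 1 / \<tau>) holomorphic_on ?H" by (intro holomorphic_intros) auto
      show "(\<lambda>\<tau>. - 1 / \<tau>) ` ?H \<subseteq> ?H" using Im_minus_inverse_pos by blast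
    qed
    then show "?F holomorphic_on ?H"
      unfolding o_def by (intro holomorphic_intros q_series_holomorphic q_convergent_A_coeff) auto
    show "open ?H" by (rule open_halfspace_Im_gt)
    show "connected ?H" by (intro convex_connected convex_halfspace_Im_gt)
    show "\<i> islimpt (\<lambda>t. \<i> * of_real t) ` {0<..}"
    proof (rule islimpt_approachable[THEN iffD2], intro allI impI)
      fix e :: real assume "e > 0"
      then show "\<exists>x'\<in>(\<lambda>t. \<i> * of_real t) ` {0<..}. x' \<noteq> \<i> \<and> dist x' \<i> < e"
        by (intro bexI[of _ "\<i> * of_real (1 + e / 2)"]) (auto simp: dist_norm algebra_simps norm_mult complex_eq_iff)
    qed
  qed (use \<tau> A_coeff_law_imaginary[OF _ v] in auto)
  then show ?thesis by simp
qed

lemma shell_0: "x \<in> shell L 0 \<Longrightarrow> x = 0"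
  by (simp add: shell_def)

text \<open>Since the vectors have norm 2, this says that the Gegenbauer polynomial of degree 2k and
  parameter 11 sums to 0 over their cosines with \<open>v\<close>. It is the coefficient of q^2 in a
  vanishing modular form. The case \<open>v = 0\<close> is separated because \<open>A_coeff\<close>
  divides by \<open>v \<bullet> v\<close>.\<close>

theorem zonal_moment_identity:
  assumes "shell L 1 = {}" and k: "k \<in> {1, 2, 3, 4}"
  shows "(\<Sum>j\<le>k. (- 1) ^ j * fact (10 + 2 * k - j) / fact j * (v \<bullet> v) ^ j * moment v (2 * (k - j)) 2 / fact (2 * (k - j))) = 0"
proof (cases "v = 0")
  case True
  have "(\<Sum>j\<le>k. (- 1) ^ j * fact (10 + 2 * k - j) / fact j * (v \<bullet> v) ^ j * moment v (2 * (k - j)) 2 / fact (2 * (k - j)) :: real) = 0"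
    by (rule sum.neutral) (use True k in \<open>auto simp: moment_def power_0_left\<close>)
  then show ?thesis .
next
  case False
  define V where "V = v \<bullet> v"
  have V: "V > 0" using False by (simp add: V_def)
  interpret quasimodular_family "A_coeff v"
    by unfold_locales (rule q_convergent_A_coeff, rule A_coeff_law[OF False])
  have "(\<Sum>j\<le>k. zonal_coeff k j * ((2 * pi * \<i> * of_nat 2) ^ j * A_coeff v (k - j) 2)) = 0"
  proof (rule zonal_sum_eq_0[OF k])
    show "A_coeff v m 0 = 0" if "m > 0" for m
    proof -
      have "moment v (2 * m) 0 = 0"
        unfolding moment_def by (rule sum.neutral) (use that in \<open>auto dest!: shell_0\<close>)
      then show ?thesis by (simp add: A_coeff_def)
    qed
    show "A_coeff v m 1 = 0" for m using assms(1) by (simp add: A_coeff_def moment_def)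
  qed
  \<comment> \<open>At n = 2 the derivative factor (4 pi \<i>)^j completes the normalisation of
    \<open>A_coeff\<close> to one power common to all terms, which can be cancelled.\<close>
  moreover have "zonal_coeff k j * ((2 * pi * \<i> * of_nat 2) ^ j * A_coeff v (k - j) 2)
      = (4 * pi * \<i> / V) ^ k * of_real ((- 1) ^ j * fact (10 + 2 * k - j) / fact j * V ^ j * moment v (2 * (k - j)) 2 / fact (2 * (k - j)))"
    if "j \<le> k" for j
  proof -
    have "(4 * pi * \<i> / V) ^ k = (4 * pi * \<i> / V) ^ j * (4 * pi * \<i> / V) ^ (k - j)"
      using that by (simp flip: power_add)
    moreover have "(2 * pi * \<i> * of_nat 2) ^ j = (4 * pi * \<i> / V) ^ j * of_real (V ^ j)"
      using V by (simp add: power_divide mult_ac)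
    ultimately show ?thesis by (simp add: zonal_coeff_def A_coeff_def V_def[symmetric])
  qed
  ultimately have "(4 * pi * \<i> / V) ^ k * of_real (\<Sum>j\<le>k. (- 1) ^ j * fact (10 + 2 * k - j) / fact j * V ^ j * moment v (2 * (k - j)) 2 / fact (2 * (k - j))) = 0"
    by (simp add: sum_distrib_left)
  moreover have "(4 * pi * \<i> / V) ^ k \<noteq> 0" using V by simp
  ultimately show ?thesis unfolding V_def mult_eq_0_iff of_real_eq_0_iff by blast
qed

end

section \<open>Inner products of minimal vectors\<close>

lemma binomial_moment:
  fixes p r g :: "'a \<Rightarrow> real"
  shows "(\<Sum>x\<in>S. g x * (p x + t * r x) ^ n) = (\<Sum>j\<le>n. (real (n choose j) * (\<Sum>x\<in>S. g x * (p x ^ (n - j) * r x ^ j))) * t ^ j)"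
proof -
  have "(\<Sum>x\<in>S. g x * (p x + t * r x) ^ n) = (\<Sum>x\<in>S. \<Sum>j\<le>n. real (n choose j) * (g x * (p x ^ (n - j) * r x ^ j)) * t ^ j)"
  proof (intro sum.cong refl)
    fix x
    have "(p x + t * r x) ^ n = (t * r x + p x) ^ n" by (simp add: add.commute)
    also have "\<dots> = (\<Sum>j\<le>n. real (n choose j) * (t * r x) ^ j * p x ^ (n - j))"
      by (simp add: binomial_ring)
    finally show "g x * (p x + t * r x) ^ n = (\<Sum>j\<le>n. real (n choose j) * (g x * (p x ^ (n - j) * r x ^ j)) * t ^ j)"
      by (simp add: sum_distrib_left power_mult_distrib mult_ac)
  qed
  also have "\<dots> = (\<Sum>j\<le>n. \<Sum>x\<in>S. real (n choose j) * (g x * (p x ^ (n - j) * r x ^ j)) * t ^ j)"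
    by (rule sum.swap)
  finally show ?thesis by (simp add: sum_distrib_left sum_distrib_right)
qed

text \<open>Polarization: a moment formula valid along the whole line p + t r is a polynomial
  identity in t, and its coefficients are the mixed moments.\<close>

lemma moment_coeffs:
  fixes p r g :: "'a \<Rightarrow> real"
  assumes "\<And>t. (\<Sum>x\<in>S. g x * (p x + t * r x) ^ n) = (\<Sum>j\<le>n. c j * t ^ j)" and "j \<le> n"
  shows "real (n choose j) * (\<Sum>x\<in>S. g x * (p x ^ (n - j) * r x ^ j)) = c j"
proof -
  have "\<forall>t. (\<Sum>j\<le>n. (real (n choose j) * (\<Sum>x\<in>S. g x * (p x ^ (n - j) * r x ^ j))) * t ^ j) = (\<Sum>j\<le>n. c j * t ^ j)"
    using assms(1) binomial_moment[of g p _ r n S] by metis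
  then show ?thesis using polyfun_eq_coeffs[of "\<lambda>j. real (n choose j) * (\<Sum>x\<in>S. g x * (p x ^ (n - j) * r x ^ j))" n c] assms(2)
    by blast
qed

text \<open>On the minimal vectors this polynomial in \<open>p = x \<bullet> A\<close> and \<open>r = x \<bullet> u\<close> is nonzero only at
  \<open>(p, r) = \<plusminus>(2, 1)\<close> and \<open>\<plusminus>(4, 2)\<close>.\<close>

definition selector :: "real \<Rightarrow> real \<Rightarrow> real" where
  "selector p r = p ^ 2 * r * (p - r) * (p + r) * (2 * p - r)"

text \<open>The hypothesis has the shape forced by |A + t u|^2 = 4 (1 + t + t^2). The coefficients
  1, 3, 6, 7, 6, 3, 1 of the cube, divided by the binomials of 6, are the mixed moments. The weight
  \<open>g\<close> permits a second use with a squared inner product.\<close>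

lemma selector_moment:
  fixes p r g :: "'a \<Rightarrow> real"
  assumes "\<And>t. (\<Sum>x\<in>S. g x * (p x + t * r x) ^ 6) = K * (1 + t + t\<^sup>2) ^ 3"
  shows "(\<Sum>x\<in>S. g x * selector (p x) (r x)) = 3 / 10 * K"
proof -
  define c where "c = (\<lambda>j::nat. K * (if j = 0 \<or> j = 6 then 1 else if j = 1 \<or> j = 5 then 3 else if j = 2 \<or> j = 4 then 6 else 7))"
  have e: "(\<Sum>x\<in>S. g x * (p x + t * r x) ^ 6) = (\<Sum>j\<le>6. c j * t ^ j)" for t
    unfolding assms by (simp add: c_def eval_nat_numeral algebra_simps)
  let ?m = "\<lambda>j. \<Sum>x\<in>S. g x * (p x ^ (6 - j) * r x ^ j)"
  have m: "real (6 choose j) * ?m j = c j" if "j \<le> 6" for j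
    by (rule moment_coeffs[OF e that])
  have b: "6 choose 1 = (6::nat)" "6 choose 2 = (15::nat)" "6 choose 3 = (20::nat)" "6 choose 4 = (15::nat)"
    by (simp_all add: eval_nat_numeral)
  have m': "?m 1 = K / 2" "?m 2 = 2 * K / 5" "?m 3 = 7 * K / 20" "?m 4 = 2 * K / 5"
    using m[of 1] m[of 2] m[of 3] m[of 4] by (simp_all add: b c_def del: binomial_eq_0_iff One_nat_def)
  have "(\<Sum>x\<in>S. g x * selector (p x) (r x)) = (\<Sum>x\<in>S. 2 * (g x * (p x ^ (6 - 1) * r x ^ 1))
      - g x * (p x ^ (6 - 2) * r x ^ 2) - 2 * (g x * (p x ^ (6 - 3) * r x ^ 3)) + g x * (p x ^ (6 - 4) * r x ^ 4))"
    by (intro sum.cong refl) (simp add: selector_def eval_nat_numeral algebra_simps)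
  also have "\<dots> = 2 * ?m 1 - ?m 2 - 2 * ?m 3 + ?m 4"
    by (simp only: sum.distrib sum_subtractf sum_distrib_left)
  also have "\<dots> = 3 / 10 * K" unfolding m' by simp
  finally show ?thesis .
qed

text \<open>The moment constants are those of the uniform measure on the sphere of radius 2 in
  dimension 24: 4^m times 1 * 3 * ... * (2m - 1) divided by 24 * 26 * ... * (22 + 2m).\<close>

locale leech_shell =
  fixes S :: "'a::real_inner set"
  assumes finite_S: "finite S"
    and norm_S: "x \<in> S \<Longrightarrow> x \<bullet> x = 4"
    and inner_S: "x \<in> S \<Longrightarrow> y \<in> S \<Longrightarrow> x \<bullet> y \<in> {-4, -2, -1, 0, 1, 2, 4}"
    and uminus_S: "x \<in> S \<Longrightarrow> - x \<in> S"
    and diff_S: "x \<in> S \<Longrightarrow> y \<in> S \<Longrightarrow> x \<bullet> y = 2 \<Longrightarrow> x - y \<in> S"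
    and moment_2: "(\<Sum>x\<in>S. (x \<bullet> v) ^ 2) = card S * (v \<bullet> v) / 6"
    and moment_4: "(\<Sum>x\<in>S. (x \<bullet> v) ^ 4) = card S * (v \<bullet> v) ^ 2 / 13"
    and moment_6: "(\<Sum>x\<in>S. (x \<bullet> v) ^ 6) = card S * (v \<bullet> v) ^ 3 * (5 / 91)"
    and moment_8: "(\<Sum>x\<in>S. (x \<bullet> v) ^ 8) = card S * (v \<bullet> v) ^ 4 * (2 / 39)"
begin

lemma inner_4: "x \<in> S \<Longrightarrow> y \<in> S \<Longrightarrow> x \<bullet> y = 4 \<longleftrightarrow> x = y"
proof
  assume *: "x \<in> S" "y \<in> S" "x \<bullet> y = 4"
  then have "(x - y) \<bullet> (x - y) = 0"
    using norm_S by (simp add: inner_diff_left inner_diff_right inner_commute)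
  then show "x = y" by simp
qed (simp add: norm_S)

lemma inner_m4: "x \<in> S \<Longrightarrow> y \<in> S \<Longrightarrow> x \<bullet> y = - 4 \<longleftrightarrow> x = - y"
  using inner_4[of x "- y"] uminus_S[of y] by auto

lemma neq_uminus: "A \<in> S \<Longrightarrow> A \<noteq> - A"
  using norm_S[of A] inner_minus_left[of A A] by force

text \<open>The polynomial p^2 (p^2 - 1) (p^2 - 4) vanishes at every admissible inner product except
  4 and -4, which occur only at \<open>A\<close> and \<open>- A\<close>. Each of these contributes
  2880, and the moments evaluate the same sum as a multiple of \<open>card S\<close>.\<close>

lemma card_S:
  assumes A: "A \<in> S"
  shows "card S = 196560"
proof -
  let ?f = "\<lambda>x. (x \<bullet> A) ^ 6 - 5 * (x \<bullet> A) ^ 4 + 4 * (x \<bullet> A) ^ 2"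
  have "(\<Sum>x\<in>S. ?f x) = (\<Sum>x\<in>{A, - A}. ?f x)"
  proof (rule sum.mono_neutral_right[OF finite_S])
    show "\<forall>x\<in>S - {A, - A}. ?f x = 0"
    proof
      fix x assume x: "x \<in> S - {A, - A}"
      then have "x \<bullet> A \<noteq> 4" "x \<bullet> A \<noteq> - 4" using inner_4[of x A] inner_m4[of x A] A by auto
      then show "?f x = 0" using inner_S[of x A] x A by auto
    qed
  qed (use A uminus_S in auto)
  also have "\<dots> = 5760" using neq_uminus[OF A] by (simp add: norm_S[OF A])
  also have "(\<Sum>x\<in>S. ?f x) = card S * (8 / 273)"
    unfolding sum.distrib sum_subtractf sum_distrib_left[symmetric] moment_2 moment_4 moment_6
    by (simp add: norm_S[OF A])
  finally have "real (card S) = 196560" by simp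
  then show ?thesis by simp
qed

section \<open>The minimal vectors with inner products 2 and 1\<close>

context
  fixes A u
  assumes A: "A \<in> S" and u: "u \<in> S" and Au: "A \<bullet> u = 2"
begin

definition A2 where "A2 = {y \<in> S. y \<bullet> A = 2 \<and> y \<bullet> u = 1}"

lemma A2_S: "y \<in> A2 \<Longrightarrow> y \<in> S" by (simp add: A2_def)

lemma finite_A2: "finite A2" using finite_S by (simp add: A2_def)

lemma A2_reflect: "y \<in> A2 \<Longrightarrow> A - y \<in> A2"
  using diff_S[of A y] A norm_S[OF A] Au by (auto simp: A2_def inner_diff_left inner_diff_right inner_commute)

text \<open>The involution y \<mapsto> A - y preserves \<open>A2\<close> and replaces an inner
  product q by 2 - q; the values -4 and -1 would go to 6 and 3, which do not occur.\<close>

lemma A2_inner: "y \<in> A2 \<Longrightarrow> z \<in> A2 \<Longrightarrow> y \<bullet> z \<in> {-2, 0, 1, 2, 4}"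
proof -
  assume *: "y \<in> A2" "z \<in> A2"
  have "y \<bullet> z \<in> {-4, -2, -1, 0, 1, 2, 4}" using inner_S * A2_S by blast
  moreover have "2 - y \<bullet> z \<in> {-4, -2, -1, 0, 1, 2, 4}"
  proof -
    have "y \<bullet> (A - z) \<in> {-4, -2, -1, 0, 1, 2, 4}" using inner_S * A2_S A2_reflect by blast
    moreover have "y \<bullet> (A - z) = 2 - y \<bullet> z" using * by (simp add: A2_def inner_diff_right)
    ultimately show ?thesis by simp
  qed
  ultimately show ?thesis by auto
qed

text \<open>As \<open>A - u\<close> is a minimal vector too, p - r also avoids 3 and -3. This
  excludes pairs such as (2, -1) and (1, -2), where the polynomial does not vanish. The value r = 4
  would force x = u and hence r = 2p.\<close>

lemma selector_neq_0:
  assumes x: "x \<in> S" and "selector (x \<bullet> A) (x \<bullet> u) \<noteq> 0"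
  shows "x \<in> {A, - A} \<union> A2 \<union> uminus ` A2"
proof -
  define p r where "p = x \<bullet> A" and "r = x \<bullet> u"
  have pr: "p \<noteq> 0" "r \<noteq> 0" "p \<noteq> r" "p \<noteq> - r" "r \<noteq> 2 * p"
    using assms(2) by (auto simp: selector_def p_def r_def)
  have "A - u \<in> S" using diff_S A u Au by blast
  then have d: "p - r \<in> {-4, -2, -1, 0, 1, 2, 4}" using inner_S[of x "A - u"] x by (simp add: p_def r_def inner_diff_right)
  have p: "p \<in> {-4, -2, -1, 0, 1, 2, 4}" and r: "r \<in> {-4, -2, -1, 0, 1, 2, 4}"
    using inner_S x A u by (auto simp: p_def r_def)
  have r4: "r \<noteq> 4" "r \<noteq> - 4"
    using inner_4[OF x u] inner_m4[OF x u] pr(5) Au by (auto simp: p_def r_def inner_commute)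
  have "p = 4 \<or> p = - 4 \<or> (p = 2 \<and> r = 1) \<or> (p = - 2 \<and> r = - 1)"
    using p r d pr r4 by auto
  then show ?thesis
  proof (elim disjE conjE)
    assume "p = - 2" "r = - 1"
    then have "- x \<in> A2" using x uminus_S by (simp add: A2_def p_def r_def)
    then show ?thesis by (metis UnI2 image_eqI minus_minus)
  qed (use inner_4[OF x A] inner_m4[OF x A] x in \<open>auto simp: p_def r_def A2_def\<close>)
qed

text \<open>The polynomial is even with value 2304 at (4, 2) and 36 at (2, 1), and antipodes
  contribute equally, whence 4608 and 72.\<close>

lemma selector_sum:
  assumes g: "\<And>x. g (- x) = g x" and gA: "g A = gA"
  shows "(\<Sum>x\<in>S. g x * selector (x \<bullet> A) (x \<bullet> u)) = 4608 * gA + 72 * (\<Sum>x\<in>A2. g x)"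
proof -
  let ?f = "\<lambda>x. g x * selector (x \<bullet> A) (x \<bullet> u)"
  have disj: "{A, - A} \<inter> (A2 \<union> uminus ` A2) = {}" "A2 \<inter> uminus ` A2 = {}"
    using norm_S[OF A] by (auto simp: A2_def)
  have "(\<Sum>x\<in>S. ?f x) = (\<Sum>x\<in>{A, - A} \<union> (A2 \<union> uminus ` A2). ?f x)"
    by (rule sum.mono_neutral_right[OF finite_S])
      (use A uminus_S A2_S selector_neq_0 in auto)
  also have "\<dots> = (\<Sum>x\<in>{A, - A}. ?f x) + ((\<Sum>x\<in>A2. ?f x) + (\<Sum>x\<in>uminus ` A2. ?f x))"
    using disj finite_A2 by (subst sum.union_disjoint, simp_all only: finite.intros finite_Un finite_imageI simp_thms)
      (subst sum.union_disjoint, auto)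
  also have "(\<Sum>x\<in>{A, - A}. ?f x) = 4608 * gA"
    using neq_uminus[OF A] by (simp add: g gA norm_S[OF A] Au selector_def)
  also have "(\<Sum>x\<in>A2. ?f x) = 36 * (\<Sum>x\<in>A2. g x)"
    unfolding sum_distrib_left by (intro sum.cong refl) (simp add: A2_def selector_def)
  also have "(\<Sum>x\<in>uminus ` A2. ?f x) = 36 * (\<Sum>x\<in>A2. g x)"
    unfolding sum_distrib_left
    by (subst sum.reindex) (auto simp: inj_on_def g A2_def selector_def intro!: sum.cong)
  finally show ?thesis by simp
qed

text \<open>The sixth moment along A + t u has the factor 64 * 10800; 3/10 of it is 207360, which
  must equal 4608 + 72 times the cardinality.\<close>

lemma card_A2: "card A2 = 2816"
proof -
  have "(\<Sum>x\<in>S. 1 * (x \<bullet> A + t * (x \<bullet> u)) ^ 6) = (64 * 10800) * (1 + t + t\<^sup>2) ^ 3" for t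
  proof -
    have "(A + t *\<^sub>R u) \<bullet> (A + t *\<^sub>R u) = 4 * (1 + t + t\<^sup>2)"
      using norm_S[OF A] norm_S[OF u] Au
      by (simp add: inner_add_left inner_add_right inner_commute[of u A] power2_eq_square algebra_simps)
    from moment_6[of "A + t *\<^sub>R u", unfolded this power_mult_distrib]
    show ?thesis by (simp add: inner_add_right card_S[OF A])
  qed
  from selector_moment[OF this] selector_sum[of "\<lambda>_. 1" 1]
  have "real (card A2) = 2816" by simp
  then show ?thesis by simp
qed

text \<open>The weight is the squared inner product with \<open>z = 2 *\<^sub>R y - A\<close>, twice
  the component of \<open>y\<close> orthogonal to \<open>A\<close> and \<open>u\<close>. It vanishes
  at \<open>A\<close>, so only \<open>A2\<close> contributes, and orthogonality lets the eighth
  moment along v + m z split into powers of E and m^2.\<close>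

lemma sum_A2_inner:
  assumes y: "y \<in> A2"
  shows "(\<Sum>x\<in>A2. (x \<bullet> y - 1) ^ 2) = 1152"
proof -
  define z where "z = 2 *\<^sub>R y - A"
  have yy: "y \<bullet> y = 4" "y \<bullet> A = 2" "y \<bullet> u = 1" using y norm_S by (auto simp: A2_def)
  have z: "z \<bullet> A = 0" "z \<bullet> u = 0" "z \<bullet> z = 12"
    using yy norm_S[OF A] Au
    by (simp_all add: z_def inner_diff_left inner_diff_right inner_commute[of A y])
  have "(\<Sum>x\<in>S. (x \<bullet> z) ^ 2 * (x \<bullet> A + t * (x \<bullet> u)) ^ 6) = 1105920 * (1 + t + t\<^sup>2) ^ 3" for t
  proof -
    define v where "v = A + t *\<^sub>R u"
    define E where "E = 4 * (1 + t + t\<^sup>2)"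
    have vE: "v \<bullet> v = E"
      using norm_S[OF A] norm_S[OF u] Au
      by (simp add: v_def E_def inner_add_left inner_add_right inner_commute[of u A] power2_eq_square algebra_simps)
    have vz: "z \<bullet> v = 0" using z by (simp add: v_def inner_add_right)
    define c where "c = (\<lambda>j::nat. 10080 * (if j = 0 then E ^ 4 else if j = 2 then 48 * E ^ 3
      else if j = 4 then 864 * E ^ 2 else if j = 6 then 6912 * E else if j = 8 then 20736 else 0))"
    have e: "(\<Sum>x\<in>S. 1 * (x \<bullet> v + m * (x \<bullet> z)) ^ 8) = (\<Sum>j\<le>8. c j * m ^ j)" for m
    proof -
      have "(v + m *\<^sub>R z) \<bullet> (v + m *\<^sub>R z) = E + 12 * m\<^sup>2"
        using z vz by (simp add: inner_add_left inner_add_right inner_commute[of v z] vE power2_eq_square)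
      then have "(\<Sum>x\<in>S. 1 * (x \<bullet> v + m * (x \<bullet> z)) ^ 8) = 10080 * (E + 12 * m\<^sup>2) ^ 4"
        using moment_8[of "v + m *\<^sub>R z"] by (simp add: inner_add_right card_S[OF A])
      also have "\<dots> = (\<Sum>j\<le>8. c j * m ^ j)"
        by (simp add: c_def eval_nat_numeral algebra_simps)
      finally show ?thesis .
    qed
    have "8 choose 2 = (28::nat)" by (simp add: eval_nat_numeral)
    then have "28 * (\<Sum>x\<in>S. 1 * ((x \<bullet> v) ^ (8 - 2) * (x \<bullet> z) ^ 2)) = 10080 * (48 * E ^ 3)"
      using moment_coeffs[OF e, of 2] by (simp add: c_def)
    then have "(\<Sum>x\<in>S. (x \<bullet> z) ^ 2 * (x \<bullet> v) ^ 6) = 17280 * E ^ 3" by (simp add: mult.commute)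
    then show ?thesis
      unfolding E_def power_mult_distrib by (simp add: v_def inner_add_right)
  qed
  from selector_moment[OF this] selector_sum[of "\<lambda>x. (x \<bullet> z) ^ 2" 0] z(1)
  have "(\<Sum>x\<in>A2. (x \<bullet> z) ^ 2) = 4608" by (simp add: inner_commute)
  moreover have "(\<Sum>x\<in>A2. (x \<bullet> z) ^ 2) = (\<Sum>x\<in>A2. 4 * (x \<bullet> y - 1) ^ 2)"
    by (intro sum.cong refl) (simp add: A2_def z_def inner_diff_right power2_eq_square algebra_simps)
  ultimately show ?thesis by (simp flip: sum_distrib_left)
qed

text \<open>In the sum 1152, the points \<open>y\<close> and \<open>A - y\<close> contribute 9 each,
  inner product 1 contributes nothing, and inner products 0 and 2 contribute 1 each.\<close>

lemma card_A2_inner: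
  assumes y: "y \<in> A2"
  shows "card {x \<in> A2. x \<bullet> y = 0 \<or> x \<bullet> y = 2} = 1134"
proof -
  let ?B = "{x \<in> A2. x \<bullet> y = 0 \<or> x \<bullet> y = 2}"
  have yy: "y \<bullet> y = 4" "y \<bullet> A = 2" using y norm_S by (auto simp: A2_def)
  have ne: "y \<noteq> A - y"
  proof
    assume "y = A - y"
    then have "y \<bullet> y = y \<bullet> (A - y)" by simp
    then show False using yy by (simp add: inner_diff_right)
  qed
  have "(\<Sum>x\<in>A2. (x \<bullet> y - 1) ^ 2) = (\<Sum>x\<in>{y, A - y} \<union> ?B. (x \<bullet> y - 1) ^ 2)"
  proof (rule sum.mono_neutral_right[OF finite_A2])
    show "\<forall>x\<in>A2 - ({y, A - y} \<union> ?B). (x \<bullet> y - 1) ^ 2 = 0"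
    proof
      fix x assume x: "x \<in> A2 - ({y, A - y} \<union> ?B)"
      then have "x \<bullet> y \<noteq> 4" using inner_4[of x y] y A2_S by auto
      moreover have "x \<bullet> y \<noteq> - 2"
      proof
        assume "x \<bullet> y = - 2"
        then have "x \<bullet> (A - y) = 4" using x by (simp add: A2_def inner_diff_right)
        then show False using inner_4[of x "A - y"] x y A2_S A2_reflect by auto
      qed
      ultimately show "(x \<bullet> y - 1) ^ 2 = 0" using A2_inner[of x y] x y by auto
    qed
  qed (use y A2_reflect in auto)
  also have "\<dots> = (\<Sum>x\<in>{y, A - y}. (x \<bullet> y - 1) ^ 2) + (\<Sum>x\<in>?B. (x \<bullet> y - 1) ^ 2)"
    using finite_A2 yy by (intro sum.union_disjoint) (auto simp: inner_diff_left inner_diff_right inner_commute)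
  also have "(\<Sum>x\<in>{y, A - y}. (x \<bullet> y - 1) ^ 2) = 18"
    using ne yy by (simp add: inner_diff_left inner_diff_right inner_commute)
  also have "(\<Sum>x\<in>?B. (x \<bullet> y - 1) ^ 2) = (\<Sum>x\<in>?B. 1)"
    by (intro sum.cong refl) auto
  finally have "real (card ?B) = 1134" using sum_A2_inner[OF y] by simp
  then show ?thesis by simp
qed

end
end

section \<open>The linear programming bound\<close>

text \<open>The frame operator of the vectors has trace \<open>card I\<close>, and its squared
  Frobenius norm is the double sum of squared inner products. Cauchy-Schwarz on the diagonal
  compares the two.\<close>

lemma gegenbauer_2_nonneg:
  fixes x :: "'i \<Rightarrow> 'a::euclidean_space"
  assumes "\<And>i. i \<in> I \<Longrightarrow> norm (x i) = 1"
  shows "(\<Sum>i\<in>I. \<Sum>j\<in>I. (x i \<bullet> x j)\<^sup>2 - 1 / DIM('a)) \<ge> 0"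
proof -
  let ?B = "Basis :: 'a set" and ?M = "\<lambda>a b. \<Sum>i\<in>I. (x i \<bullet> a) * (x i \<bullet> b)"
  have tr: "(\<Sum>a\<in>?B. ?M a a) = card I"
  proof -
    have "(\<Sum>a\<in>?B. ?M a a) = (\<Sum>i\<in>I. x i \<bullet> x i)"
      unfolding euclidean_inner[of "x _" "x _"] by (rule sum.swap)
    then show ?thesis using assms by (simp add: norm_eq_1)
  qed
  have "(\<Sum>i\<in>I. \<Sum>j\<in>I. (x i \<bullet> x j)\<^sup>2)
      = (\<Sum>i\<in>I. \<Sum>j\<in>I. \<Sum>a\<in>?B. \<Sum>b\<in>?B. (x i \<bullet> a) * (x i \<bullet> b) * ((x j \<bullet> a) * (x j \<bullet> b)))"
    unfolding power2_eq_square euclidean_inner[of "x _" "x _"] sum_product by (simp only: mult_ac)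
  also have "\<dots> = (\<Sum>a\<in>?B. \<Sum>b\<in>?B. (?M a b)\<^sup>2)"
    by (simp only: sum.swap[of _ I ?B] power2_eq_square sum_product)
  finally have M: "(\<Sum>i\<in>I. \<Sum>j\<in>I. (x i \<bullet> x j)\<^sup>2) = \<dots>" .
  have "(real (card I))\<^sup>2 = (\<Sum>a\<in>?B. ?M a a * 1)\<^sup>2" using tr by simp
  also have "\<dots> \<le> (\<Sum>a\<in>?B. (?M a a)\<^sup>2) * (\<Sum>a\<in>?B. 1\<^sup>2)" by (rule Cauchy_Schwarz_ineq_sum)
  also have "(\<Sum>a\<in>?B. (?M a a)\<^sup>2) \<le> (\<Sum>a\<in>?B. \<Sum>b\<in>?B. (?M a b)\<^sup>2)"
  proof (rule sum_mono)
    fix a :: 'a assume "a \<in> ?B"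
    then show "(?M a a)\<^sup>2 \<le> (\<Sum>b\<in>?B. (?M a b)\<^sup>2)"
      by (rule member_le_sum[of a ?B "\<lambda>b. (?M a b)\<^sup>2"]) auto
  qed
  finally show ?thesis
    using M by (simp add: sum_subtractf divide_le_eq power2_eq_square)
qed

text \<open>The degree 4 zonal harmonic is the inner product of the traceless parts of the tensors
  \<open>v\<^sup>\<otimes>\<^sup>4\<close>. Tracelessness reduces that inner product to the evaluation of one tensor at the other vector.\<close>

lemma gegenbauer_4_nonneg:
  fixes x :: "'i \<Rightarrow> 'a::euclidean_space"
  assumes norm1: "\<And>i. i \<in> I \<Longrightarrow> norm (x i) = 1"
  defines "n \<equiv> real (DIM('a))"
  shows "(\<Sum>i\<in>I. \<Sum>j\<in>I. (x i \<bullet> x j) ^ 4 - 6 / (n + 4) * (x i \<bullet> x j)\<^sup>2 + 3 / ((n + 2) * (n + 4))) \<ge> 0"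
proof -
  let ?B = "Basis :: 'a set"
  have n: "n > 0" by (simp add: n_def)
  \<comment> \<open>Tracelessness fixes both constants: contracting two indices leaves the factors 1
    - (n + 4) \<alpha> and (n + 2) \<beta> - \<alpha>.\<close>
  define \<alpha> where "\<alpha> = 1 / (n + 4)"
  define \<beta> where "\<beta> = 1 / ((n + 2) * (n + 4))"
  define \<delta> where "\<delta> = (\<lambda>a b :: 'a. if a = b then 1 else 0 :: real)"
  define Z where "Z = (\<lambda>(v :: 'a \<Rightarrow> real) a b c d. v a * v b * v c * v d
    - \<alpha> * (\<delta> a b * (v c * v d) + \<delta> a c * (v b * v d) + \<delta> a d * (v b * v c)
         + \<delta> b c * (v a * v d) + \<delta> b d * (v a * v c) + \<delta> c d * (v a * v b))
    + \<beta> * (\<delta> a b * \<delta> c d + \<delta> a c * \<delta> b d + \<delta> a d * \<delta> b c))"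
  have \<delta>s: "\<delta> a b = \<delta> b a" for a b by (simp add: \<delta>_def)
  have \<delta>1: "(\<Sum>a\<in>?B. \<delta> a b * f a) = f b" if "b \<in> ?B" for b and f :: "'a \<Rightarrow> real"
  proof -
    have "\<delta> a b * f a = (if a = b then f a else 0)" for a by (simp add: \<delta>_def)
    then show ?thesis using that by simp
  qed
  have \<delta>2: "(\<Sum>a\<in>?B. \<delta> b a * f a) = f b" if "b \<in> ?B" for b and f :: "'a \<Rightarrow> real"
    using \<delta>1[OF that] by (simp add: \<delta>s)
  have perm: "Z v a b c d = Z v b a c d" "Z v a b c d = Z v a c b d" "Z v a b c d = Z v a b d c" for v a b c d
    by (simp_all add: Z_def \<delta>s[of b a] \<delta>s[of c b] \<delta>s[of d c] algebra_simps)
  have trace: "(\<Sum>a\<in>?B. Z v a a c d) = 0" if v: "(\<Sum>a\<in>?B. v a * v a) = 1" and "c \<in> ?B" "d \<in> ?B" for v c d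
  proof -
    have "Z v a a c d = (v a * v a) * (v c * v d - \<alpha> * \<delta> c d)
      - \<alpha> * (v c * v d) - 2 * \<alpha> * v d * (\<delta> a c * v a) - 2 * \<alpha> * v c * (\<delta> a d * v a)
      + \<beta> * \<delta> c d + 2 * \<beta> * (\<delta> a c * \<delta> a d)" for a
      by (simp add: Z_def \<delta>_def algebra_simps)
    then have "(\<Sum>a\<in>?B. Z v a a c d) = (v c * v d - \<alpha> * \<delta> c d)
      - n * (\<alpha> * (v c * v d)) - 2 * \<alpha> * v d * v c - 2 * \<alpha> * v c * v d
      + n * (\<beta> * \<delta> c d) + 2 * \<beta> * \<delta> c d"
      using that by (simp add: sum.distrib sum_subtractf v \<delta>1 n_def flip: sum_distrib_left sum_distrib_right)
    also have "\<dots> = (v c * v d) * (1 - (n + 4) * \<alpha>) + \<delta> c d * ((n + 2) * \<beta> - \<alpha>)"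
      by (simp add: algebra_simps)
    also have "\<dots> = 0" using n by (simp add: \<alpha>_def \<beta>_def)
    finally show ?thesis .
  qed
  let ?S = "\<lambda>F. \<Sum>a\<in>?B. \<Sum>b\<in>?B. \<Sum>c\<in>?B. \<Sum>d\<in>?B. F a b c d :: real"
  let ?C = "\<lambda>X Y. \<Sum>c\<in>?B. \<Sum>d\<in>?B. X c d * (\<Sum>a\<in>?B. Y a a c d) :: real"
  have swap12: "?S F = ?S (\<lambda>a b c d. F b a c d)" for F by (rule sum.swap)
  have swap23: "?S F = ?S (\<lambda>a b c d. F a c b d)" for F by (rule sum.cong[OF refl], rule sum.swap)
  have swap34: "?S F = ?S (\<lambda>a b c d. F a b d c)" for F by (rule sum.cong[OF refl], rule sum.cong[OF refl], rule sum.swap)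
  \<comment> \<open>Against a fully symmetric \<open>Y\<close> all six terms with one delta give the
    same contraction, and so do the three terms with two deltas.\<close>
  have expand: "?S (\<lambda>a b c d. Z v a b c d * Y a b c d) = ?S (\<lambda>a b c d. v a * v b * v c * v d * Y a b c d)
      - 6 * \<alpha> * ?C (\<lambda>c d. v c * v d) Y + 3 * \<beta> * ?C \<delta> Y"
    if Y: "\<And>a b c d. Y b a c d = Y a b c d" "\<And>a b c d. Y a c b d = Y a b c d" "\<And>a b c d. Y a b d c = Y a b c d" for v Y
  proof -
    have z1: "?S (\<lambda>a b c d. \<delta> a b * X c d * Y a b c d) = ?C X Y" for X
    proof -
      have "(\<Sum>b\<in>?B. \<Sum>c\<in>?B. \<Sum>d\<in>?B. \<delta> a b * X c d * Y a b c d) = (\<Sum>c\<in>?B. \<Sum>d\<in>?B. X c d * Y a a c d)"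
        if "a \<in> ?B" for a
        using \<delta>2[OF that, of "\<lambda>b. \<Sum>c\<in>?B. \<Sum>d\<in>?B. X c d * Y a b c d"]
        by (simp add: sum_distrib_left mult.assoc)
      then have "?S (\<lambda>a b c d. \<delta> a b * X c d * Y a b c d) = (\<Sum>a\<in>?B. \<Sum>c\<in>?B. \<Sum>d\<in>?B. X c d * Y a a c d)"
        by simp
      also have "\<dots> = (\<Sum>c\<in>?B. \<Sum>a\<in>?B. \<Sum>d\<in>?B. X c d * Y a a c d)" by (rule sum.swap)
      also have "\<dots> = (\<Sum>c\<in>?B. \<Sum>d\<in>?B. \<Sum>a\<in>?B. X c d * Y a a c d)" by (rule sum.cong[OF refl], rule sum.swap)
      finally show ?thesis by (simp only: sum_distrib_left)
    qed
    have z2: "?S (\<lambda>a b c d. \<delta> a c * X b d * Y a b c d) = ?C X Y" for X by (subst swap23) (simp only: Y(2) z1)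
    have z3: "?S (\<lambda>a b c d. \<delta> a d * X b c * Y a b c d) = ?C X Y" for X by (subst swap34) (simp only: Y(3) z2)
    have z4: "?S (\<lambda>a b c d. \<delta> b c * X a d * Y a b c d) = ?C X Y" for X by (subst swap12) (simp only: Y(1) z2)
    have z5: "?S (\<lambda>a b c d. \<delta> b d * X a c * Y a b c d) = ?C X Y" for X by (subst swap12) (simp only: Y(1) z3)
    have z6: "?S (\<lambda>a b c d. \<delta> c d * X a b * Y a b c d) = ?C X Y" for X by (subst swap23) (simp only: Y(2) z5)
    have eq: "Z v a b c d * Y a b c d = v a * v b * v c * v d * Y a b c d
      - \<alpha> * (\<delta> a b * (v c * v d) * Y a b c d) - \<alpha> * (\<delta> a c * (v b * v d) * Y a b c d) - \<alpha> * (\<delta> a d * (v b * v c) * Y a b c d)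
      - \<alpha> * (\<delta> b c * (v a * v d) * Y a b c d) - \<alpha> * (\<delta> b d * (v a * v c) * Y a b c d) - \<alpha> * (\<delta> c d * (v a * v b) * Y a b c d)
      + \<beta> * (\<delta> a b * \<delta> c d * Y a b c d) + \<beta> * (\<delta> a c * \<delta> b d * Y a b c d) + \<beta> * (\<delta> a d * \<delta> b c * Y a b c d)" for a b c d
      unfolding Z_def by (simp only: algebra_simps)
    show ?thesis
      unfolding eq sum.distrib sum_subtractf sum_distrib_left[symmetric] z1 z2 z3 z4 z5 z6 by simp
  qed
  have ip: "?S (\<lambda>a b c d. Z v a b c d * Z w a b c d) = P ^ 4 - 6 * \<alpha> * P\<^sup>2 + 3 * \<beta>"
    if vv: "(\<Sum>a\<in>?B. v a * v a) = 1" and ww: "(\<Sum>a\<in>?B. w a * w a) = 1"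
      and vw: "(\<Sum>a\<in>?B. v a * w a) = P" for v w P
  proof -
    let ?V = "\<lambda>a b c d. v a * v b * v c * v d"
    have "?S (\<lambda>a b c d. Z v a b c d * Z w a b c d) = ?S (\<lambda>a b c d. ?V a b c d * Z w a b c d)
        - 6 * \<alpha> * ?C (\<lambda>c d. v c * v d) (Z w) + 3 * \<beta> * ?C \<delta> (Z w)"
      by (rule expand) (rule perm)+
    \<comment> \<open>Both contractions vanish because \<open>Z w\<close> is traceless. Expanding
      the remaining factor \<open>Z w\<close> against the pure tensor of \<open>v\<close> leaves
      only powers of the inner product.\<close>
    also have "\<dots> = ?S (\<lambda>a b c d. ?V a b c d * Z w a b c d)" by (simp add: trace[OF ww])
    also have "\<dots> = ?S (\<lambda>a b c d. Z w a b c d * ?V a b c d)" by (simp only: mult.commute)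
    also have "\<dots> = ?S (\<lambda>a b c d. w a * w b * w c * w d * ?V a b c d) - 6 * \<alpha> * ?C (\<lambda>c d. w c * w d) ?V + 3 * \<beta> * ?C \<delta> ?V"
      by (rule expand) (simp_all add: mult_ac)
    also have "?S (\<lambda>a b c d. w a * w b * w c * w d * ?V a b c d)
        = ?S (\<lambda>a b c d. (v a * w a) * ((v b * w b) * ((v c * w c) * (v d * w d))))" by (simp only: mult_ac)
    also have "\<dots> = P ^ 4"
      by (simp only: sum_distrib_left[symmetric] sum_distrib_right[symmetric] vw) (simp add: power4_eq_xxxx)
    also have "?C (\<lambda>c d. w c * w d) ?V = (\<Sum>c\<in>?B. \<Sum>d\<in>?B. (v c * w c) * (v d * w d))"
      by (simp add: vv flip: sum_distrib_right) (simp only: mult_ac)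
    also have "\<dots> = P\<^sup>2"
      by (simp only: sum_distrib_left[symmetric] sum_distrib_right[symmetric] vw power2_eq_square)
    also have "?C \<delta> ?V = 1"
      by (simp add: \<delta>2 vv flip: sum_distrib_right)
    finally show ?thesis by simp
  qed
  let ?x = "\<lambda>i a. x i \<bullet> a"
  have "0 \<le> ?S (\<lambda>a b c d. (\<Sum>i\<in>I. Z (?x i) a b c d)\<^sup>2)" by (intro sum_nonneg) auto
  also have "\<dots> = ?S (\<lambda>a b c d. \<Sum>i\<in>I. \<Sum>j\<in>I. Z (?x i) a b c d * Z (?x j) a b c d)"
    by (simp add: power2_eq_square sum_product)
  also have "\<dots> = (\<Sum>i\<in>I. \<Sum>j\<in>I. ?S (\<lambda>a b c d. Z (?x i) a b c d * Z (?x j) a b c d))"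
    by (simp only: sum.swap[of _ I ?B])
  also have "\<dots> = (\<Sum>i\<in>I. \<Sum>j\<in>I. (x i \<bullet> x j) ^ 4 - 6 * \<alpha> * (x i \<bullet> x j)\<^sup>2 + 3 * \<beta>)"
  proof (intro sum.cong refl ip)
    show "(\<Sum>a\<in>?B. ?x i a * ?x i a) = 1" if "i \<in> I" for i
      using norm1[OF that] euclidean_inner[of "x i" "x i"] by (simp add: norm_eq_1)
    then show "(\<Sum>a\<in>?B. ?x j a * ?x j a) = 1" if "j \<in> I" for j using that by blast
    show "(\<Sum>a\<in>?B. ?x i a * ?x j a) = x i \<bullet> x j" for i j by (simp add: euclidean_inner[of "x i" "x j"])
  qed
  finally show ?thesis by (simp add: \<alpha>_def \<beta>_def)
qed

section \<open>Interpolation of the potential\<close>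

lemma MVT_within:
  fixes R R' :: "real \<Rightarrow> real"
  assumes R: "\<And>x. x \<in> {0..<1} \<Longrightarrow> (R has_real_derivative R' x) (at x within {0..<1})"
    and "0 \<le> a" "a < b" "b < 1"
  obtains z where "a < z" "z < b" "R b - R a = (b - a) * R' z"
proof -
  have at: "(R has_real_derivative R' x) (at x)" if "a < x" "x < b" for x
  proof -
    have "at x within {0..<1} = at x"
      using that assms by (intro at_within_interior) (simp add: interior_atLeastLessThan)
    then show ?thesis using R[of x] that assms by simp
  qed
  have "continuous_on {0..<1} R"
    using R by (intro continuous_on_eq_continuous_within[THEN iffD2] ballI DERIV_continuous)
  then have "continuous_on {a..b} R" by (rule continuous_on_subset) (use assms in auto)
  moreover have "R differentiable (at x)" if "a < x" "x < b" for x
    using at[OF that] real_differentiable_def by blast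
  ultimately obtain l z where z: "a < z" "z < b" "DERIV R z :> l" "R b - R a = (b - a) * l"
    using MVT[of a b R] \<open>a < b\<close> by blast
  then have "l = R' z" using at DERIV_unique by blast
  then show ?thesis using that z by blast
qed

lemma Rolle_within:
  fixes R R' :: "real \<Rightarrow> real"
  assumes R: "\<And>x. x \<in> {0..<1} \<Longrightarrow> (R has_real_derivative R' x) (at x within {0..<1})"
    and "0 \<le> a" "a < b" "b < 1" "R a = R b"
  obtains z where "a < z" "z < b" "R' z = 0"
  using MVT_within[OF R assms(2-4)] assms(3,5) by (metis cancel_comm_monoid_add_class.diff_cancel less_irrefl mult_eq_0_iff right_minus_eq)

text \<open>Hermite interpolation at 0 (simple) and \<open>c\<close> (double): the error is \<open>H3 \<xi> / 6 * s * (s - c)\<^sup>2\<close>.\<close>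

lemma hermite_lower_bound:
  fixes H H1 H2 H3 :: "real \<Rightarrow> real"
  assumes H: "\<And>x. x \<in> {0..<1} \<Longrightarrow> (H has_real_derivative H1 x) (at x within {0..<1})"
    and H1: "\<And>x. x \<in> {0..<1} \<Longrightarrow> (H1 has_real_derivative H2 x) (at x within {0..<1})"
    and H2: "\<And>x. x \<in> {0..<1} \<Longrightarrow> (H2 has_real_derivative H3 x) (at x within {0..<1})"
    and H3: "\<And>x. x \<in> {0..<1} \<Longrightarrow> H3 x \<ge> 0"
    and c: "0 < c" "c < 1" and s: "s \<in> {0..<1}"
  defines "D1 \<equiv> (H c - H 0) / c"
  defines "D2 \<equiv> (H1 c - D1) / c"
  shows "H 0 + D1 * s + D2 * (s * (s - c)) \<le> H s"
proof (cases "s = 0 \<or> s = c")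
  case True
  then show ?thesis using c by (auto simp: D1_def)
next
  case False
  let ?f = "\<lambda>x. H 0 + D1 * x + D2 * (x * (x - c))"
  \<comment> \<open>Chosen so that the remainder \<open>R\<close> vanishes at \<open>s\<close> as
    well. With its zero at 0 and its double zero at \<open>c\<close>, three rounds of Rolle's
    theorem give a zero of \<open>R3\<close>, hence the sign of \<open>K\<close>.\<close>
  define K where "K = (H s - ?f s) / (s * (s - c)\<^sup>2)"
  have den: "s * (s - c)\<^sup>2 > 0" using False s by auto
  define R where "R = (\<lambda>x. H x - ?f x - K * (x * (x - c)\<^sup>2))"
  define R1 where "R1 = (\<lambda>x. H1 x - D1 - D2 * (2 * x - c) - K * ((x - c)\<^sup>2 + 2 * x * (x - c)))"
  define R2 where "R2 = (\<lambda>x. H2 x - 2 * D2 - K * (6 * x - 4 * c))"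
  define R3 where "R3 = (\<lambda>x. H3 x - 6 * K)"
  have dR: "(R has_real_derivative R1 x) (at x within {0..<1})" if "x \<in> {0..<1}" for x
    unfolding R_def R1_def by (auto intro!: derivative_eq_intros H[OF that] simp: power2_eq_square algebra_simps)
  have dR1: "(R1 has_real_derivative R2 x) (at x within {0..<1})" if "x \<in> {0..<1}" for x
    unfolding R1_def R2_def by (auto intro!: derivative_eq_intros H1[OF that] simp: power2_eq_square algebra_simps)
  have dR2: "(R2 has_real_derivative R3 x) (at x within {0..<1})" if "x \<in> {0..<1}" for x
    unfolding R2_def R3_def by (auto intro!: derivative_eq_intros H2[OF that])
  have z: "R 0 = 0" "R c = 0" "R s = 0" "R1 c = 0"
  proof -
    show "R 0 = 0" by (simp add: R_def)
    show "R c = 0" using c by (simp add: R_def D1_def)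
    have "K * (s * (s - c)\<^sup>2) = H s - ?f s"
      unfolding K_def by (rule nonzero_eq_divide_eq[THEN iffD1, OF less_imp_neq[OF den, symmetric] refl])
    then show "R s = 0" by (simp add: R_def)
    show "R1 c = 0" using c by (simp add: R1_def D2_def)
  qed
  \<comment> \<open>Two of the three zeros of \<open>R1\<close> come from Rolle's theorem, the third
    is the double node \<open>c\<close>; its position among them depends on the side on which
    \<open>s\<close> lies.\<close>
  obtain p q r where pqr: "0 < p" "p < q" "q < r" "r < 1" "R1 p = 0" "R1 q = 0" "R1 r = 0"
  proof (cases "s < c")
    case True
    obtain p where "0 < p" "p < s" "R1 p = 0"
      by (rule Rolle_within[OF dR, of 0 s]) (use z s False in auto)
    moreover obtain q where "s < q" "q < c" "R1 q = 0"
      by (rule Rolle_within[OF dR, of s c]) (use z s c True in auto)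
    ultimately show ?thesis using that[of p q c] z c by auto
  next
    case sc: False
    obtain p where "0 < p" "p < c" "R1 p = 0"
      by (rule Rolle_within[OF dR, of 0 c]) (use z c in auto)
    moreover obtain r where "c < r" "r < s" "R1 r = 0"
      by (rule Rolle_within[OF dR, of c s]) (use z s c False sc in auto)
    ultimately show ?thesis using that[of p c r] z s by auto
  qed
  obtain p' where p': "p < p'" "p' < q" "R2 p' = 0"
    by (rule Rolle_within[OF dR1, of p q]) (use pqr in auto)
  obtain q' where q': "q < q'" "q' < r" "R2 q' = 0"
    by (rule Rolle_within[OF dR1, of q r]) (use pqr in auto)
  obtain \<xi> where \<xi>: "p' < \<xi>" "\<xi> < q'" "R3 \<xi> = 0"
    by (rule Rolle_within[OF dR2, of p' q']) (use pqr p' q' in auto)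
  have "K \<ge> 0" using H3[of \<xi>] \<xi> pqr p' q' by (simp add: R3_def)
  from mult_nonneg_nonneg[OF this less_imp_le[OF den]] have "K * (s * (s - c)\<^sup>2) \<ge> 0" .
  then show ?thesis using z(3) by (simp add: R_def)
qed

text \<open>The interpolant is in Newton form, so its coefficients are divided differences. The mean
  value theorem makes \<open>D1\<close> a value of the first derivative, and monotonicity of that
  derivative gives \<open>D2 \<ge> 0\<close>. These signs allow the two harmonic inequalities to be
  used separately.\<close>

lemma absolutely_monotone_lower_bound:
  assumes "absolutely_monotone h" and c: "0 < c" "c < 1"
  obtains D1 D2 where "D1 \<ge> 0" "D2 \<ge> 0"
    and "\<And>s. s \<in> {0..<1} \<Longrightarrow> h (- 1) + D1 * s + D2 * (s * (s - c)) \<le> h (2 * s - 1)"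
    and "h (2 * c - 1) = h (- 1) + D1 * c"
proof -
  obtain D where D0: "\<And>t. t \<in> {-1..<1} \<Longrightarrow> D 0 t = h t"
    and D: "\<And>j t. t \<in> {-1..<1} \<Longrightarrow> (D j has_real_derivative D (Suc j) t) (at t within {-1..<1})"
    and pos: "\<And>j t. t \<in> {-1..<1} \<Longrightarrow> D j t \<ge> 0"
    using assms(1) unfolding absolutely_monotone_def by blast
  define E where "E = (\<lambda>j s. 2 ^ j * D j (2 * s - 1) :: real)"
  have E: "(E j has_real_derivative E (Suc j) s) (at s within {0..<1})" if s: "s \<in> {0..<1}" for j s
  proof -
    have img: "(\<lambda>s. 2 * s - 1) ` {0..<1::real} \<subseteq> {-1..<1}" by auto
    have "(D j has_real_derivative D (Suc j) (2 * s - 1)) (at (2 * s - 1) within (\<lambda>s. 2 * s - 1) ` {0..<1})"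
      using s by (intro has_field_derivative_subset[OF D img]) auto
    moreover have "((\<lambda>s. 2 * s - 1) has_real_derivative 2) (at s within {0..<1})"
      by (auto intro!: derivative_eq_intros)
    ultimately have "(D j \<circ> (\<lambda>s. 2 * s - 1) has_real_derivative D (Suc j) (2 * s - 1) * 2) (at s within {0..<1})"
      by (rule DERIV_image_chain)
    from DERIV_cmult[OF this, of "2 ^ j"] show ?thesis by (simp add: E_def o_def mult_ac)
  qed
  have Epos: "E j s \<ge> 0" if "s \<in> {0..<1}" for j s
    using pos[of "2 * s - 1" j] that by (simp add: E_def)
  have E0: "E 0 s = h (2 * s - 1)" if "s \<in> {0..<1}" for s
    using D0[of "2 * s - 1"] that by (simp add: E_def)
  define D1 where "D1 = (E 0 c - E 0 0) / c"
  define D2 where "D2 = (E 1 c - D1) / c"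
  obtain z where z: "0 < z" "z < c" "E 0 c - E 0 0 = (c - 0) * E 1 z"
    by (rule MVT_within[of "E 0" "E 1" 0 c]) (use E[of _ 0] c in auto)
  have D1: "D1 = E 1 z" using z c by (simp add: D1_def)
  have mono: "E 1 z \<le> E 1 c"
  proof -
    obtain y where y: "z < y" "y < c" "E 1 c - E 1 z = (c - z) * E 2 y"
      by (rule MVT_within[of "E 1" "E 2" z c]) (use E[of _ 1] z c in \<open>auto simp: numeral_2_eq_2\<close>)
    then have "E 2 y \<ge> 0" using z c by (intro Epos) auto
    then have "(c - z) * E 2 y \<ge> 0" using z by simp
    then show ?thesis using y by simp
  qed
  show ?thesis
  proof (rule that)
    show "D1 \<ge> 0" unfolding D1 using z c by (intro Epos) auto
    show "D2 \<ge> 0" using mono c by (simp add: D2_def D1)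
    show "h (- 1) + D1 * s + D2 * (s * (s - c)) \<le> h (2 * s - 1)" if s: "s \<in> {0..<1}" for s
    proof -
      have "E 0 0 + D1 * s + D2 * (s * (s - c)) \<le> E 0 s"
        unfolding D1_def D2_def
        by (rule hermite_lower_bound[of "E 0" "E 1" "E 2" "E 3"])
          (use E[of _ 0] E[of _ 1] E[of _ 2] Epos c s in \<open>auto simp: eval_nat_numeral\<close>)
      then show ?thesis using E0[of 0] E0[OF s] by simp
    qed
    show "h (2 * c - 1) = h (- 1) + D1 * c"
      using E0[of 0] E0[of c] c by (simp add: D1_def)
  qed
qed

section \<open>Energies of line configurations\<close>

lemma span_singleton_minus: "span {- x} = span {x :: 'a::real_vector}"
proof (intro subset_antisym span_minimal subspace_span)
  show "{- x} \<subseteq> span {x}" by (simp add: span_base span_neg)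
  show "{x} \<subseteq> span {- x}" using span_neg[OF span_base[of "- x" "{- x}"]] by simp
qed

lemma line_configuration_inner:
  fixes x :: "nat \<Rightarrow> 'a::euclidean_space"
  assumes "line_configuration N x" "i < N" "j < N" "i \<noteq> j"
  shows "(x i \<bullet> x j)\<^sup>2 \<in> {0..<1}"
proof -
  have n: "x i \<bullet> x i = 1" "x j \<bullet> x j = 1"
    using assms by (auto simp: line_configuration_def norm_eq_1)
  have ne: "span {x i} \<noteq> span {x j}" using assms by (auto simp: line_configuration_def inj_on_def)
  have "\<bar>x i \<bullet> x j\<bar> \<le> 1" using Cauchy_Schwarz_ineq2[of "x i" "x j"] n by (simp add: norm_eq_1[symmetric])
  moreover have "x i \<bullet> x j \<noteq> 1"
  proof
    assume "x i \<bullet> x j = 1"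
    then have "(x i - x j) \<bullet> (x i - x j) = 0" using n by (simp add: inner_diff_left inner_diff_right inner_commute)
    then show False using ne by simp
  qed
  moreover have "x i \<bullet> x j \<noteq> - 1"
  proof
    assume "x i \<bullet> x j = - 1"
    then have "(x i + x j) \<bullet> (x i + x j) = 0" using n by (simp add: inner_add_left inner_add_right inner_commute)
    then have "x i = - x j" by (simp add: add_eq_0_iff2)
    then show False using ne by (simp add: span_singleton_minus)
  qed
  ultimately have "\<bar>x i \<bullet> x j\<bar> < 1" by linarith
  then show ?thesis by (simp add: abs_square_less_1)
qed

text \<open>The interpolant at 0 and 1/9 agrees with the potential at both squared cosines of
  \<open>x\<close> and minorises it for any competitor. Its energy depends only on the sums of
  squared cosines and of their squares, which the harmonics of degrees 2 and 4 bound from below by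
  the values of \<open>x\<close>.\<close>

lemma two_distance_lines_optimal:
  fixes x :: "nat \<Rightarrow> 'a::euclidean_space"
  assumes dim: "DIM('a) = 22" and x: "line_configuration 1408 x"
    and two: "\<And>i j. i < 1408 \<Longrightarrow> j < 1408 \<Longrightarrow> i \<noteq> j \<Longrightarrow> (x i \<bullet> x j)\<^sup>2 \<in> {0, 1 / 9}"
    and count: "\<And>i. i < 1408 \<Longrightarrow> card {j \<in> {..<1408} - {i}. (x i \<bullet> x j)\<^sup>2 = 1 / 9} = 567"
    and h: "absolutely_monotone h" and y: "line_configuration 1408 (y :: nat \<Rightarrow> 'a)"
  shows "projective_energy h 1408 x \<le> projective_energy h 1408 y"
proof -
  let ?N = "1408 :: nat"
  obtain D1 D2 where D: "D1 \<ge> 0" "D2 \<ge> 0"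
    and low: "\<And>s. s \<in> {0..<1} \<Longrightarrow> h (- 1) + D1 * s + D2 * (s * (s - 1/9)) \<le> h (2 * s - 1)"
    and hc: "h (2 * (1/9) - 1) = h (- 1) + D1 * (1/9)"
    by (rule absolutely_monotone_lower_bound[OF h, of "1/9"]) auto
  let ?f = "\<lambda>s. h (- 1) + D1 * s + D2 * (s * (s - 1/9))"
  have ex: "projective_energy h ?N x = 1408 * (1407 * h (- 1) + 63 * D1)"
  proof -
    have "(\<Sum>j\<in>{..<?N} - {i}. h (2 * (x i \<bullet> x j)\<^sup>2 - 1)) = 1407 * h (- 1) + 63 * D1" if i: "i < ?N" for i
    proof -
      let ?J = "{j \<in> {..<?N} - {i}. (x i \<bullet> x j)\<^sup>2 = 1 / 9}"
      have "h (2 * (x i \<bullet> x j)\<^sup>2 - 1) = h (- 1) + (if j \<in> ?J then D1 / 9 else 0)" if "j \<in> {..<?N} - {i}" for j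
      proof (cases "(x i \<bullet> x j)\<^sup>2 = 1 / 9")
        case True
        have "h (2 * (x i \<bullet> x j)\<^sup>2 - 1) = h (- 1) + D1 / 9" unfolding True using hc by simp
        moreover have "j \<in> ?J" using that True by simp
        ultimately show ?thesis by simp
      next
        case False
        then show ?thesis using two[of i j] i that by auto
      qed
      then have "(\<Sum>j\<in>{..<?N} - {i}. h (2 * (x i \<bullet> x j)\<^sup>2 - 1))
          = (\<Sum>j\<in>{..<?N} - {i}. h (- 1) + (if j \<in> ?J then D1 / 9 else 0))"
        by (rule sum.cong[OF refl])
      also have "\<dots> = 1407 * h (- 1) + (\<Sum>j\<in>{..<?N} - {i}. if j \<in> ?J then D1 / 9 else 0)"
        using i by (simp add: sum.distrib)
      also have "(\<Sum>j\<in>{..<?N} - {i}. if j \<in> ?J then D1 / 9 else 0) = (\<Sum>j\<in>?J. D1 / 9)"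
        by (rule sum.mono_neutral_cong_right) auto
      also have "\<dots> = 63 * D1" using count[OF i] by simp
      finally show ?thesis .
    qed
    then show ?thesis by (simp add: projective_energy_def)
  qed
  define s where "s = (\<lambda>i j. (y i \<bullet> y j)\<^sup>2)"
  have n1: "norm (y i) = 1" if "i \<in> {..<?N}" for i using y that by (simp add: line_configuration_def)
  define T1 where "T1 = (\<Sum>i<?N. \<Sum>j<?N. s i j)"
  define T2 where "T2 = (\<Sum>i<?N. \<Sum>j<?N. (s i j)\<^sup>2)"
  have g2: "T1 \<ge> 1408 * 64"
    using gegenbauer_2_nonneg[of "{..<?N}" y] n1 by (simp add: dim s_def T1_def sum_subtractf)
  have g4: "T2 \<ge> 3 / 13 * T1 - 1408 * (1408 / 208)"
  proof -
    have "(\<Sum>i<?N. \<Sum>j<?N. (y i \<bullet> y j) ^ 4 - 6 / (real DIM('a) + 4) * (y i \<bullet> y j)\<^sup>2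
        + 3 / ((real DIM('a) + 2) * (real DIM('a) + 4))) \<ge> 0"
      by (rule gegenbauer_4_nonneg) (rule n1)
    also have "(\<Sum>i<?N. \<Sum>j<?N. (y i \<bullet> y j) ^ 4 - 6 / (real DIM('a) + 4) * (y i \<bullet> y j)\<^sup>2
        + 3 / ((real DIM('a) + 2) * (real DIM('a) + 4))) = T2 - 3 / 13 * T1 + 1408 * (1408 / 208)"
      by (simp add: dim sum.distrib sum_subtractf T1_def T2_def s_def flip: sum_distrib_left sum_divide_distrib power_mult)
    finally show ?thesis by simp
  qed
  have "1408 * (1407 * h (- 1) + 63 * D1) \<le> (\<Sum>i<?N. \<Sum>j<?N. ?f (s i j)) - 1408 * ?f 1"
  proof -
    have "(\<Sum>i<?N. \<Sum>j<?N. ?f (s i j)) = (\<Sum>i<?N. \<Sum>j<?N. h (- 1) + (D1 - D2 / 9) * s i j + D2 * (s i j)\<^sup>2)"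
      by (intro sum.cong refl) (simp add: power2_eq_square algebra_simps)
    also have "\<dots> = 1408 * 1408 * h (- 1) + (D1 - D2 / 9) * T1 + D2 * T2"
      by (simp add: sum.distrib T1_def T2_def flip: sum_distrib_left)
    finally have e: "(\<Sum>i<?N. \<Sum>j<?N. ?f (s i j)) = 1408 * 1408 * h (- 1) + D1 * T1 + D2 * (T2 - T1 / 9)"
      by (simp add: algebra_simps)
    have "D1 * T1 \<ge> D1 * (1408 * 64)" using g2 D by (intro mult_left_mono)
    \<comment> \<open>The coefficient 3/13 - 1/9 of \<open>T1\<close> is positive, so
      \<open>g2\<close> applies after \<open>g4\<close>; per line, (3/13) * 64 - 1408/208 - 64/9 =
      8/9. This is exactly the diagonal term 1 - 1/9 subtracted with \<open>?f 1\<close>.\<close>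
    moreover have "D2 * (T2 - T1 / 9) \<ge> D2 * (1408 * (8 / 9))"
      using g2 g4 D by (intro mult_left_mono) auto
    ultimately show ?thesis unfolding e by (simp add: algebra_simps)
  qed
  also have "\<dots> = (\<Sum>i<?N. (\<Sum>j<?N. ?f (s i j)) - ?f 1)" by (simp add: sum_subtractf)
  also have "\<dots> = (\<Sum>i<?N. \<Sum>j\<in>{..<?N} - {i}. ?f (s i j))"
  proof (rule sum.cong[OF refl])
    fix i assume "i \<in> {..<?N}"
    moreover then have "s i i = 1" using n1[of i] by (simp add: s_def norm_eq_1)
    ultimately show "(\<Sum>j<?N. ?f (s i j)) - ?f 1 = (\<Sum>j\<in>{..<?N} - {i}. ?f (s i j))"
      by (subst sum.remove[of _ i]) auto
  qed
  also have "\<dots> \<le> (\<Sum>i<?N. \<Sum>j\<in>{..<?N} - {i}. h (2 * s i j - 1))"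
  proof (intro sum_mono)
    fix i j assume "i \<in> {..<?N}" "j \<in> {..<?N} - {i}"
    then have "s i j \<in> {0..<1}" unfolding s_def by (intro line_configuration_inner[OF y]) auto
    then show "?f (s i j) \<le> h (2 * s i j - 1)" by (rule low)
  qed
  also have "\<dots> = projective_energy h ?N y" by (simp add: projective_energy_def s_def)
  finally show ?thesis unfolding ex .
qed

lemma span_singleton_eq_unit:
  fixes x y :: "'a::real_inner"
  assumes "norm x = 1" "norm y = 1"
  shows "span {x} = span {y} \<longleftrightarrow> x = y \<or> x = - y"
proof
  assume "span {x} = span {y}"
  then have "x \<in> span {y}" using span_base[of x "{x}"] by auto
  then obtain k where k: "x = k *\<^sub>R y" by (auto simp: span_singleton)
  then have "\<bar>k\<bar> = 1" using assms by simp
  then show "x = y \<or> x = - y" using k by (auto simp: abs_if split: if_splits)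
next
  assume "x = y \<or> x = - y"
  then show "span {x} = span {y}" by (auto simp: span_singleton_minus)
qed

text \<open>Every line meets the code in one antipodal pair, so choosing a representative per line
  halves each count of an even function: 2816 to 1408 and 1134 to 567.\<close>

lemma antipodal_code_optimal:
  fixes C :: "'a::euclidean_space set"
  assumes dim: "DIM('a) = 22" and C: "card C = 2816" "\<And>x. x \<in> C \<Longrightarrow> norm x = 1" "\<And>x. x \<in> C \<Longrightarrow> - x \<in> C"
    and ip: "\<And>x z. x \<in> C \<Longrightarrow> z \<in> C \<Longrightarrow> x \<bullet> z \<in> {- 1, - 1/3, 0, 1/3, 1}"
    and count: "\<And>x. x \<in> C \<Longrightarrow> card {z \<in> C. (x \<bullet> z)\<^sup>2 = 1/9} = 1134"
  shows "card ((\<lambda>x. span {x}) ` C) = 1408" "universally_optimal_lines ((\<lambda>x. span {x}) ` C)"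
proof -
  let ?l = "\<lambda>x::'a. span {x}"
  let ?T = "?l ` C"
  have fin: "finite C" using C(1) by (metis card.infinite zero_neq_numeral)
  have nonzero: "x \<noteq> - x" if "x \<in> C" for x
  proof
    assume "x = - x"
    then have "x \<bullet> x = (- x) \<bullet> x" by simp
    then show False using C(2)[OF that] by (simp add: norm_eq_1)
  qed
  have fiber: "{z \<in> C. ?l z = ?l x} = {x, - x}" if "x \<in> C" for x
    using that C span_singleton_eq_unit by blast
  obtain rep where rep: "\<And>l. l \<in> ?T \<Longrightarrow> rep l \<in> C \<and> ?l (rep l) = l"
    using bchoice[of ?T "\<lambda>l x. x \<in> C \<and> ?l x = l"] by blast
  have double: "(\<Sum>z\<in>C. g z) = 2 * (\<Sum>l\<in>?T. g (rep l))" if "\<And>z. g (- z) = g z" for g :: "'a \<Rightarrow> nat"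
  proof -
    have "(\<Sum>z\<in>C. g z) = (\<Sum>l\<in>?T. \<Sum>z\<in>{z \<in> C. ?l z = l}. g z)"
      using sum.group[OF fin, of ?T ?l g] fin by simp
    also have "\<dots> = (\<Sum>l\<in>?T. 2 * g (rep l))"
    proof (rule sum.cong[OF refl])
      fix l assume "l \<in> ?T"
      then have r: "rep l \<in> C" "?l (rep l) = l" using rep by auto
      then have "{z \<in> C. ?l z = l} = {rep l, - rep l}" using fiber[OF r(1)] by simp
      then show "(\<Sum>z\<in>{z \<in> C. ?l z = l}. g z) = 2 * g (rep l)"
        using nonzero[OF r(1)] that by simp
    qed
    finally show ?thesis by (simp add: sum_distrib_left)
  qed
  show card: "card ?T = 1408"
    using double[of "\<lambda>_. 1"] C(1) by simp
  have "finite ?T" using fin by simp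
  then obtain e where e: "bij_betw e {..<1408::nat} ?T"
    using ex_bij_betw_nat_finite[of ?T] card by (auto simp: atLeast0LessThan)
  define x where "x = (\<lambda>i. rep (e i))"
  have xC: "x i \<in> C" "?l (x i) = e i" if "i < 1408" for i
    using rep[of "e i"] bij_betwE[OF e] that by (auto simp: x_def)
  have lc: "line_configuration 1408 x"
    unfolding line_configuration_def
  proof
    show "\<forall>i<1408. norm (x i) = 1" using xC C(2) by blast
    show "inj_on (\<lambda>i. ?l (x i)) {..<1408}"
      using bij_betw_imp_inj_on[OF e] xC(2) by (auto simp: inj_on_def)
  qed
  have B: "?T = (\<lambda>i. ?l (x i)) ` {..<1408}"
    using bij_betw_imp_surj_on[OF e] xC(2) by (auto simp: image_iff)
  have two: "(x i \<bullet> x j)\<^sup>2 \<in> {0, 1 / 9}" if "i < 1408" "j < 1408" "i \<noteq> j" for i j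
  proof -
    have "(x i \<bullet> x j)\<^sup>2 \<in> {0..<1}" by (rule line_configuration_inner[OF lc that])
    moreover from ip[OF xC(1)[OF that(1)] xC(1)[OF that(2)]]
    have "(x i \<bullet> x j)\<^sup>2 \<in> power2 ` {- 1, - 1/3, 0, 1/3, 1}" by (rule imageI)
    ultimately show ?thesis by (simp add: power_divide) auto
  qed
  have cnt: "card {j \<in> {..<1408} - {i}. (x i \<bullet> x j)\<^sup>2 = 1 / 9} = 567" if i: "i < 1408" for i
  proof -
    let ?g = "\<lambda>z. if (x i \<bullet> z)\<^sup>2 = 1/9 then 1 else 0 :: nat"
    have "1134 = (\<Sum>z\<in>C. ?g z)"
      using count[OF xC(1)[OF i]] fin by (simp add: sum.If_cases Int_def)
    also have "\<dots> = 2 * (\<Sum>l\<in>?T. ?g (rep l))" by (rule double) simp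
    also have "(\<Sum>l\<in>?T. ?g (rep l)) = (\<Sum>j<1408. ?g (x j))"
      unfolding x_def by (rule sum.reindex_bij_betw[OF e, symmetric])
    also have "\<dots> = card {j \<in> {..<1408}. (x i \<bullet> x j)\<^sup>2 = 1/9}"
      by (simp add: sum.If_cases Int_def)
    also have "{j \<in> {..<1408}. (x i \<bullet> x j)\<^sup>2 = 1/9} = {j \<in> {..<1408} - {i}. (x i \<bullet> x j)\<^sup>2 = 1 / 9}"
      using C(2)[OF xC(1)[OF i]] by (auto simp: norm_eq_1)
    finally show ?thesis by simp
  qed
  show "universally_optimal_lines ?T"
    unfolding universally_optimal_lines_def
    using lc B two_distance_lines_optimal[OF dim lc two cnt] by blast
qed

section \<open>The code of 1408 lines\<close>

context even_unimodular_24 begin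

text \<open>The zonal identity for each \<open>k\<close> expresses the moment of degree 2k through
  the lower ones, so the four moments are solved for successively.\<close>

lemma shell_moments:
  assumes "shell L 1 = {}"
  defines "N \<equiv> real (card (shell L 2))"
  shows "moment v 2 2 = N * (v \<bullet> v) / 6" "moment v 4 2 = N * (v \<bullet> v) ^ 2 / 13"
    "moment v 6 2 = N * (v \<bullet> v) ^ 3 * (5 / 91)" "moment v 8 2 = N * (v \<bullet> v) ^ 4 * (2 / 39)"
proof -
  have s: "{..1::nat} = {0, 1}" "{..2::nat} = {0, 1, 2}" "{..3::nat} = {0, 1, 2, 3}" "{..4::nat} = {0, 1, 2, 3, 4}"
    by auto
  have N: "moment v 0 2 = N" by (simp add: moment_def N_def)
  show m2: "moment v 2 2 = N * (v \<bullet> v) / 6"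
    using zonal_moment_identity[OF assms(1), of 1 v] by (simp add: s fact_numeral N field_simps flip: numeral_2_eq_2)
  show m4: "moment v 4 2 = N * (v \<bullet> v) ^ 2 / 13"
    using zonal_moment_identity[OF assms(1), of 2 v] by (simp add: s fact_numeral N m2 power2_eq_square field_simps flip: numeral_2_eq_2)
  show m6: "moment v 6 2 = N * (v \<bullet> v) ^ 3 * (5 / 91)"
    using zonal_moment_identity[OF assms(1), of 3 v] by (simp add: s fact_numeral N m2 m4 power2_eq_square power3_eq_cube field_simps flip: numeral_2_eq_2)
  show "moment v 8 2 = N * (v \<bullet> v) ^ 4 * (2 / 39)"
    using zonal_moment_identity[OF assms(1), of 4 v] by (simp add: s fact_numeral N m2 m4 m6 power2_eq_square power3_eq_cube power4_eq_xxxx field_simps flip: numeral_2_eq_2)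
qed

text \<open>Inner products are integers bounded by 4 in absolute value; 3 and -3 are impossible
  because \<open>x - y\<close> or \<open>x + y\<close> would be a lattice vector of squared length
  2.\<close>

lemma leech_shell_2:
  assumes no_roots: "shell L 1 = {}"
  shows "leech_shell (shell L 2)"
proof
  have nS: "x \<bullet> x = 4" if "x \<in> shell L 2" for x
    using that unfolding shell_def power2_norm_eq_inner by simp
  have LS: "x \<in> L" if "x \<in> shell L 2" for x using that by (simp add: shell_def)
  have S1: "x \<bullet> x \<noteq> 2" if "x \<in> L" for x
    using no_roots that by (auto simp: shell_def power2_norm_eq_inner)
  show "finite (shell L 2)" by (rule finite_shell)
  show "x \<bullet> x = 4" if "x \<in> shell L 2" for x by (rule nS[OF that])
  show "- x \<in> shell L 2" if "x \<in> shell L 2" for x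
    using that uminus_in_L by (simp add: shell_def)
  show "x - y \<in> shell L 2" if "x \<in> shell L 2" "y \<in> shell L 2" "x \<bullet> y = 2" for x y
  proof -
    have "(x - y) \<bullet> (x - y) = 4"
      using nS[OF that(1)] nS[OF that(2)] that(3) by (simp add: inner_diff_left inner_diff_right inner_commute[of y x])
    moreover have "x - y \<in> L" using diff_in_L LS that by blast
    ultimately show ?thesis by (simp add: shell_def power2_norm_eq_inner)
  qed
  show "x \<bullet> y \<in> {-4, -2, -1, 0, 1, 2, 4}" if x: "x \<in> shell L 2" and y: "y \<in> shell L 2" for x y
  proof -
    obtain k where k: "x \<bullet> y = of_int k" using inner_Ints[OF LS[OF x] LS[OF y]] Ints_cases by blast
    have "norm x = 2" "norm y = 2" using nS[OF x] nS[OF y] by (simp_all add: norm_eq_sqrt_inner)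
    then have "\<bar>x \<bullet> y\<bar> \<le> 4" using Cauchy_Schwarz_ineq2[of x y] by simp
    then have "- 4 \<le> k" "k \<le> 4" using k by linarith+
    moreover have "k \<noteq> 3"
    proof
      assume "k = 3"
      then have "(x - y) \<bullet> (x - y) = 2"
        using nS[OF x] nS[OF y] k by (simp add: inner_diff_left inner_diff_right inner_commute[of y x])
      then show False using S1 diff_in_L LS x y by blast
    qed
    moreover have "k \<noteq> - 3"
    proof
      assume "k = - 3"
      then have "(x + y) \<bullet> (x + y) = 2"
        using nS[OF x] nS[OF y] k by (simp add: inner_add_left inner_add_right inner_commute[of y x])
      then show False using S1 add_in_L LS x y by blast
    qed
    ultimately have "k \<in> {-4, -2, -1, 0, 1, 2, 4}" by auto
    then show ?thesis unfolding k by auto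
  qed
qed (use shell_moments[OF no_roots] in \<open>simp_all add: moment_def\<close>)

end

lemma orthogonal_comp_span_pair:
  "x \<in> (span {A, u})\<^sup>\<bottom> \<longleftrightarrow> x \<bullet> A = 0 \<and> x \<bullet> u = 0"
proof
  assume "x \<in> (span {A, u})\<^sup>\<bottom>"
  then show "x \<bullet> A = 0 \<and> x \<bullet> u = 0"
    by (auto simp: orthogonal_comp_def orthogonal_def inner_commute span_base)
next
  assume *: "x \<bullet> A = 0 \<and> x \<bullet> u = 0"
  have "orthogonal x y" if "y \<in> span {A, u}" for y
    by (rule orthogonal_to_span[OF that]) (use * in \<open>auto simp: orthogonal_def\<close>)
  then show "x \<in> (span {A, u})\<^sup>\<bottom>"
    by (auto simp: orthogonal_comp_def orthogonal_commute)
qed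

lemma orth_proj_eqI:
  assumes "subspace W" "p \<in> W" "x - p \<in> W\<^sup>\<bottom>"
  shows "orth_proj W x = p"
  unfolding orth_proj_def
proof (rule the_equality)
  fix q assume q: "q \<in> W \<and> x - q \<in> W\<^sup>\<bottom>"
  have "q - p \<in> W" using q assms by (simp add: subspace_diff)
  moreover have "(x - p) - (x - q) \<in> W\<^sup>\<bottom>"
    by (rule subspace_diff[OF subspace_orthogonal_comp]) (use q assms in auto)
  then have "q - p \<in> W\<^sup>\<bottom>" by simp
  ultimately have "orthogonal (q - p) (q - p)" by (auto simp: orthogonal_comp_def)
  then show "q = p" by (simp add: orthogonal_def)
qed (use assms in auto)

text \<open>Polarization inside \<open>V\<close>: norms are preserved only there, and closure of
  \<open>V\<close> under addition suffices.\<close>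

lemma linear_isometry_on_inner:
  assumes "linear \<phi>" "subspace V" "\<forall>x\<in>V. norm (\<phi> x) = norm x" "x \<in> V" "y \<in> V"
  shows "\<phi> x \<bullet> \<phi> y = x \<bullet> y"
proof -
  have n: "\<phi> z \<bullet> \<phi> z = z \<bullet> z" if "z \<in> V" for z
    using assms(3) that by (metis power2_norm_eq_inner)
  have "x + y \<in> V" using assms subspace_add by blast
  from n[OF this] n[OF assms(4)] n[OF assms(5)] show ?thesis
    by (simp add: linear_add[OF assms(1)] inner_add_left inner_add_right inner_commute)
qed

theorem theorem6p1:
  fixes \<Lambda> :: "(real^24) set"
    and A u :: "real^24"
    and A\<^sub>2 A\<^sub>2_hat W :: "(real^24) set"
    and \<phi> :: "real^24 \<Rightarrow> real^22"
    and B\<^sub>1\<^sub>4\<^sub>0\<^sub>8 :: "(real^22) set set"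
  assumes "is_Leech_lattice \<Lambda>"
    and "A \<in> shell \<Lambda> 2" and "u \<in> shell \<Lambda> 2" and "A \<bullet> u = 2"
    and "A\<^sub>2 = {y \<in> shell \<Lambda> 2. y \<bullet> A = 2 \<and> y \<bullet> u = 1}"
    and "W = span {A, u}"
    and "A\<^sub>2_hat = normal_part W ` A\<^sub>2"
    and "linear \<phi>" and "\<forall>x\<in>W\<^sup>\<bottom>. norm (\<phi> x) = norm x" and "\<phi> ` (W\<^sup>\<bottom>) = UNIV"
    and "B\<^sub>1\<^sub>4\<^sub>0\<^sub>8 = (\<lambda>x. span {\<phi> x}) ` A\<^sub>2_hat"
  shows "card A\<^sub>2_hat = 2816 \<and> uminus ` A\<^sub>2_hat = A\<^sub>2_hat \<and> card B\<^sub>1\<^sub>4\<^sub>0\<^sub>8 = 1408 \<and>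
         universally_optimal_lines B\<^sub>1\<^sub>4\<^sub>0\<^sub>8"
proof -
  have unimod: "even_unimodular_lattice \<Lambda>" and no2: "\<And>x. x \<in> \<Lambda> \<Longrightarrow> x \<bullet> x \<noteq> 2"
    using assms(1) by (auto simp: is_Leech_lattice_def)
  obtain M d where Md: "unimodular_basis M d" "unimodular_basis.L d = \<Lambda>"
    by (rule even_unimodular_basis[OF unimod])
  interpret even_unimodular_24 M d
  proof (intro even_unimodular_24.intro even_unimodular_24_axioms.intro Md(1))
    show "CARD(24) = 24" by simp
    show "\<exists>k::int. x \<bullet> x = 2 * of_int k" if "x \<in> unimodular_basis.L d" for x
      using that unimod by (simp add: Md(2) even_unimodular_lattice_def)
  qed
  have "shell L 1 = {}"
    using no2 by (auto simp: Md(2) shell_def power2_norm_eq_inner)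
  then interpret leech_shell "shell \<Lambda> 2" using leech_shell_2 by (simp add: Md(2))
  note Au = assms(2-4)
  have A2: "A\<^sub>2 = A2 A u" by (simp add: assms(5) A2_def[OF Au])
  note A2_in = A2_S[OF Au]
  have mem: "y \<bullet> y = 4" "y \<bullet> A = 2" "y \<bullet> u = 1" if "y \<in> A\<^sub>2" for y
    using that norm_S by (auto simp: assms(5))
  have AA: "A \<bullet> A = 4" using norm_S assms(2) by blast
  \<comment> \<open>Half of \<open>A\<close> has the inner products 2 with \<open>A\<close> and 1
    with \<open>u\<close>, just like every vector of the code, so it is their common projection to
    \<open>W\<close>. The difference has squared norm 4 - 1 = 3.\<close>
  define c where "c = (\<lambda>y. y - (1/2) *\<^sub>R A)"
  have cperp: "c y \<in> W\<^sup>\<bottom>" if "y \<in> A\<^sub>2" for y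
    using mem[OF that] AA assms(4)
    by (simp add: assms(6) orthogonal_comp_span_pair c_def inner_diff_left)
  have cc: "c y \<bullet> c z = y \<bullet> z - 1" if "y \<in> A\<^sub>2" "z \<in> A\<^sub>2" for y z
    using mem[OF that(1)] mem[OF that(2)] AA
    by (simp add: c_def inner_diff_left inner_diff_right inner_commute)
  define hat where "hat = (\<lambda>y. c y /\<^sub>R sqrt 3)"
  have np: "normal_part W y = hat y" if y: "y \<in> A\<^sub>2" for y
  proof -
    have "orth_proj W y = (1/2) *\<^sub>R A"
      using cperp[OF y] by (intro orth_proj_eqI) (auto simp: assms(6) c_def span_base span_scale)
    moreover have "norm (c y) = sqrt 3" using cc[OF y y] mem[OF y] by (simp add: norm_eq_sqrt_inner)
    ultimately show ?thesis by (simp add: normal_part_def hat_def c_def)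
  qed
  have hat_img: "A\<^sub>2_hat = hat ` A\<^sub>2" using np by (simp add: assms(7) cong: image_cong)
  have refl: "A - y \<in> A\<^sub>2" if "y \<in> A\<^sub>2" for y using A2_reflect[OF Au] that by (simp add: A2)
  have hat_refl: "hat (A - y) = - hat y" for y
  proof -
    have "c (A - y) = - c y" by (simp add: c_def algebra_simps flip: scaleR_left_distrib)
    then show ?thesis by (simp add: hat_def)
  qed
  have perp: "subspace (W\<^sup>\<bottom>)" by (rule subspace_orthogonal_comp)
  have hat_perp: "hat y \<in> W\<^sup>\<bottom>" if "y \<in> A\<^sub>2" for y
    unfolding hat_def by (intro subspace_scale[OF perp] cperp that)
  define f where "f = (\<lambda>y. \<phi> (hat y))"
  have ff: "f y \<bullet> f z = (y \<bullet> z - 1) / 3" if "y \<in> A\<^sub>2" "z \<in> A\<^sub>2" for y z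
  proof -
    have "f y \<bullet> f z = hat y \<bullet> hat z"
      unfolding f_def by (rule linear_isometry_on_inner[OF assms(8) perp assms(9) hat_perp[OF that(1)] hat_perp[OF that(2)]])
    also have "\<dots> = (c y \<bullet> c z) / 3" by (simp add: hat_def field_simps)
    finally show ?thesis using cc[OF that] by simp
  qed
  \<comment> \<open>Equal images have inner product 1, hence \<open>y \<bullet> z = 4\<close>, which
    forces equality among minimal vectors.\<close>
  have inj_f: "inj_on f A\<^sub>2"
  proof (rule inj_onI)
    fix y z assume yz: "y \<in> A\<^sub>2" "z \<in> A\<^sub>2" "f y = f z"
    then have "(y \<bullet> z - 1) / 3 = 1" using ff[of y z] ff[of y y] mem[of y] by simp
    then show "y = z" using inner_4[of y z] yz A2_in by (simp add: A2)
  qed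
  then have "inj_on hat A\<^sub>2" unfolding f_def inj_on_def by metis
  then have card_hat: "card A\<^sub>2_hat = 2816"
    using card_A2[OF Au] by (simp add: hat_img card_image A2)
  have anti: "uminus ` A\<^sub>2_hat = A\<^sub>2_hat"
  proof -
    have sub: "uminus ` A\<^sub>2_hat \<subseteq> A\<^sub>2_hat"
      unfolding hat_img using refl hat_refl by (auto simp: image_iff) metis
    then have "uminus ` (uminus ` A\<^sub>2_hat) \<subseteq> uminus ` A\<^sub>2_hat" by (rule image_mono)
    then show ?thesis using sub by (simp add: image_image)
  qed
  let ?C = "f ` A\<^sub>2"
  have B: "B\<^sub>1\<^sub>4\<^sub>0\<^sub>8 = (\<lambda>x. span {x}) ` ?C"
    by (simp add: assms(11) hat_img image_image f_def)
  have code: "card ((\<lambda>x. span {x}) ` ?C) = 1408 \<and> universally_optimal_lines ((\<lambda>x. span {x}) ` ?C)"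
  proof -
    have h1: "DIM(real^22) = 22" by simp
    have h2: "card ?C = 2816" using card_A2[OF Au] inj_f by (simp add: card_image A2)
    have h3: "norm x = 1" if x: "x \<in> ?C" for x
    proof -
      obtain y where "y \<in> A\<^sub>2" "x = f y" using x by blast
      then show ?thesis using ff[of y y] mem[of y] by (simp add: norm_eq_1)
    qed
    have h4: "- x \<in> ?C" if x: "x \<in> ?C" for x
    proof -
      obtain y where y: "y \<in> A\<^sub>2" "x = f y" using x by blast
      then have "- x = f (A - y)" by (simp add: f_def hat_refl linear_neg[OF assms(8)])
      then show ?thesis using refl y by blast
    qed
    \<comment> \<open>The map q \<mapsto> (q - 1)/3 sends the five possible inner products within
      \<open>A2\<close> to these cosines.\<close>
    have h5: "x \<bullet> z \<in> {- 1, - 1/3, 0, 1/3, 1}" if xz: "x \<in> ?C" "z \<in> ?C" for x z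
    proof -
      obtain y w where "y \<in> A\<^sub>2" "w \<in> A\<^sub>2" "x = f y" "z = f w" using xz by blast
      moreover from this have "y \<bullet> w \<in> {-2, 0, 1, 2, 4}" using A2_inner[OF Au] by (simp add: A2)
      ultimately show ?thesis using ff[of y w] by auto
    qed
    have h6: "card {z \<in> ?C. (x \<bullet> z)\<^sup>2 = 1/9} = 1134" if x: "x \<in> ?C" for x
    proof -
      obtain y where y: "y \<in> A\<^sub>2" "x = f y" using x by blast
      have "(x \<bullet> f w)\<^sup>2 = 1/9 \<longleftrightarrow> w \<bullet> y = 0 \<or> w \<bullet> y = 2" if w: "w \<in> A\<^sub>2" for w
      proof -
        have "(q - 1)\<^sup>2 = 1 \<longleftrightarrow> q = 0 \<or> q = 2" for q :: real
          by (auto simp: power2_eq_1_iff)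
        moreover have "(x \<bullet> f w)\<^sup>2 = (w \<bullet> y - 1)\<^sup>2 / 9"
          unfolding y(2) ff[OF y(1) w] inner_commute[of y w] by (simp add: power_divide)
        ultimately show ?thesis by simp
      qed
      then have "{z \<in> ?C. (x \<bullet> z)\<^sup>2 = 1/9} = f ` {w \<in> A2 A u. w \<bullet> y = 0 \<or> w \<bullet> y = 2}"
        by (auto simp: A2)
      moreover have "inj_on f {w \<in> A2 A u. w \<bullet> y = 0 \<or> w \<bullet> y = 2}"
        using inj_f by (rule inj_on_subset) (auto simp: A2)
      ultimately show ?thesis using card_A2_inner[OF Au] y by (simp add: card_image A2)
    qed
    show ?thesis using antipodal_code_optimal[OF h1 h2 h3 h4 h5 h6] by blast
  qed
  show ?thesis using card_hat anti code by (simp add: B)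
qed

end
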